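(* Every right exact morphism of derivators preserves left homotopy finite left Kan extensions; that is, if $F\colon\mathscr{D}\to\mathscr{E}$ is a right exact morphism of derivators and $u\colon A\to B$ is a left homotopy finite functor between small categories, then $F$ preserves left Kan extensions along $u$.
   Context: **Derivators.** $\mathbf{Cat}$ is the 2-category of small categories, $\mathbf{CAT}$ that of not necessarily small categories, $\mathbb{1}$ is the terminal category, $\pi_A\colon A\to\mathbb{1}$ the unique functor; objects $a\in A$ are identified with functors $a\colon\mathbb{1}\to A$. A prederivator is a strict 2-functor $\mathscr{D}\colon\mathbf{Cat}^{\mathrm{op}}\to\mathbf{CAT}$ (op reverses functors only); $u\colon A\to B$ induces $u^\ast\colon\mathscr{D}(B)\to\mathscr{D}(A)$, and $X_a:=a^\ast X$. It is a derivator if: (Der1) $\mathscr{D}$ sends coproducts to products; (Der2) $f$ in $\mathscr{D}(A)$ is an isomorphism iff $f_a$ is so for all $a\in A$; (Der3) each $u^\ast$ has a left adjoint $u_!$ and a right adjoint $u_\ast$ (write $\operatorname{colim}_A=(\pi_A)_!$, $\lim_A=(\pi_A)_\ast$); (Der4) for $u\colon A\to B$, $b\in B$, with projections $p\colon(u/b)\to A$, $q\colon(b/u)\to A$ from the slice categories, the canonical mates $\operatorname{colim}_{(u/b)}p^\ast\to b^\ast u_!$ and $b^\ast u_\ast\to\lim_{(b/u)}q^\ast$ are isomorphisms. **Morphisms.** A morphism $F\colon\mathscr{D}\to\mathscr{E}$ of derivators is a pseudo-natural transformation: functors $F_A\colon\mathscr{D}(A)\to\mathscr{E}(A)$ and coherent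 natural isomorphisms $\gamma_u\colon u^\ast F_B\cong F_Au^\ast$ for $u\colon A\to B$. $F$ preserves left Kan extensions along $u\colon A\to B$ if the canonical mate $$u_!F_A\xrightarrow{\eta}u_!F_Au^\ast u_!\xrightarrow{\gamma_u^{-1}}u_!u^\ast F_Bu_!\xrightarrow{\varepsilon}F_Bu_!$$ is an isomorphism; it preserves colimits of shape $A$ if it preserves left Kan extensions along $\pi_A$. $F$ is right exact if it preserves initial objects (colimits of shape $\emptyset$) and pushouts (colimits of shape $\ulcorner$, where $\ulcorner$ is the full subcategory of $[1]\times[1]$ on all objects except $(1,1)$). **Finiteness.** A small category is strictly homotopy finite if its nerve is a finite simplicial set (finitely many nondegenerate simplices), and homotopy finite if it is equivalent to a strictly homotopy finite category. A functor $v\colon C\to D$ is homotopy final if for every derivator $\mathscr{D}$ and $X\in\mathscr{D}(D)$ the canonical map $\operatorname{colim}_Cv^\ast X\to\operatorname{colim}_DX$ is an isomorphism. A functor $u\colon A\to B$ between small categories is left homotopy finite if for every $b\in B$ there is a homotopy finite category $C_b$ and a homotopy final functor $C_b\to(u/b)$. *)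

theory Defs
  imports Main "HOL-Library.FuncSet"
begin

unbundle cardinal_syntax

text \<open>
  Categories, functors and natural transformations are records whose operations are
  undefined outside their carriers, so that HOL equality of records is the strict equality
  that the definition of a strict 2-functor refers to.
  The term \<open>Cmp C g f\<close> is the composite of \<open>f\<close> followed by \<open>g\<close>.
\<close>

record ('o, 'm) cat =
  Ob :: "'o set"
  Ar :: "'m set"
  Dom :: "'m \<Rightarrow> 'o"
  Cod :: "'m \<Rightarrow> 'o"
  Idn :: "'o \<Rightarrow> 'm"
  Cmp :: "'m \<Rightarrow> 'm \<Rightarrow> 'm"

definition mk_cat :: "'o set \<Rightarrow> 'm set \<Rightarrow> ('m \<Rightarrow> 'o) \<Rightarrow> ('m \<Rightarrow> 'o) \<Rightarrow> ('o \<Rightarrow> 'm) \<Rightarrow>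
    ('m \<Rightarrow> 'm \<Rightarrow> 'm) \<Rightarrow> ('o, 'm) cat" where
  "mk_cat X M d c i k =
    \<lparr> Ob = X, Ar = M, Dom = restrict d M, Cod = restrict c M, Idn = restrict i X,
      Cmp = (\<lambda>g f. if g \<in> M \<and> f \<in> M \<and> c f = d g then k g f else undefined) \<rparr>"

definition is_cat :: "('o, 'm) cat \<Rightarrow> bool" where
  "is_cat C \<longleftrightarrow>
    Dom C \<in> Ar C \<rightarrow>\<^sub>E Ob C \<and> Cod C \<in> Ar C \<rightarrow>\<^sub>E Ob C \<and> Idn C \<in> Ob C \<rightarrow>\<^sub>E Ar C \<and>
    (\<forall>x\<in>Ob C. Dom C (Idn C x) = x \<and> Cod C (Idn C x) = x) \<and>
    (\<forall>f\<in>Ar C. \<forall>g\<in>Ar C. Cod C f = Dom C g \<longrightarrow>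
       Cmp C g f \<in> Ar C \<and> Dom C (Cmp C g f) = Dom C f \<and> Cod C (Cmp C g f) = Cod C g) \<and>
    (\<forall>f g. \<not> (f \<in> Ar C \<and> g \<in> Ar C \<and> Cod C f = Dom C g) \<longrightarrow> Cmp C g f = undefined) \<and>
    (\<forall>f\<in>Ar C. Cmp C f (Idn C (Dom C f)) = f \<and> Cmp C (Idn C (Cod C f)) f = f) \<and>
    (\<forall>f\<in>Ar C. \<forall>g\<in>Ar C. \<forall>h\<in>Ar C. Cod C f = Dom C g \<and> Cod C g = Dom C h \<longrightarrow>
       Cmp C h (Cmp C g f) = Cmp C (Cmp C h g) f)"

definition inverse_arrows :: "('o, 'm) cat \<Rightarrow> 'm \<Rightarrow> 'm \<Rightarrow> bool" where
  "inverse_arrows C f g \<longleftrightarrow> f \<in> Ar C \<and> g \<in> Ar C \<and> Dom C g = Cod C f \<and> Cod C g = Dom C f \<and>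
    Cmp C g f = Idn C (Dom C f) \<and> Cmp C f g = Idn C (Cod C f)"

definition iso_arrow :: "('o, 'm) cat \<Rightarrow> 'm \<Rightarrow> bool" where
  "iso_arrow C f \<longleftrightarrow> (\<exists>g. inverse_arrows C f g)"

record ('o, 'm, 'p, 'n) ftr =
  Src :: "('o, 'm) cat"
  Trg :: "('p, 'n) cat"
  FO :: "'o \<Rightarrow> 'p"
  FA :: "'m \<Rightarrow> 'n"

definition mk_ftr :: "('o, 'm) cat \<Rightarrow> ('p, 'n) cat \<Rightarrow> ('o \<Rightarrow> 'p) \<Rightarrow> ('m \<Rightarrow> 'n) \<Rightarrow>
    ('o, 'm, 'p, 'n) ftr" where
  "mk_ftr C D x m = \<lparr> Src = C, Trg = D, FO = restrict x (Ob C), FA = restrict m (Ar C) \<rparr>"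

definition is_ftr :: "('o, 'm, 'p, 'n) ftr \<Rightarrow> bool" where
  "is_ftr F \<longleftrightarrow>
    is_cat (Src F) \<and> is_cat (Trg F) \<and>
    FO F \<in> Ob (Src F) \<rightarrow>\<^sub>E Ob (Trg F) \<and> FA F \<in> Ar (Src F) \<rightarrow>\<^sub>E Ar (Trg F) \<and>
    (\<forall>f\<in>Ar (Src F). Dom (Trg F) (FA F f) = FO F (Dom (Src F) f) \<and>
                    Cod (Trg F) (FA F f) = FO F (Cod (Src F) f)) \<and>
    (\<forall>x\<in>Ob (Src F). FA F (Idn (Src F) x) = Idn (Trg F) (FO F x)) \<and>
    (\<forall>f\<in>Ar (Src F). \<forall>g\<in>Ar (Src F). Cod (Src F) f = Dom (Src F) g \<longrightarrow>
       FA F (Cmp (Src F) g f) = Cmp (Trg F) (FA F g) (FA F f))"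

definition id_ftr :: "('o, 'm) cat \<Rightarrow> ('o, 'm, 'o, 'm) ftr" where
  "id_ftr C = mk_ftr C C (\<lambda>x. x) (\<lambda>f. f)"

definition comp_ftr :: "('p, 'n, 'q, 'k) ftr \<Rightarrow> ('o, 'm, 'p, 'n) ftr \<Rightarrow> ('o, 'm, 'q, 'k) ftr"
    (infixr "\<bullet>" 75) where
  "G \<bullet> F = mk_ftr (Src F) (Trg G) (\<lambda>x. FO G (FO F x)) (\<lambda>f. FA G (FA F f))"

record ('o, 'm, 'p, 'n) ntr =
  NDom :: "('o, 'm, 'p, 'n) ftr"
  NCod :: "('o, 'm, 'p, 'n) ftr"
  Cpt :: "'o \<Rightarrow> 'n"

definition mk_ntr :: "('o, 'm, 'p, 'n) ftr \<Rightarrow> ('o, 'm, 'p, 'n) ftr \<Rightarrow> ('o \<Rightarrow> 'n) \<Rightarrow>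
    ('o, 'm, 'p, 'n) ntr" where
  "mk_ntr F G t = \<lparr> NDom = F, NCod = G, Cpt = restrict t (Ob (Src F)) \<rparr>"

definition is_ntr :: "('o, 'm, 'p, 'n) ntr \<Rightarrow> bool" where
  "is_ntr \<alpha> \<longleftrightarrow> (let F = NDom \<alpha>; G = NCod \<alpha>; C = Src F; D = Trg F in
    is_ftr F \<and> is_ftr G \<and> Src G = C \<and> Trg G = D \<and>
    Cpt \<alpha> \<in> Ob C \<rightarrow>\<^sub>E Ar D \<and>
    (\<forall>x\<in>Ob C. Dom D (Cpt \<alpha> x) = FO F x \<and> Cod D (Cpt \<alpha> x) = FO G x) \<and>
    (\<forall>f\<in>Ar C. Cmp D (Cpt \<alpha> (Cod C f)) (FA F f) = Cmp D (FA G f) (Cpt \<alpha> (Dom C f))))"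

definition nat_iso :: "('o, 'm, 'p, 'n) ntr \<Rightarrow> bool" where
  "nat_iso \<alpha> \<longleftrightarrow> is_ntr \<alpha> \<and> (\<forall>x\<in>Ob (Src (NDom \<alpha>)). iso_arrow (Trg (NDom \<alpha>)) (Cpt \<alpha> x))"

definition nat_inv :: "('o, 'm, 'p, 'n) ntr \<Rightarrow> ('o, 'm, 'p, 'n) ntr" where
  "nat_inv \<alpha> = mk_ntr (NCod \<alpha>) (NDom \<alpha>)
     (\<lambda>x. THE g. inverse_arrows (Trg (NDom \<alpha>)) (Cpt \<alpha> x) g)"

definition id_ntr :: "('o, 'm, 'p, 'n) ftr \<Rightarrow> ('o, 'm, 'p, 'n) ntr" where
  "id_ntr F = mk_ntr F F (\<lambda>x. Idn (Trg F) (FO F x))"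

definition vcomp :: "('o, 'm, 'p, 'n) ntr \<Rightarrow> ('o, 'm, 'p, 'n) ntr \<Rightarrow> ('o, 'm, 'p, 'n) ntr"
    (infixr "\<odot>" 65) where
  "\<beta> \<odot> \<alpha> = mk_ntr (NDom \<alpha>) (NCod \<beta>) (\<lambda>x. Cmp (Trg (NDom \<alpha>)) (Cpt \<beta> x) (Cpt \<alpha> x))"

text \<open>Whiskering: \<open>G \<lhd> \<alpha>\<close> applies \<open>G\<close> after \<open>\<alpha>\<close>, and \<open>\<alpha> \<rhd> H\<close> applies \<open>H\<close> before \<open>\<alpha>\<close>.\<close>

definition whisker_left :: "('p, 'n, 'q, 'k) ftr \<Rightarrow> ('o, 'm, 'p, 'n) ntr \<Rightarrow> ('o, 'm, 'q, 'k) ntr"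
    (infixr "\<lhd>" 70) where
  "G \<lhd> \<alpha> = mk_ntr (G \<bullet> NDom \<alpha>) (G \<bullet> NCod \<alpha>) (\<lambda>x. FA G (Cpt \<alpha> x))"

definition whisker_right :: "('p, 'n, 'q, 'k) ntr \<Rightarrow> ('o, 'm, 'p, 'n) ftr \<Rightarrow> ('o, 'm, 'q, 'k) ntr"
    (infixl "\<rhd>" 71) where
  "\<alpha> \<rhd> H = mk_ntr (NDom \<alpha> \<bullet> H) (NCod \<alpha> \<bullet> H) (\<lambda>x. Cpt \<alpha> (FO H x))"

text \<open>\<open>adjunction L R \<eta> \<epsilon>\<close>: \<open>L\<close> is left adjoint to \<open>R\<close> with unit \<open>\<eta>\<close> and counit \<open>\<epsilon>\<close>.\<close>

definition adjunction :: "('o, 'm, 'p, 'n) ftr \<Rightarrow> ('p, 'n, 'o, 'm) ftr \<Rightarrow>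
    ('o, 'm, 'o, 'm) ntr \<Rightarrow> ('p, 'n, 'p, 'n) ntr \<Rightarrow> bool" where
  "adjunction L R \<eta> \<epsilon> \<longleftrightarrow>
    is_ftr L \<and> is_ftr R \<and> Src R = Trg L \<and> Trg R = Src L \<and>
    is_ntr \<eta> \<and> NDom \<eta> = id_ftr (Src L) \<and> NCod \<eta> = R \<bullet> L \<and>
    is_ntr \<epsilon> \<and> NDom \<epsilon> = L \<bullet> R \<and> NCod \<epsilon> = id_ftr (Src R) \<and>
    (\<epsilon> \<rhd> L) \<odot> (L \<lhd> \<eta>) = id_ntr L \<and>
    (R \<lhd> \<epsilon>) \<odot> (\<eta> \<rhd> R) = id_ntr R"

definition equivalence_ftr :: "('o, 'm, 'p, 'n) ftr \<Rightarrow> bool" where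
  "equivalence_ftr F \<longleftrightarrow> is_ftr F \<and>
    (\<exists>G \<alpha> \<beta>. is_ftr G \<and> Src G = Trg F \<and> Trg G = Src F \<and>
       nat_iso \<alpha> \<and> NDom \<alpha> = id_ftr (Src F) \<and> NCod \<alpha> = G \<bullet> F \<and>
       nat_iso \<beta> \<and> NDom \<beta> = F \<bullet> G \<and> NCod \<beta> = id_ftr (Trg F))"

definition equivalent_cats :: "('o, 'm) cat \<Rightarrow> ('p, 'n) cat \<Rightarrow> bool" where
  "equivalent_cats C D \<longleftrightarrow> (\<exists>F. equivalence_ftr F \<and> Src F = C \<and> Trg F = D)"

definition product_cat :: "('o, 'm) cat \<Rightarrow> ('p, 'n) cat \<Rightarrow> ('o \<times> 'p, 'm \<times> 'n) cat" where
  "product_cat C D = mk_cat (Ob C \<times> Ob D) (Ar C \<times> Ar D)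
     (\<lambda>(f, g). (Dom C f, Dom D g)) (\<lambda>(f, g). (Cod C f, Cod D g))
     (\<lambda>(x, y). (Idn C x, Idn D y)) (\<lambda>(f', g') (f, g). (Cmp C f' f, Cmp D g' g))"

definition full_subcat :: "('o, 'm) cat \<Rightarrow> 'o set \<Rightarrow> ('o, 'm) cat" where
  "full_subcat C X = mk_cat (Ob C \<inter> X) {f \<in> Ar C. Dom C f \<in> X \<and> Cod C f \<in> X}
     (Dom C) (Cod C) (Idn C) (Cmp C)"

definition product_family :: "'i set \<Rightarrow> ('i \<Rightarrow> ('o, 'm) cat) \<Rightarrow> ('i \<Rightarrow> 'o, 'i \<Rightarrow> 'm) cat" where
  "product_family I C = mk_cat (\<Pi>\<^sub>E i\<in>I. Ob (C i)) (\<Pi>\<^sub>E i\<in>I. Ar (C i))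
     (\<lambda>f. \<lambda>i\<in>I. Dom (C i) (f i)) (\<lambda>f. \<lambda>i\<in>I. Cod (C i) (f i))
     (\<lambda>x. \<lambda>i\<in>I. Idn (C i) (x i)) (\<lambda>g f. \<lambda>i\<in>I. Cmp (C i) (g i) (f i))"

definition coproduct_family :: "'i set \<Rightarrow> ('i \<Rightarrow> ('o, 'm) cat) \<Rightarrow> ('i \<times> 'o, 'i \<times> 'm) cat" where
  "coproduct_family I C = mk_cat (SIGMA i:I. Ob (C i)) (SIGMA i:I. Ar (C i))
     (\<lambda>(i, f). (i, Dom (C i) f)) (\<lambda>(i, f). (i, Cod (C i) f))
     (\<lambda>(i, x). (i, Idn (C i) x)) (\<lambda>(i, g) (j, f). (i, Cmp (C i) g f))"

text \<open>The comma category \<open>u/b\<close>: an object is \<open>(a, f : u a \<rightarrow> b)\<close>,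
  an arrow is \<open>(source, underlying arrow, target)\<close>.\<close>

definition slice_over :: "('o, 'm, 'p, 'n) ftr \<Rightarrow> 'p \<Rightarrow>
    ('o \<times> 'n, ('o \<times> 'n) \<times> 'm \<times> ('o \<times> 'n)) cat" where
  "slice_over u b = (let A = Src u; B = Trg u;
      X = {(a, f). a \<in> Ob A \<and> f \<in> Ar B \<and> Dom B f = FO u a \<and> Cod B f = b} in
    mk_cat X
      {(s, g, t). s \<in> X \<and> t \<in> X \<and> g \<in> Ar A \<and> Dom A g = fst s \<and> Cod A g = fst t \<and>
         Cmp B (snd t) (FA u g) = snd s}
      (\<lambda>(s, g, t). s) (\<lambda>(s, g, t). t) (\<lambda>s. (s, Idn A (fst s), s))
      (\<lambda>(s', g', t') (s, g, t). (s, Cmp A g' g, t')))"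

text \<open>The comma category \<open>b/u\<close>: an object is \<open>(a, f : b \<rightarrow> u a)\<close>.\<close>

definition slice_under :: "('o, 'm, 'p, 'n) ftr \<Rightarrow> 'p \<Rightarrow>
    ('o \<times> 'n, ('o \<times> 'n) \<times> 'm \<times> ('o \<times> 'n)) cat" where
  "slice_under u b = (let A = Src u; B = Trg u;
      X = {(a, f). a \<in> Ob A \<and> f \<in> Ar B \<and> Dom B f = b \<and> Cod B f = FO u a} in
    mk_cat X
      {(s, g, t). s \<in> X \<and> t \<in> X \<and> g \<in> Ar A \<and> Dom A g = fst s \<and> Cod A g = fst t \<and>
         Cmp B (FA u g) (snd s) = snd t}
      (\<lambda>(s, g, t). s) (\<lambda>(s, g, t). t) (\<lambda>s. (s, Idn A (fst s), s))
      (\<lambda>(s', g', t') (s, g, t). (s, Cmp A g' g, t')))"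

text \<open>The poset \<open>[n]\<close> and the functor \<open>[m] \<rightarrow> [n]\<close> given by an order-preserving map.\<close>

definition ord_cat :: "nat \<Rightarrow> (nat, nat \<times> nat) cat" where
  "ord_cat n = mk_cat {..n} {(i, j). i \<le> j \<and> j \<le> n} fst snd (\<lambda>i. (i, i))
     (\<lambda>(j', k) (i, j). (i, k))"

definition ord_ftr :: "nat \<Rightarrow> nat \<Rightarrow> (nat \<Rightarrow> nat) \<Rightarrow> (nat, nat \<times> nat, nat, nat \<times> nat) ftr" where
  "ord_ftr m n \<theta> = mk_ftr (ord_cat m) (ord_cat n) \<theta> (\<lambda>(i, j). (\<theta> i, \<theta> j))"

text \<open>\<open>Act X m n \<theta>\<close> is the map \<open>X\<^sub>n \<rightarrow> X\<^sub>m\<close> induced by \<open>\<theta> : [m] \<rightarrow> [n]\<close>.\<close>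

record 'x sset =
  Simp :: "nat \<Rightarrow> 'x set"
  Act :: "nat \<Rightarrow> nat \<Rightarrow> (nat \<Rightarrow> nat) \<Rightarrow> 'x \<Rightarrow> 'x"

definition degenerate :: "'x sset \<Rightarrow> nat \<Rightarrow> 'x \<Rightarrow> bool" where
  "degenerate X n x \<longleftrightarrow> (\<exists>m<n. \<exists>\<sigma>. mono_on {..n} \<sigma> \<and> \<sigma> ` {..n} = {..m} \<and>
     (\<exists>y\<in>Simp X m. x = Act X n m \<sigma> y))"

definition finite_sset :: "'x sset \<Rightarrow> bool" where
  "finite_sset X \<longleftrightarrow> finite {(n, x). x \<in> Simp X n \<and> \<not> degenerate X n x}"

definition nerve :: "('o, 'm) cat \<Rightarrow> (nat, nat \<times> nat, 'o, 'm) ftr sset" where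
  "nerve C = \<lparr> Simp = (\<lambda>n. {x. is_ftr x \<and> Src x = ord_cat n \<and> Trg x = C}),
               Act = (\<lambda>m n \<theta> x. x \<bullet> ord_ftr m n \<theta>) \<rparr>"

text \<open>
  The carrier of every small category is a subset of a fixed type \<open>'u\<close>, the ``universe''.
  A subset is small if it has strictly smaller cardinality than \<open>'u\<close>, and \<open>'u\<close> is required
  to be uncountable and regular.  If \<open>U\<close> is a Grothendieck universe containing an infinite
  set and \<open>'u\<close> is a type in bijection with \<open>U\<close>, then the small sets are, up to bijection,
  exactly the elements of \<open>U\<close>.  Closure under power sets is not required because none of
  the notions below uses it.
\<close>

definition small_set :: "'u set \<Rightarrow> bool" where
  "small_set S \<longleftrightarrow> |S| <o |UNIV :: 'u set|"

definition universe :: "'u itself \<Rightarrow> bool" where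
  "universe (_ :: 'u itself) \<longleftrightarrow>
    (\<exists>N :: 'u set. infinite N \<and> small_set N) \<and>
    (\<forall>(I :: 'u set) (S :: 'u \<Rightarrow> 'u set). small_set I \<and> (\<forall>i\<in>I. small_set (S i)) \<longrightarrow>
       small_set (\<Union>i\<in>I. S i))"

type_synonym 'u scat = "('u, 'u) cat"
type_synonym 'u sftr = "('u, 'u, 'u, 'u) ftr"
type_synonym 'u sntr = "('u, 'u, 'u, 'u) ntr"

definition small_cat :: "'u scat \<Rightarrow> bool" where
  "small_cat A \<longleftrightarrow> is_cat A \<and> small_set (Ob A) \<and> small_set (Ar A)"

definition small_ftr :: "'u sftr \<Rightarrow> bool" where
  "small_ftr u \<longleftrightarrow> is_ftr u \<and> small_cat (Src u) \<and> small_cat (Trg u)"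

definition small_ntr :: "'u sntr \<Rightarrow> bool" where
  "small_ntr \<alpha> \<longleftrightarrow> is_ntr \<alpha> \<and> small_ftr (NDom \<alpha>) \<and> small_ftr (NCod \<alpha>)"

text \<open>
  Slices, coproducts and the span shape are built on product types or on \<open>nat\<close>; \<open>small_copy\<close>
  transports them along an arbitrary injection into \<open>'u\<close>.  Such an injection exists whenever
  \<open>'u\<close> is infinite, for \<open>nat\<close> and for all iterated products of \<open>'u\<close> and \<open>nat\<close>.
\<close>

definition code :: "'a \<Rightarrow> 'u" where
  "code = (SOME f. inj f)"

definition decode :: "'u \<Rightarrow> 'a" where
  "decode = inv code"

definition small_copy :: "('o, 'm) cat \<Rightarrow> 'u scat" where
  "small_copy C = mk_cat (code ` Ob C) (code ` Ar C)
     (\<lambda>f. code (Dom C (decode f))) (\<lambda>f. code (Cod C (decode f)))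
     (\<lambda>x. code (Idn C (decode x))) (\<lambda>g f. code (Cmp C (decode g) (decode f)))"

definition one_cat :: "'u scat" where
  "one_cat = mk_cat {undefined} {undefined} (\<lambda>_. undefined) (\<lambda>_. undefined) (\<lambda>_. undefined)
     (\<lambda>_ _. undefined)"

definition empty_cat :: "'u scat" where
  "empty_cat = mk_cat {} {} undefined undefined undefined undefined"

definition to_one :: "'u scat \<Rightarrow> 'u sftr" where
  "to_one A = mk_ftr A one_cat (\<lambda>_. undefined) (\<lambda>_. undefined)"

definition point :: "'u scat \<Rightarrow> 'u \<Rightarrow> 'u sftr" where
  "point A a = mk_ftr one_cat A (\<lambda>_. a) (\<lambda>_. Idn A a)"

definition span_cat :: "'u scat" where
  "span_cat = small_copy (full_subcat (product_cat (ord_cat 1) (ord_cat 1))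
     (Ob (product_cat (ord_cat 1) (ord_cat 1)) - {(1, 1)}))"

definition small_coproduct :: "'u set \<Rightarrow> ('u \<Rightarrow> 'u scat) \<Rightarrow> 'u scat" where
  "small_coproduct I A = small_copy (coproduct_family I A)"

definition coproj :: "'u set \<Rightarrow> ('u \<Rightarrow> 'u scat) \<Rightarrow> 'u \<Rightarrow> 'u sftr" where
  "coproj I A i = mk_ftr (A i) (small_coproduct I A) (\<lambda>x. code (i, x)) (\<lambda>f. code (i, f))"

definition over :: "'u sftr \<Rightarrow> 'u \<Rightarrow> 'u scat" where
  "over u b = small_copy (slice_over u b)"

definition over_proj :: "'u sftr \<Rightarrow> 'u \<Rightarrow> 'u sftr" where
  "over_proj u b = mk_ftr (over u b) (Src u)
     (\<lambda>x. fst (decode x :: 'u \<times> 'u))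
     (\<lambda>m. fst (snd (decode m :: ('u \<times> 'u) \<times> 'u \<times> ('u \<times> 'u))))"

definition under :: "'u sftr \<Rightarrow> 'u \<Rightarrow> 'u scat" where
  "under u b = small_copy (slice_under u b)"

definition under_proj :: "'u sftr \<Rightarrow> 'u \<Rightarrow> 'u sftr" where
  "under_proj u b = mk_ftr (under u b) (Src u)
     (\<lambda>x. fst (decode x :: 'u \<times> 'u))
     (\<lambda>m. fst (snd (decode m :: ('u \<times> 'u) \<times> 'u \<times> ('u \<times> 'u))))"

text \<open>The canonical 2-cells \<open>u p \<Rightarrow> b \<pi>\<close> on \<open>u/b\<close> and \<open>b \<pi> \<Rightarrow> u q\<close> on \<open>b/u\<close>.\<close>

definition over_cell :: "'u sftr \<Rightarrow> 'u \<Rightarrow> 'u sntr" where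
  "over_cell u b = mk_ntr (u \<bullet> over_proj u b) (point (Trg u) b \<bullet> to_one (over u b))
     (\<lambda>x. snd (decode x :: 'u \<times> 'u))"

definition under_cell :: "'u sftr \<Rightarrow> 'u \<Rightarrow> 'u sntr" where
  "under_cell u b = mk_ntr (point (Trg u) b \<bullet> to_one (under u b)) (u \<bullet> under_proj u b)
     (\<lambda>x. snd (decode x :: 'u \<times> 'u))"

text \<open>
  The values of a prederivator are categories with objects in a type \<open>'o\<close> and arrows in a
  type \<open>'m\<close>, with no size restriction; the pair \<open>('o, 'm)\<close> plays the role of \<open>CAT\<close>.
\<close>

record ('u, 'o, 'm) prederiv =
  DO :: "'u scat \<Rightarrow> ('o, 'm) cat"
  DF :: "'u sftr \<Rightarrow> ('o, 'm, 'o, 'm) ftr"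
  DN :: "'u sntr \<Rightarrow> ('o, 'm, 'o, 'm) ntr"

definition prederivator :: "('u, 'o, 'm) prederiv \<Rightarrow> bool" where
  "prederivator D \<longleftrightarrow>
    (\<forall>A. small_cat A \<longrightarrow> is_cat (DO D A) \<and> DF D (id_ftr A) = id_ftr (DO D A)) \<and>
    (\<forall>u. small_ftr u \<longrightarrow>
       is_ftr (DF D u) \<and> Src (DF D u) = DO D (Trg u) \<and> Trg (DF D u) = DO D (Src u) \<and>
       DN D (id_ntr u) = id_ntr (DF D u)) \<and>
    (\<forall>u v. small_ftr u \<and> small_ftr v \<and> Src v = Trg u \<longrightarrow> DF D (v \<bullet> u) = DF D u \<bullet> DF D v) \<and>
    (\<forall>\<alpha>. small_ntr \<alpha> \<longrightarrow>
       is_ntr (DN D \<alpha>) \<and> NDom (DN D \<alpha>) = DF D (NDom \<alpha>) \<and> NCod (DN D \<alpha>) = DF D (NCod \<alpha>)) \<and>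
    (\<forall>\<alpha> \<beta>. small_ntr \<alpha> \<and> small_ntr \<beta> \<and> NDom \<beta> = NCod \<alpha> \<longrightarrow>
       DN D (\<beta> \<odot> \<alpha>) = DN D \<beta> \<odot> DN D \<alpha>) \<and>
    (\<forall>\<alpha> v. small_ntr \<alpha> \<and> small_ftr v \<and> Src v = Trg (NDom \<alpha>) \<longrightarrow>
       DN D (v \<lhd> \<alpha>) = DN D \<alpha> \<rhd> DF D v) \<and>
    (\<forall>\<alpha> t. small_ntr \<alpha> \<and> small_ftr t \<and> Trg t = Src (NDom \<alpha>) \<longrightarrow>
       DN D (\<alpha> \<rhd> t) = DF D t \<lhd> DN D \<alpha>)"

definition left_kan :: "('u, 'o, 'm) prederiv \<Rightarrow> 'u sftr \<Rightarrow> ('o, 'm, 'o, 'm) ftr \<Rightarrow>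
    ('o, 'm, 'o, 'm) ntr \<Rightarrow> ('o, 'm, 'o, 'm) ntr \<Rightarrow> bool" where
  "left_kan D u L \<eta> \<epsilon> \<longleftrightarrow> adjunction L (DF D u) \<eta> \<epsilon>"

definition right_kan :: "('u, 'o, 'm) prederiv \<Rightarrow> 'u sftr \<Rightarrow> ('o, 'm, 'o, 'm) ftr \<Rightarrow>
    ('o, 'm, 'o, 'm) ntr \<Rightarrow> ('o, 'm, 'o, 'm) ntr \<Rightarrow> bool" where
  "right_kan D u R \<eta> \<epsilon> \<longleftrightarrow> adjunction (DF D u) R \<eta> \<epsilon>"

text \<open>
  For \<open>\<alpha> : u p \<Rightarrow> w q\<close>, the mate
  \<open>q\<^sub>! p\<^sup>* \<rightarrow> q\<^sub>! p\<^sup>* u\<^sup>* u\<^sub>! \<rightarrow> q\<^sub>! q\<^sup>* w\<^sup>* u\<^sub>! \<rightarrow> w\<^sup>* u\<^sub>!\<close>, where \<open>Lu\<close>, \<open>\<eta>u\<close> are \<open>u\<^sub>!\<close> and the unit of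
  \<open>u\<^sub>! \<stileturn> u\<^sup>*\<close>, and \<open>Lq\<close>, \<open>\<epsilon>q\<close> are \<open>q\<^sub>!\<close> and the counit of \<open>q\<^sub>! \<stileturn> q\<^sup>*\<close>.
\<close>

definition left_mate :: "('u, 'o, 'm) prederiv \<Rightarrow> 'u sftr \<Rightarrow> 'u sftr \<Rightarrow> 'u sntr \<Rightarrow>
    ('o, 'm, 'o, 'm) ftr \<Rightarrow> ('o, 'm, 'o, 'm) ntr \<Rightarrow>
    ('o, 'm, 'o, 'm) ftr \<Rightarrow> ('o, 'm, 'o, 'm) ntr \<Rightarrow> ('o, 'm, 'o, 'm) ntr" where
  "left_mate D p w \<alpha> Lu \<eta>u Lq \<epsilon>q =
     (\<epsilon>q \<rhd> (DF D w \<bullet> Lu)) \<odot> (Lq \<lhd> (DN D \<alpha> \<rhd> Lu)) \<odot> (Lq \<lhd> (DF D p \<lhd> \<eta>u))"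

text \<open>
  For \<open>\<alpha> : w q \<Rightarrow> u p\<close>, the mate
  \<open>w\<^sup>* u\<^sub>* \<rightarrow> q\<^sub>* q\<^sup>* w\<^sup>* u\<^sub>* \<rightarrow> q\<^sub>* p\<^sup>* u\<^sup>* u\<^sub>* \<rightarrow> q\<^sub>* p\<^sup>*\<close>, where \<open>Ru\<close>, \<open>\<epsilon>u\<close> are \<open>u\<^sub>*\<close> and the counit of
  \<open>u\<^sup>* \<stileturn> u\<^sub>*\<close>, and \<open>Rq\<close>, \<open>\<eta>q\<close> are \<open>q\<^sub>*\<close> and the unit of \<open>q\<^sup>* \<stileturn> q\<^sub>*\<close>.
\<close>

definition right_mate :: "('u, 'o, 'm) prederiv \<Rightarrow> 'u sftr \<Rightarrow> 'u sftr \<Rightarrow> 'u sntr \<Rightarrow>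
    ('o, 'm, 'o, 'm) ftr \<Rightarrow> ('o, 'm, 'o, 'm) ntr \<Rightarrow>
    ('o, 'm, 'o, 'm) ftr \<Rightarrow> ('o, 'm, 'o, 'm) ntr \<Rightarrow> ('o, 'm, 'o, 'm) ntr" where
  "right_mate D p w \<alpha> Ru \<epsilon>u Rq \<eta>q =
     (Rq \<lhd> (DF D p \<lhd> \<epsilon>u)) \<odot> (Rq \<lhd> (DN D \<alpha> \<rhd> Ru)) \<odot> (\<eta>q \<rhd> (DF D w \<bullet> Ru))"

definition restriction_to_product :: "('u, 'o, 'm) prederiv \<Rightarrow> 'u set \<Rightarrow> ('u \<Rightarrow> 'u scat) \<Rightarrow>
    ('o, 'm, 'u \<Rightarrow> 'o, 'u \<Rightarrow> 'm) ftr" where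
  "restriction_to_product D I A =
     mk_ftr (DO D (small_coproduct I A)) (product_family I (\<lambda>i. DO D (A i)))
       (\<lambda>X. \<lambda>i\<in>I. FO (DF D (coproj I A i)) X) (\<lambda>f. \<lambda>i\<in>I. FA (DF D (coproj I A i)) f)"

definition Der1 :: "('u, 'o, 'm) prederiv \<Rightarrow> bool" where
  "Der1 D \<longleftrightarrow> (\<forall>I A. small_set I \<and> (\<forall>i\<in>I. small_cat (A i)) \<longrightarrow>
     equivalence_ftr (restriction_to_product D I A))"

definition Der2 :: "('u, 'o, 'm) prederiv \<Rightarrow> bool" where
  "Der2 D \<longleftrightarrow> (\<forall>A f. small_cat A \<and> f \<in> Ar (DO D A) \<longrightarrow>
     (iso_arrow (DO D A) f \<longleftrightarrow>
      (\<forall>a\<in>Ob A. iso_arrow (DO D one_cat) (FA (DF D (point A a)) f))))"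

definition Der3 :: "('u, 'o, 'm) prederiv \<Rightarrow> bool" where
  "Der3 D \<longleftrightarrow> (\<forall>u. small_ftr u \<longrightarrow>
     (\<exists>L \<eta> \<epsilon>. left_kan D u L \<eta> \<epsilon>) \<and> (\<exists>R \<eta> \<epsilon>. right_kan D u R \<eta> \<epsilon>))"

text \<open>
  Whether a mate is invertible does not depend on the chosen adjoints; here and below the
  condition is imposed for every choice.
\<close>

definition Der4 :: "('u, 'o, 'm) prederiv \<Rightarrow> bool" where
  "Der4 D \<longleftrightarrow> (\<forall>u b. small_ftr u \<and> b \<in> Ob (Trg u) \<longrightarrow>
     (\<forall>Lu \<eta>u \<epsilon>u Lq \<eta>q \<epsilon>q.
        left_kan D u Lu \<eta>u \<epsilon>u \<and> left_kan D (to_one (over u b)) Lq \<eta>q \<epsilon>q \<longrightarrow>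
        nat_iso (left_mate D (over_proj u b) (point (Trg u) b) (over_cell u b) Lu \<eta>u Lq \<epsilon>q)) \<and>
     (\<forall>Ru \<eta>u \<epsilon>u Rq \<eta>q \<epsilon>q.
        right_kan D u Ru \<eta>u \<epsilon>u \<and> right_kan D (to_one (under u b)) Rq \<eta>q \<epsilon>q \<longrightarrow>
        nat_iso (right_mate D (under_proj u b) (point (Trg u) b) (under_cell u b) Ru \<epsilon>u Rq \<eta>q)))"

definition derivator :: "('u, 'o, 'm) prederiv \<Rightarrow> bool" where
  "derivator D \<longleftrightarrow> prederivator D \<and> Der1 D \<and> Der2 D \<and> Der3 D \<and> Der4 D"

record ('u, 'o, 'm) dmor =
  MF :: "'u scat \<Rightarrow> ('o, 'm, 'o, 'm) ftr"
  MN :: "'u sftr \<Rightarrow> ('o, 'm, 'o, 'm) ntr"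

definition derivator_morphism :: "('u, 'o, 'm) prederiv \<Rightarrow> ('u, 'o, 'm) prederiv \<Rightarrow>
    ('u, 'o, 'm) dmor \<Rightarrow> bool" where
  "derivator_morphism D E F \<longleftrightarrow>
    (\<forall>A. small_cat A \<longrightarrow>
       is_ftr (MF F A) \<and> Src (MF F A) = DO D A \<and> Trg (MF F A) = DO E A \<and>
       MN F (id_ftr A) = id_ntr (MF F A)) \<and>
    (\<forall>u. small_ftr u \<longrightarrow>
       nat_iso (MN F u) \<and> NDom (MN F u) = DF E u \<bullet> MF F (Trg u) \<and>
       NCod (MN F u) = MF F (Src u) \<bullet> DF D u) \<and>
    (\<forall>u v. small_ftr u \<and> small_ftr v \<and> Src v = Trg u \<longrightarrow>
       MN F (v \<bullet> u) = (MN F u \<rhd> DF D v) \<odot> (DF E u \<lhd> MN F v)) \<and>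
    (\<forall>\<alpha>. small_ntr \<alpha> \<longrightarrow>
       (MF F (Src (NDom \<alpha>)) \<lhd> DN D \<alpha>) \<odot> MN F (NDom \<alpha>) =
       MN F (NCod \<alpha>) \<odot> (DN E \<alpha> \<rhd> MF F (Trg (NDom \<alpha>))))"

text \<open>\<open>LD\<close>, \<open>\<eta>D\<close> belong to \<open>u\<^sub>! \<stileturn> u\<^sup>*\<close> in the source derivator \<open>D\<close>; \<open>LE\<close>, \<open>\<epsilon>E\<close> belong to it
  in the target.\<close>

definition morphism_mate :: "('u, 'o, 'm) dmor \<Rightarrow> 'u sftr \<Rightarrow>
    ('o, 'm, 'o, 'm) ftr \<Rightarrow> ('o, 'm, 'o, 'm) ntr \<Rightarrow>
    ('o, 'm, 'o, 'm) ftr \<Rightarrow> ('o, 'm, 'o, 'm) ntr \<Rightarrow> ('o, 'm, 'o, 'm) ntr" where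
  "morphism_mate F u LD \<eta>D LE \<epsilon>E =
     (\<epsilon>E \<rhd> (MF F (Trg u) \<bullet> LD)) \<odot> (LE \<lhd> (nat_inv (MN F u) \<rhd> LD)) \<odot>
     (LE \<lhd> (MF F (Src u) \<lhd> \<eta>D))"

definition preserves_left_kan :: "('u, 'o, 'm) prederiv \<Rightarrow> ('u, 'o, 'm) prederiv \<Rightarrow>
    ('u, 'o, 'm) dmor \<Rightarrow> 'u sftr \<Rightarrow> bool" where
  "preserves_left_kan D E F u \<longleftrightarrow> (\<forall>LD \<eta>D \<epsilon>D LE \<eta>E \<epsilon>E.
     left_kan D u LD \<eta>D \<epsilon>D \<and> left_kan E u LE \<eta>E \<epsilon>E \<longrightarrow>
     nat_iso (morphism_mate F u LD \<eta>D LE \<epsilon>E))"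

definition preserves_colimits :: "('u, 'o, 'm) prederiv \<Rightarrow> ('u, 'o, 'm) prederiv \<Rightarrow>
    ('u, 'o, 'm) dmor \<Rightarrow> 'u scat \<Rightarrow> bool" where
  "preserves_colimits D E F A \<longleftrightarrow> preserves_left_kan D E F (to_one A)"

definition right_exact :: "('u, 'o, 'm) prederiv \<Rightarrow> ('u, 'o, 'm) prederiv \<Rightarrow>
    ('u, 'o, 'm) dmor \<Rightarrow> bool" where
  "right_exact D E F \<longleftrightarrow>
     preserves_colimits D E F empty_cat \<and> preserves_colimits D E F span_cat"

definition strictly_homotopy_finite :: "'u scat \<Rightarrow> bool" where
  "strictly_homotopy_finite C \<longleftrightarrow> small_cat C \<and> finite_sset (nerve C)"

definition homotopy_finite :: "'u scat \<Rightarrow> bool" where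
  "homotopy_finite C \<longleftrightarrow> small_cat C \<and>
     (\<exists>C' :: 'u scat. strictly_homotopy_finite C' \<and> equivalent_cats C C')"

text \<open>
  The type argument fixes \<open>CAT\<close>: ``every derivator'' is every derivator with values in
  categories with objects in \<open>'o\<close> and arrows in \<open>'m\<close>.  The canonical map is the mate of the
  identity 2-cell \<open>\<pi> v = \<pi>\<close>.
\<close>

definition homotopy_final :: "('o \<times> 'm) itself \<Rightarrow> 'u sftr \<Rightarrow> bool" where
  "homotopy_final (_ :: ('o \<times> 'm) itself) v \<longleftrightarrow> small_ftr v \<and>
     (\<forall>(D :: ('u, 'o, 'm) prederiv) LD \<eta>D \<epsilon>D LC \<eta>C \<epsilon>C.
        derivator D \<and> left_kan D (to_one (Trg v)) LD \<eta>D \<epsilon>D \<and>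
        left_kan D (to_one (Src v)) LC \<eta>C \<epsilon>C \<longrightarrow>
        nat_iso (left_mate D v (id_ftr one_cat) (id_ntr (to_one (Src v))) LD \<eta>D LC \<epsilon>C))"

definition left_homotopy_finite :: "('o \<times> 'm) itself \<Rightarrow> 'u sftr \<Rightarrow> bool" where
  "left_homotopy_finite T u \<longleftrightarrow> small_ftr u \<and>
     (\<forall>b\<in>Ob (Trg u). \<exists>v. homotopy_finite (Src v) \<and> Trg v = over u b \<and> homotopy_final T v)"

end

theory Submission
  imports Defs
begin

text \<open>
  The value of \<open>u\<^sub>!\<close> at \<open>b\<close> is the colimit over \<open>u/b\<close> (Der4), and isomorphisms are detected at the
  objects \<open>b\<close> (Der2).  So \<open>F\<close> preserves left Kan extensions along \<open>u\<close> as soon as it preserves colimits of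
  shape \<open>u/b\<close> for all \<open>b\<close> (\<open>preserves_universal_pointwise\<close>).  A final functor \<open>K \<rightarrow> C\<close> transports the
  preservation of colimits from \<open>K\<close> to \<open>C\<close> (\<open>preserves_colimits_final\<close>), and equivalences are final
  (\<open>colimit_final_equivalence\<close>).  It remains to show that a right exact \<open>F\<close> preserves colimits whose
  shape \<open>C\<close> has a finite nerve.

  A cycle of nonidentity arrows would give nondegenerate simplices of every dimension.  Hence \<open>C\<close> is a
  finite category with a height function that increases along every nonidentity arrow
  (\<open>nerve_finite_graded\<close>).  Let \<open>m\<close> be an object of maximal height, \<open>C' = C - m\<close>, and let \<open>C'/m\<close> be the
  category of nonidentity arrows into \<open>m\<close>.  Then the colimit of \<open>X\<close> is the pushout of
  \<open>colim\<^bsub>C'\<^esub> X \<leftarrow> colim\<^bsub>C'/m\<^esub> X \<rightarrow> X\<^sub>m\<close>.  The arrows in \<open>C'/m\<close> start below the height of \<open>m\<close>, and \<open>C'\<close> has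
  fewer objects than \<open>C\<close>, so an induction on the bound for the height and then on the number of objects
  proves the claim (\<open>graded_preserves\<close>).

  The pushout formula is obtained without coherent squares.  Let \<open>K\<close> be the double mapping cylinder of
  \<open>C' \<leftarrow> C'/m \<rightarrow> 1\<close>.  It maps to the span category by \<open>v\<close> and to \<open>C\<close> by a projection \<open>q\<close>.  The slices of
  \<open>v\<close> admit final functors from \<open>C'/m\<close>, from \<open>C'\<close> and from the point; so \<open>F\<close> preserves Kan extensions
  along \<open>v\<close>, colimits of spans, and therefore colimits of shape \<open>K\<close>.  And \<open>q\<close> is final
  (\<open>cyl_proj_final\<close>): by the formula for right Kan extensions it suffices that arrows between constant
  diagrams on \<open>c/q\<close> are constant (\<open>colimit_final_under\<close>), and this follows from a pair of natural
  transformations connecting the identity of \<open>c/q\<close> with a constant functor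
  (\<open>contraction_fully_faithful\<close>).

  Mates are avoided throughout.  The mate of a 2-cell is the transpose of an arrow built from a unit, so
  it is invertible if and only if that arrow is universal (\<open>transpose_iso_iff_universal\<close>).  All arguments
  are therefore about arrows \<open>X \<rightarrow> u\<^sup>* Z\<close>, which can be composed, restricted and pasted with 2-cells; a
  morphism of derivators acts on them compatibly with these operations (\<open>lift_comp\<close>, \<open>lift_restrict\<close>,
  \<open>lift_pasted\<close>).
\<close>

section \<open>Hom-sets, functors and natural transformations\<close>

definition hom :: "('o, 'm) cat \<Rightarrow> 'o \<Rightarrow> 'o \<Rightarrow> 'm set" where
  "hom C x y = {f \<in> Ar C. Dom C f = x \<and> Cod C f = y}"

lemma hom_iff: "f \<in> hom C x y \<longleftrightarrow> f \<in> Ar C \<and> Dom C f = x \<and> Cod C f = y"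
  by (simp add: hom_def)

lemma Dom_ob [intro]: "is_cat C \<Longrightarrow> f \<in> Ar C \<Longrightarrow> Dom C f \<in> Ob C"
  unfolding is_cat_def by (meson PiE_mem)

lemma Cod_ob [intro]: "is_cat C \<Longrightarrow> f \<in> Ar C \<Longrightarrow> Cod C f \<in> Ob C"
  unfolding is_cat_def by (meson PiE_mem)

lemma hom_ob: "is_cat C \<Longrightarrow> f \<in> hom C x y \<Longrightarrow> x \<in> Ob C \<and> y \<in> Ob C"
  by (auto simp: hom_iff)

lemma cat_id: "is_cat C \<Longrightarrow> x \<in> Ob C \<Longrightarrow> Idn C x \<in> hom C x x"
  unfolding is_cat_def hom_iff by (meson PiE_mem)

lemma cat_comp: "is_cat C \<Longrightarrow> g \<in> hom C y z \<Longrightarrow> f \<in> hom C x y \<Longrightarrow> Cmp C g f \<in> hom C x z"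
  unfolding is_cat_def hom_iff by simp

lemma cat_assoc:
  "is_cat C \<Longrightarrow> f \<in> hom C w x \<Longrightarrow> g \<in> hom C x y \<Longrightarrow> h \<in> hom C y z \<Longrightarrow>
     Cmp C h (Cmp C g f) = Cmp C (Cmp C h g) f"
  unfolding is_cat_def hom_iff by simp

lemma cat_id_right: "is_cat C \<Longrightarrow> f \<in> hom C x y \<Longrightarrow> Cmp C f (Idn C x) = f"
  unfolding is_cat_def hom_iff by auto

lemma cat_id_left: "is_cat C \<Longrightarrow> f \<in> hom C x y \<Longrightarrow> Cmp C (Idn C y) f = f"
  unfolding is_cat_def hom_iff by auto

lemma cat_eqI:
  fixes C D :: "('o, 'm) cat"
  assumes "is_cat C" "is_cat D" "Ob C = Ob D" "Ar C = Ar D"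
    and d: "\<And>f. f \<in> Ar D \<Longrightarrow> Dom C f = Dom D f" and c: "\<And>f. f \<in> Ar D \<Longrightarrow> Cod C f = Cod D f"
    and i: "\<And>x. x \<in> Ob D \<Longrightarrow> Idn C x = Idn D x"
    and k: "\<And>x y z f g. f \<in> hom D x y \<Longrightarrow> g \<in> hom D y z \<Longrightarrow> Cmp C g f = Cmp D g f"
  shows "C = D"
proof -
  have e: "Dom C \<in> Ar D \<rightarrow>\<^sub>E Ob D" "Cod C \<in> Ar D \<rightarrow>\<^sub>E Ob D" "Idn C \<in> Ob D \<rightarrow>\<^sub>E Ar D"
    "Dom D \<in> Ar D \<rightarrow>\<^sub>E Ob D" "Cod D \<in> Ar D \<rightarrow>\<^sub>E Ob D" "Idn D \<in> Ob D \<rightarrow>\<^sub>E Ar D"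
    using assms(1-4) unfolding is_cat_def by simp_all
  have "Dom C = Dom D" "Cod C = Cod D" "Idn C = Idn D"
    using PiE_ext[OF e(1,4) d] PiE_ext[OF e(2,5) c] PiE_ext[OF e(3,6) i] by simp_all
  moreover have kk: "Cmp C g f = Cmp D g f" for g f
  proof (cases "f \<in> Ar D \<and> g \<in> Ar D \<and> Cod D f = Dom D g")
    case True then show ?thesis using k[of f "Dom D f" "Dom D g" g "Cod D g"] by (simp add: hom_iff)
  next
    case False
    have "Cmp C g f = undefined"
      using assms(1) False unfolding is_cat_def assms(4) \<open>Dom C = Dom D\<close> \<open>Cod C = Cod D\<close> by blast
    moreover have "Cmp D g f = undefined"
      using assms(2) False unfolding is_cat_def by blast
    ultimately show ?thesis by simp
  qed
  moreover have "Cmp C = Cmp D" by (intro ext kk)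
  ultimately show ?thesis using assms(3,4) by (auto intro!: cat.equality)
qed

lemma mk_cat_simps [simp]:
  "Ob (mk_cat X M d c i k) = X" "Ar (mk_cat X M d c i k) = M"
  "f \<in> M \<Longrightarrow> Dom (mk_cat X M d c i k) f = d f"
  "f \<in> M \<Longrightarrow> Cod (mk_cat X M d c i k) f = c f"
  "x \<in> X \<Longrightarrow> Idn (mk_cat X M d c i k) x = i x"
  "g \<in> M \<Longrightarrow> f \<in> M \<Longrightarrow> c f = d g \<Longrightarrow> Cmp (mk_cat X M d c i k) g f = k g f"
  by (simp_all add: mk_cat_def)

lemma is_cat_mk_cat:
  assumes "\<And>f. f \<in> M \<Longrightarrow> d f \<in> X \<and> c f \<in> X"
    and "\<And>x. x \<in> X \<Longrightarrow> i x \<in> M \<and> d (i x) = x \<and> c (i x) = x"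
    and "\<And>f g. f \<in> M \<Longrightarrow> g \<in> M \<Longrightarrow> c f = d g \<Longrightarrow> k g f \<in> M \<and> d (k g f) = d f \<and> c (k g f) = c g"
    and "\<And>f. f \<in> M \<Longrightarrow> k f (i (d f)) = f \<and> k (i (c f)) f = f"
    and "\<And>f g h. f \<in> M \<Longrightarrow> g \<in> M \<Longrightarrow> h \<in> M \<Longrightarrow> c f = d g \<Longrightarrow> c g = d h \<Longrightarrow>
      k h (k g f) = k (k h g) f"
  shows "is_cat (mk_cat X M d c i k)"
  unfolding is_cat_def mk_cat_def using assms by auto

subsection \<open>Isomorphisms\<close>

definition isos :: "('o, 'm) cat \<Rightarrow> 'o \<Rightarrow> 'o \<Rightarrow> 'm set" where
  "isos C x y = {f \<in> hom C x y. iso_arrow C f}"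

lemma isos_iff:
  "f \<in> isos C x y \<longleftrightarrow> f \<in> hom C x y \<and>
     (\<exists>g\<in>hom C y x. Cmp C g f = Idn C x \<and> Cmp C f g = Idn C y)"
proof
  assume "f \<in> isos C x y"
  then obtain g where "f \<in> hom C x y" "inverse_arrows C f g" by (auto simp: isos_def iso_arrow_def)
  then show "f \<in> hom C x y \<and> (\<exists>g\<in>hom C y x. Cmp C g f = Idn C x \<and> Cmp C f g = Idn C y)"
    by (intro conjI bexI[of _ g]) (simp_all add: inverse_arrows_def hom_iff)
next
  assume "f \<in> hom C x y \<and> (\<exists>g\<in>hom C y x. Cmp C g f = Idn C x \<and> Cmp C f g = Idn C y)"
  then obtain g where "f \<in> hom C x y" "g \<in> hom C y x" "Cmp C g f = Idn C x" "Cmp C f g = Idn C y"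
    by blast
  then have "inverse_arrows C f g" by (simp add: inverse_arrows_def hom_iff)
  then show "f \<in> isos C x y" using \<open>f \<in> hom C x y\<close> by (auto simp: isos_def iso_arrow_def)
qed

lemma isosI:
  "f \<in> hom C x y \<Longrightarrow> g \<in> hom C y x \<Longrightarrow> Cmp C g f = Idn C x \<Longrightarrow> Cmp C f g = Idn C y \<Longrightarrow>
     f \<in> isos C x y"
  unfolding isos_iff by blast

lemma isosE:
  assumes "f \<in> isos C x y"
  obtains g where "f \<in> hom C x y" "g \<in> hom C y x" "Cmp C g f = Idn C x" "Cmp C f g = Idn C y"
    "g \<in> isos C y x"
proof -
  obtain g where *: "f \<in> hom C x y" "g \<in> hom C y x" "Cmp C g f = Idn C x" "Cmp C f g = Idn C y"
    using assms unfolding isos_iff by auto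
  have "g \<in> isos C y x" using * by (auto simp: isos_iff)
  then show thesis using * that by blast
qed

lemma isos_hom: "f \<in> isos C x y \<Longrightarrow> f \<in> hom C x y"
  by (simp add: isos_def)

lemma isos_arrow: "f \<in> isos C x y \<Longrightarrow> iso_arrow C f"
  by (simp add: isos_def)

lemma isos_id: "is_cat C \<Longrightarrow> x \<in> Ob C \<Longrightarrow> Idn C x \<in> isos C x x"
  by (metis cat_id cat_id_left isosI)

lemma isos_comp:
  assumes C: "is_cat C" and g: "g \<in> isos C y z" and f: "f \<in> isos C x y"
  shows "Cmp C g f \<in> isos C x z"
proof -
  obtain f' where f': "f \<in> hom C x y" "f' \<in> hom C y x" "Cmp C f' f = Idn C x" "Cmp C f f' = Idn C y"
    using f by (rule isosE)
  obtain g' where g': "g \<in> hom C y z" "g' \<in> hom C z y" "Cmp C g' g = Idn C y" "Cmp C g g' = Idn C z"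
    using g by (rule isosE)
  note h = cat_comp[OF C] and a = cat_assoc[OF C]
  have "Cmp C (Cmp C f' g') (Cmp C g f) = Cmp C f' (Cmp C (Cmp C g' g) f)"
    using a[OF f'(1) g'(1,2)] a[OF h[OF g'(1) f'(1)] g'(2) f'(2)] by simp
  then have "Cmp C (Cmp C f' g') (Cmp C g f) = Idn C x"
    using f' g' cat_id_left[OF C f'(1)] by simp
  moreover have "Cmp C (Cmp C g f) (Cmp C f' g') = Cmp C g (Cmp C (Cmp C f f') g')"
    using a[OF g'(2) f'(2,1)] a[OF h[OF f'(2) g'(2)] f'(1) g'(1)] by simp
  then have "Cmp C (Cmp C g f) (Cmp C f' g') = Idn C z"
    using f' g' cat_id_left[OF C g'(2)] by simp
  ultimately show ?thesis using f' g' h by (blast intro: isosI)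
qed

lemma iso_left_cancel:
  assumes C: "is_cat C" and i: "i \<in> isos C y z" and f: "f \<in> hom C x y" and g: "g \<in> hom C x y"
    and eq: "Cmp C i f = Cmp C i g"
  shows "f = g"
proof -
  obtain j where j: "i \<in> hom C y z" "j \<in> hom C z y" "Cmp C j i = Idn C y"
    using i by (rule isosE)
  have "Cmp C (Cmp C j i) f = Cmp C (Cmp C j i) g"
    using cat_assoc[OF C f j(1,2)] cat_assoc[OF C g j(1,2)] eq by simp
  then show ?thesis using j cat_id_left[OF C f] cat_id_left[OF C g] by simp
qed

lemma iso_right_cancel:
  assumes C: "is_cat C" and i: "i \<in> isos C x y" and f: "f \<in> hom C y z" and g: "g \<in> hom C y z"
    and eq: "Cmp C f i = Cmp C g i"
  shows "f = g"
proof -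
  obtain j where j: "i \<in> hom C x y" "j \<in> hom C y x" "Cmp C i j = Idn C y"
    using i by (rule isosE)
  have "Cmp C f (Cmp C i j) = Cmp C g (Cmp C i j)"
    using cat_assoc[OF C j(2,1) f] cat_assoc[OF C j(2,1) g] eq by simp
  then show ?thesis using j cat_id_right[OF C f] cat_id_right[OF C g] by simp
qed

lemma iso_left_factor:
  assumes C: "is_cat C" and i: "i \<in> isos C y z" and f: "f \<in> hom C x y"
    and c: "Cmp C i f \<in> isos C x z"
  shows "f \<in> isos C x y"
proof -
  obtain j where j: "i \<in> hom C y z" "j \<in> hom C z y" "Cmp C j i = Idn C y" "j \<in> isos C z y"
    using i by (rule isosE)
  have "Cmp C j (Cmp C i f) = f"
    using cat_assoc[OF C f j(1,2)] j(3) cat_id_left[OF C f] by simp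
  then show ?thesis using isos_comp[OF C j(4) c] by simp
qed

subsection \<open>Functors\<close>

definition func :: "('o, 'm) cat \<Rightarrow> ('p, 'n) cat \<Rightarrow> ('o, 'm, 'p, 'n) ftr \<Rightarrow> bool" where
  "func C D F \<longleftrightarrow> is_ftr F \<and> Src F = C \<and> Trg F = D"

lemma func_cat: "func C D F \<Longrightarrow> is_cat C" "func C D F \<Longrightarrow> is_cat D"
  by (auto simp: func_def is_ftr_def)

lemma func_ob: "func C D F \<Longrightarrow> x \<in> Ob C \<Longrightarrow> FO F x \<in> Ob D"
  unfolding func_def is_ftr_def by (metis PiE_mem)

lemma func_hom: "func C D F \<Longrightarrow> f \<in> hom C x y \<Longrightarrow> FA F f \<in> hom D (FO F x) (FO F y)"
  unfolding func_def is_ftr_def hom_iff by (metis PiE_mem)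

lemma func_id: "func C D F \<Longrightarrow> x \<in> Ob C \<Longrightarrow> FA F (Idn C x) = Idn D (FO F x)"
  unfolding func_def is_ftr_def by auto

lemma func_comp:
  "func C D F \<Longrightarrow> g \<in> hom C y z \<Longrightarrow> f \<in> hom C x y \<Longrightarrow>
     FA F (Cmp C g f) = Cmp D (FA F g) (FA F f)"
  unfolding func_def is_ftr_def hom_iff by auto

lemma func_isos:
  assumes F: "func C D F" and f: "f \<in> isos C x y"
  shows "FA F f \<in> isos D (FO F x) (FO F y)"
proof -
  obtain g where g: "f \<in> hom C x y" "g \<in> hom C y x" "Cmp C g f = Idn C x" "Cmp C f g = Idn C y"
    using f by (rule isosE)
  have ob: "x \<in> Ob C" "y \<in> Ob C" using hom_ob[OF func_cat(1)[OF F] g(1)] by auto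
  show ?thesis
    using isosI[OF func_hom[OF F g(1)] func_hom[OF F g(2)]] func_id[OF F ob(1)] func_id[OF F ob(2)]
      func_comp[OF F g(2,1)] func_comp[OF F g(1,2)] g(3,4) by simp
qed

lemma mk_ftr_simps [simp]:
  "Src (mk_ftr C D x m) = C" "Trg (mk_ftr C D x m) = D"
  "a \<in> Ob C \<Longrightarrow> FO (mk_ftr C D x m) a = x a"
  "f \<in> Ar C \<Longrightarrow> FA (mk_ftr C D x m) f = m f"
  by (simp_all add: mk_ftr_def)

lemma mk_ftr_hom [simp]: "f \<in> hom C a b \<Longrightarrow> FA (mk_ftr C D x m) f = m f"
  by (simp add: hom_iff)

lemma func_mk_ftr:
  assumes "is_cat C" "is_cat D" "\<And>a. a \<in> Ob C \<Longrightarrow> x a \<in> Ob D"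
    and "\<And>f a b. f \<in> hom C a b \<Longrightarrow> m f \<in> hom D (x a) (x b)"
    and "\<And>a. a \<in> Ob C \<Longrightarrow> m (Idn C a) = Idn D (x a)"
    and "\<And>f g a b c. f \<in> hom C a b \<Longrightarrow> g \<in> hom C b c \<Longrightarrow> m (Cmp C g f) = Cmp D (m g) (m f)"
  shows "func C D (mk_ftr C D x m)"
proof -
  have "m f \<in> hom D (x (Dom C f)) (x (Cod C f))" if "f \<in> Ar C" for f
    using assms(4)[of f "Dom C f" "Cod C f"] that by (simp add: hom_iff)
  moreover have "Idn C a \<in> Ar C" if "a \<in> Ob C" for a
    using cat_id[OF assms(1) that] by (simp add: hom_iff)
  moreover have "Cmp C g f \<in> Ar C \<and> m (Cmp C g f) = Cmp D (m g) (m f)"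
    if "f \<in> Ar C" "g \<in> Ar C" "Cod C f = Dom C g" for f g
    using assms(6)[of f "Dom C f" "Dom C g" g "Cod C g"] that
      cat_comp[OF assms(1), of g "Dom C g" "Cod C g" f] by (simp add: hom_iff)
  ultimately show ?thesis
    using assms(1,2,3,5) unfolding func_def is_ftr_def mk_ftr_def
    by (auto simp: hom_iff Dom_ob Cod_ob)
qed

lemma ftr_eqI:
  assumes F: "func C D F" and G: "func C D G"
    and "\<And>x. x \<in> Ob C \<Longrightarrow> FO F x = FO G x" "\<And>f. f \<in> Ar C \<Longrightarrow> FA F f = FA G f"
  shows "F = G"
proof -
  have e: "FO F \<in> Ob C \<rightarrow>\<^sub>E Ob D" "FO G \<in> Ob C \<rightarrow>\<^sub>E Ob D"
    "FA F \<in> Ar C \<rightarrow>\<^sub>E Ar D" "FA G \<in> Ar C \<rightarrow>\<^sub>E Ar D"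
    using F G unfolding func_def is_ftr_def by auto
  have "FO F = FO G" "FA F = FA G"
    using PiE_ext[OF e(1,2) assms(3)] PiE_ext[OF e(3,4) assms(4)] by simp_all
  moreover have "Src F = Src G" "Trg F = Trg G" using F G by (simp_all add: func_def)
  ultimately show ?thesis by (auto intro!: ftr.equality)
qed

lemma comp_simps [simp]:
  "Src (G \<bullet> F) = Src F" "Trg (G \<bullet> F) = Trg G"
  "x \<in> Ob (Src F) \<Longrightarrow> FO (G \<bullet> F) x = FO G (FO F x)"
  "f \<in> Ar (Src F) \<Longrightarrow> FA (G \<bullet> F) f = FA G (FA F f)"
  by (simp_all add: comp_ftr_def)

lemma comp_hom: "func C D F \<Longrightarrow> f \<in> hom C x y \<Longrightarrow> FA (G \<bullet> F) f = FA G (FA F f)"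
  by (simp add: func_def hom_iff)

lemma comp_ob: "func C D F \<Longrightarrow> x \<in> Ob C \<Longrightarrow> FO (G \<bullet> F) x = FO G (FO F x)"
  by (simp add: func_def)

lemma func_comp_ftr:
  assumes F: "func C D F" and G: "func D E G"
  shows "func C E (G \<bullet> F)"
proof -
  have s: "Src F = C" "Trg G = E" using F G by (simp_all add: func_def)
  show ?thesis unfolding comp_ftr_def s
  proof (rule func_mk_ftr)
    show "is_cat C" "is_cat E" using func_cat[OF F] func_cat[OF G] by auto
    show "FO G (FO F a) \<in> Ob E" if "a \<in> Ob C" for a
      using func_ob[OF G func_ob[OF F that]] .
    show "FA G (FA F f) \<in> hom E (FO G (FO F a)) (FO G (FO F b))" if "f \<in> hom C a b" for f a b
      using func_hom[OF G func_hom[OF F that]] .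
    show "FA G (FA F (Idn C a)) = Idn E (FO G (FO F a))" if "a \<in> Ob C" for a
      using func_id[OF F that] func_id[OF G func_ob[OF F that]] by simp
    show "FA G (FA F (Cmp C g f)) = Cmp E (FA G (FA F g)) (FA G (FA F f))"
      if f: "f \<in> hom C a b" and g: "g \<in> hom C b c" for f g a b c
      using func_comp[OF F g f] func_comp[OF G func_hom[OF F g] func_hom[OF F f]] by simp
  qed
qed

lemma func_id_ftr: "is_cat C \<Longrightarrow> func C C (id_ftr C)"
  unfolding id_ftr_def by (rule func_mk_ftr) auto

lemma id_ftr_simps [simp]:
  "Src (id_ftr C) = C" "Trg (id_ftr C) = C"
  "x \<in> Ob C \<Longrightarrow> FO (id_ftr C) x = x" "f \<in> Ar C \<Longrightarrow> FA (id_ftr C) f = f"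
  by (simp_all add: id_ftr_def)

lemma comp_assoc:
  assumes F: "func A B F" and G: "func B C G" and H: "func C D H"
  shows "H \<bullet> (G \<bullet> F) = (H \<bullet> G) \<bullet> F"
proof (rule ftr_eqI)
  show "func A D (H \<bullet> (G \<bullet> F))" "func A D ((H \<bullet> G) \<bullet> F)"
    using assms by (blast intro: func_comp_ftr)+
  have m: "FA F f \<in> Ar B" if "f \<in> Ar A" for f
    using func_hom[OF F, of f "Dom A f" "Cod A f"] that by (simp add: hom_iff)
  show "FO (H \<bullet> (G \<bullet> F)) x = FO ((H \<bullet> G) \<bullet> F) x" if "x \<in> Ob A" for x
    using assms that func_ob[OF F that] by (simp add: func_def)
  show "FA (H \<bullet> (G \<bullet> F)) f = FA ((H \<bullet> G) \<bullet> F) f" if "f \<in> Ar A" for f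
    using assms that m[OF that] by (simp add: func_def)
qed

lemma comp_id_right:
  assumes "func A B F" shows "F \<bullet> id_ftr A = F"
  by (rule ftr_eqI[OF func_comp_ftr[OF func_id_ftr assms] assms])
    (use assms func_cat(1)[OF assms] in auto)

lemma func_ar: "func C D F \<Longrightarrow> f \<in> Ar C \<Longrightarrow> FA F f \<in> Ar D"
  unfolding func_def is_ftr_def by (metis PiE_mem)

lemma comp_id_left:
  assumes "func A B F" shows "id_ftr B \<bullet> F = F"
  by (rule ftr_eqI[OF func_comp_ftr[OF assms func_id_ftr] assms])
    (use assms func_ob[OF assms] func_ar[OF assms] in \<open>auto simp: comp_ob func_cat[OF assms] func_def[of A B F]\<close>)

subsection \<open>Natural transformations\<close>

definition ntr :: "('o, 'm, 'p, 'n) ftr \<Rightarrow> ('o, 'm, 'p, 'n) ftr \<Rightarrow> ('o, 'm, 'p, 'n) ntr \<Rightarrow> bool" where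
  "ntr F G \<alpha> \<longleftrightarrow> is_ntr \<alpha> \<and> NDom \<alpha> = F \<and> NCod \<alpha> = G"

lemma ntr_func:
  assumes "ntr F G \<alpha>" shows "func (Src F) (Trg F) F" "func (Src F) (Trg F) G"
  using assms by (auto simp: ntr_def is_ntr_def func_def Let_def)

lemma ntr_hom:
  "ntr F G \<alpha> \<Longrightarrow> func C D F \<Longrightarrow> x \<in> Ob C \<Longrightarrow> Cpt \<alpha> x \<in> hom D (FO F x) (FO G x)"
  unfolding ntr_def func_def is_ntr_def Let_def hom_iff by (metis PiE_mem)

lemma ntr_nat:
  "ntr F G \<alpha> \<Longrightarrow> func C D F \<Longrightarrow> f \<in> hom C x y \<Longrightarrow>
     Cmp D (Cpt \<alpha> y) (FA F f) = Cmp D (FA G f) (Cpt \<alpha> x)"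
  unfolding ntr_def func_def is_ntr_def Let_def hom_iff by auto

lemma mk_ntr_simps [simp]:
  "NDom (mk_ntr F G t) = F" "NCod (mk_ntr F G t) = G"
  "x \<in> Ob (Src F) \<Longrightarrow> Cpt (mk_ntr F G t) x = t x"
  by (simp_all add: mk_ntr_def)

lemma ntr_mk_ntr:
  assumes F: "func C D F" and G: "func C D G"
    and t: "\<And>x. x \<in> Ob C \<Longrightarrow> t x \<in> hom D (FO F x) (FO G x)"
    and n: "\<And>f x y. f \<in> hom C x y \<Longrightarrow> Cmp D (t y) (FA F f) = Cmp D (FA G f) (t x)"
  shows "ntr F G (mk_ntr F G t)"
proof -
  have "Cmp D (t (Cod C f)) (FA F f) = Cmp D (FA G f) (t (Dom C f))" if "f \<in> Ar C" for f
    using n[of f "Dom C f" "Cod C f"] that by (simp add: hom_iff)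
  then show ?thesis
    using assms(1-3) func_cat[OF F] unfolding ntr_def is_ntr_def Let_def mk_ntr_def
    by (auto simp: hom_iff func_def Dom_ob Cod_ob)
qed

lemma ntr_eqI:
  assumes a: "ntr F G \<alpha>" and b: "ntr F G \<beta>" and "\<And>x. x \<in> Ob (Src F) \<Longrightarrow> Cpt \<alpha> x = Cpt \<beta> x"
  shows "\<alpha> = \<beta>"
proof -
  have e: "Cpt \<alpha> \<in> Ob (Src F) \<rightarrow>\<^sub>E Ar (Trg F)" "Cpt \<beta> \<in> Ob (Src F) \<rightarrow>\<^sub>E Ar (Trg F)"
    using a b unfolding ntr_def is_ntr_def Let_def by auto
  have "Cpt \<alpha> = Cpt \<beta>" using PiE_ext[OF e assms(3)] by simp
  moreover have "NDom \<alpha> = NDom \<beta>" "NCod \<alpha> = NCod \<beta>" using a b by (simp_all add: ntr_def)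
  ultimately show ?thesis by (auto intro!: ntr.equality)
qed

lemma ntr_id_ntr:
  assumes F: "func C D F" shows "ntr F F (id_ntr F)"
proof -
  have s: "Trg F = D" using F by (simp add: func_def)
  note D = func_cat(2)[OF F]
  show ?thesis unfolding id_ntr_def s
  proof (rule ntr_mk_ntr[OF F F])
    show "Idn D (FO F x) \<in> hom D (FO F x) (FO F x)" if "x \<in> Ob C" for x
      using cat_id[OF D func_ob[OF F that]] .
    show "Cmp D (Idn D (FO F y)) (FA F f) = Cmp D (FA F f) (Idn D (FO F x))"
      if "f \<in> hom C x y" for f x y
      using cat_id_left[OF D func_hom[OF F that]] cat_id_right[OF D func_hom[OF F that]] by simp
  qed
qed

lemma id_ntr_cpt [simp]: "x \<in> Ob (Src F) \<Longrightarrow> Cpt (id_ntr F) x = Idn (Trg F) (FO F x)"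
  by (simp add: id_ntr_def)

lemma whisker_left_cpt [simp]:
  "x \<in> Ob (Src (NDom \<alpha>)) \<Longrightarrow> Cpt (G \<lhd> \<alpha>) x = FA G (Cpt \<alpha> x)"
  by (simp add: whisker_left_def)

lemma whisker_right_cpt [simp]:
  "x \<in> Ob (Src H) \<Longrightarrow> Cpt (\<alpha> \<rhd> H) x = Cpt \<alpha> (FO H x)"
  by (simp add: whisker_right_def)

lemma vcomp_cpt [simp]:
  "x \<in> Ob (Src (NDom \<alpha>)) \<Longrightarrow> Cpt (\<beta> \<odot> \<alpha>) x = Cmp (Trg (NDom \<alpha>)) (Cpt \<beta> x) (Cpt \<alpha> x)"
  by (simp add: vcomp_def)

lemma vcomp_ends [simp]: "NDom (\<beta> \<odot> \<alpha>) = NDom \<alpha>" "NCod (\<beta> \<odot> \<alpha>) = NCod \<beta>"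
  by (simp_all add: vcomp_def)

lemma whisker_ends [simp]:
  "NDom (G \<lhd> \<alpha>) = G \<bullet> NDom \<alpha>" "NCod (G \<lhd> \<alpha>) = G \<bullet> NCod \<alpha>"
  "NDom (\<alpha> \<rhd> H) = NDom \<alpha> \<bullet> H" "NCod (\<alpha> \<rhd> H) = NCod \<alpha> \<bullet> H"
  by (simp_all add: whisker_left_def whisker_right_def)

lemma ntr_vcomp:
  assumes a: "ntr F G \<alpha>" and b: "ntr G H \<beta>"
  shows "ntr F H (\<beta> \<odot> \<alpha>)"
proof -
  let ?C = "Src F" and ?D = "Trg F"
  note F = ntr_func(1)[OF a] and G = ntr_func(2)[OF a]
  have H: "func ?C ?D H" using ntr_func(2)[OF b] G by (simp add: func_def)
  note D = func_cat(2)[OF F]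
  have ends: "NDom \<alpha> = F" "NCod \<beta> = H" using a b by (simp_all add: ntr_def)
  show ?thesis unfolding vcomp_def ends
  proof (rule ntr_mk_ntr[OF F H])
    fix x assume x: "x \<in> Ob ?C"
    show "Cmp ?D (Cpt \<beta> x) (Cpt \<alpha> x) \<in> hom ?D (FO F x) (FO H x)"
      using cat_comp[OF D ntr_hom[OF b G x] ntr_hom[OF a F x]] .
  next
    fix f x y assume f: "f \<in> hom ?C x y"
    have x: "x \<in> Ob ?C" and y: "y \<in> Ob ?C" using hom_ob[OF func_cat(1)[OF F] f] by auto
    note ax = ntr_hom[OF a F x] and ay = ntr_hom[OF a F y]
      and bx = ntr_hom[OF b G x] and "by" = ntr_hom[OF b G y]
    have "Cmp ?D (Cmp ?D (Cpt \<beta> y) (Cpt \<alpha> y)) (FA F f) = Cmp ?D (Cpt \<beta> y) (Cmp ?D (FA G f) (Cpt \<alpha> x))"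
      using cat_assoc[OF D func_hom[OF F f] ay "by"] ntr_nat[OF a F f] by simp
    also have "\<dots> = Cmp ?D (Cmp ?D (FA H f) (Cpt \<beta> x)) (Cpt \<alpha> x)"
      using cat_assoc[OF D ax func_hom[OF G f] "by"] ntr_nat[OF b G f] by simp
    also have "\<dots> = Cmp ?D (FA H f) (Cmp ?D (Cpt \<beta> x) (Cpt \<alpha> x))"
      using cat_assoc[OF D ax bx func_hom[OF H f]] by simp
    finally show "Cmp ?D (Cmp ?D (Cpt \<beta> y) (Cpt \<alpha> y)) (FA F f) =
      Cmp ?D (FA H f) (Cmp ?D (Cpt \<beta> x) (Cpt \<alpha> x))" .
  qed
qed

lemma ntr_whisker_left:
  assumes a: "ntr F G \<alpha>" and F: "func C D F" and K: "func D E K"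
  shows "ntr (K \<bullet> F) (K \<bullet> G) (K \<lhd> \<alpha>)"
proof -
  have G: "func C D G" using a F ntr_func(2)[OF a] by (simp add: func_def)
  have ends: "NDom \<alpha> = F" "NCod \<alpha> = G" using a by (simp_all add: ntr_def)
  show ?thesis unfolding whisker_left_def ends
  proof (rule ntr_mk_ntr[OF func_comp_ftr[OF F K] func_comp_ftr[OF G K]])
    fix x assume x: "x \<in> Ob C"
    show "FA K (Cpt \<alpha> x) \<in> hom E (FO (K \<bullet> F) x) (FO (K \<bullet> G) x)"
      using func_hom[OF K ntr_hom[OF a F x]] by (simp add: comp_ob[OF F x] comp_ob[OF G x])
  next
    fix f x y assume f: "f \<in> hom C x y"
    have x: "x \<in> Ob C" and y: "y \<in> Ob C" using hom_ob[OF func_cat(1)[OF F] f] by auto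
    show "Cmp E (FA K (Cpt \<alpha> y)) (FA (K \<bullet> F) f) = Cmp E (FA (K \<bullet> G) f) (FA K (Cpt \<alpha> x))"
      using ntr_nat[OF a F f] func_comp[OF K ntr_hom[OF a F y] func_hom[OF F f]]
        func_comp[OF K func_hom[OF G f] ntr_hom[OF a F x]]
      by (simp add: comp_hom[OF F f] comp_hom[OF G f])
  qed
qed

lemma ntr_whisker_right:
  assumes a: "ntr F G \<alpha>" and F: "func C D F" and H: "func B C H"
  shows "ntr (F \<bullet> H) (G \<bullet> H) (\<alpha> \<rhd> H)"
proof -
  have G: "func C D G" using a F ntr_func(2)[OF a] by (simp add: func_def)
  have ends: "NDom \<alpha> = F" "NCod \<alpha> = G" using a by (simp_all add: ntr_def)
  show ?thesis unfolding whisker_right_def ends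
  proof (rule ntr_mk_ntr[OF func_comp_ftr[OF H F] func_comp_ftr[OF H G]])
    fix x assume x: "x \<in> Ob B"
    show "Cpt \<alpha> (FO H x) \<in> hom D (FO (F \<bullet> H) x) (FO (G \<bullet> H) x)"
      using ntr_hom[OF a F func_ob[OF H x]] by (simp add: comp_ob[OF H x])
  next
    fix f x y assume f: "f \<in> hom B x y"
    show "Cmp D (Cpt \<alpha> (FO H y)) (FA (F \<bullet> H) f) = Cmp D (FA (G \<bullet> H) f) (Cpt \<alpha> (FO H x))"
      using ntr_nat[OF a F func_hom[OF H f]] by (simp add: comp_hom[OF H f])
  qed
qed

lemma inverse_arrows_unique:
  assumes C: "is_cat C" and g: "inverse_arrows C f g" and h: "inverse_arrows C f h"
  shows "g = h"
proof -
  let ?x = "Dom C f" and ?y = "Cod C f"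
  have f: "f \<in> hom C ?x ?y" and gh: "g \<in> hom C ?y ?x" and hh: "h \<in> hom C ?y ?x"
    using g h by (simp_all add: inverse_arrows_def hom_iff)
  have "g = Cmp C g (Cmp C f h)" using h cat_id_right[OF C gh] by (simp add: inverse_arrows_def)
  also have "\<dots> = Cmp C (Cmp C g f) h" using cat_assoc[OF C hh f gh] .
  also have "\<dots> = h" using g cat_id_left[OF C hh] by (simp add: inverse_arrows_def)
  finally show ?thesis .
qed

lemma nat_inv_inverse:
  assumes "nat_iso \<alpha>" and a: "ntr F G \<alpha>" and F: "func C D F" and x: "x \<in> Ob C"
  shows "Cpt (nat_inv \<alpha>) x \<in> hom D (FO G x) (FO F x)"
    "Cmp D (Cpt (nat_inv \<alpha>) x) (Cpt \<alpha> x) = Idn D (FO F x)"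
    "Cmp D (Cpt \<alpha> x) (Cpt (nat_inv \<alpha>) x) = Idn D (FO G x)"
proof -
  note D = func_cat(2)[OF F]
  have s: "Src F = C" "Trg F = D" "NDom \<alpha> = F" "NCod \<alpha> = G" "Src G = C"
    using F a ntr_func(2)[OF a] by (simp_all add: func_def ntr_def)
  have ax: "Cpt \<alpha> x \<in> hom D (FO F x) (FO G x)" using ntr_hom[OF a F x] .
  have "iso_arrow D (Cpt \<alpha> x)" using assms(1) x by (simp add: nat_iso_def s)
  then have "\<exists>!g. inverse_arrows D (Cpt \<alpha> x) g"
    unfolding iso_arrow_def using inverse_arrows_unique[OF D] by blast
  from theI'[OF this] have "inverse_arrows D (Cpt \<alpha> x) (Cpt (nat_inv \<alpha>) x)"
    using x by (simp add: nat_inv_def s)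
  then show "Cpt (nat_inv \<alpha>) x \<in> hom D (FO G x) (FO F x)"
    "Cmp D (Cpt (nat_inv \<alpha>) x) (Cpt \<alpha> x) = Idn D (FO F x)"
    "Cmp D (Cpt \<alpha> x) (Cpt (nat_inv \<alpha>) x) = Idn D (FO G x)"
    using ax by (auto simp: inverse_arrows_def hom_iff)
qed

lemma ntr_nat_inv:
  assumes i: "nat_iso \<alpha>" and a: "ntr F G \<alpha>" and F: "func C D F"
  shows "ntr G F (nat_inv \<alpha>)"
proof -
  note D = func_cat(2)[OF F]
  have G: "func C D G" using a F ntr_func(2)[OF a] by (simp add: func_def)
  have s: "Src F = C" "Trg F = D" "NDom \<alpha> = F" "NCod \<alpha> = G" "Src G = C"
    using F a ntr_func(2)[OF a] by (simp_all add: func_def ntr_def)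
  note inv = nat_inv_inverse[OF i a F]
  let ?i = "Cpt (nat_inv \<alpha>)"
  have "ntr G F (mk_ntr G F ?i)"
  proof (rule ntr_mk_ntr[OF G F inv(1)])
    fix f x y assume f: "f \<in> hom C x y"
    have x: "x \<in> Ob C" and y: "y \<in> Ob C" using hom_ob[OF func_cat(1)[OF F] f] by auto
    note ax = ntr_hom[OF a F x] and ay = ntr_hom[OF a F y]
    have "Cpt \<alpha> x \<in> isos D (FO F x) (FO G x)"
      using isosI[OF ax inv(1)[OF x] inv(2,3)[OF x]] .
    moreover have "Cmp D (Cmp D (?i y) (FA G f)) (Cpt \<alpha> x) = Cmp D (?i y) (Cmp D (Cpt \<alpha> y) (FA F f))"
      using cat_assoc[OF D ax func_hom[OF G f] inv(1)[OF y]] ntr_nat[OF a F f] by simp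
    moreover have "\<dots> = FA F f"
      using cat_assoc[OF D func_hom[OF F f] ay inv(1)[OF y]] inv(2)[OF y]
        cat_id_left[OF D func_hom[OF F f]] by simp
    moreover have "Cmp D (Cmp D (FA F f) (?i x)) (Cpt \<alpha> x) = FA F f"
      using cat_assoc[OF D ax inv(1)[OF x] func_hom[OF F f]] inv(2)[OF x]
        cat_id_right[OF D func_hom[OF F f]] by simp
    ultimately show "Cmp D (?i y) (FA G f) = Cmp D (FA F f) (?i x)"
      using iso_right_cancel[OF D _ cat_comp[OF D inv(1)[OF y] func_hom[OF G f]]
          cat_comp[OF D func_hom[OF F f] inv(1)[OF x]]] by metis
  qed auto
  moreover have "mk_ntr G F ?i = nat_inv \<alpha>"
    unfolding nat_inv_def s(2,3,4) mk_ntr_def by (auto simp: restrict_def)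
  ultimately show ?thesis by simp
qed

section \<open>Universal arrows\<close>

text \<open>\<open>e : X \<rightarrow> R Z\<close> is an initial object of the comma category of \<open>X\<close> and \<open>R\<close>.\<close>

definition universal ::
    "('p, 'n, 'o, 'm) ftr \<Rightarrow> 'o \<Rightarrow> 'p \<Rightarrow> 'm \<Rightarrow> bool" where
  "universal R X Z e \<longleftrightarrow> Z \<in> Ob (Src R) \<and> e \<in> hom (Trg R) X (FO R Z) \<and>
    (\<forall>W\<in>Ob (Src R). \<forall>f\<in>hom (Trg R) X (FO R W).
       \<exists>!g. g \<in> hom (Src R) Z W \<and> Cmp (Trg R) (FA R g) e = f)"

lemma universalI:
  assumes "func B A R" "Z \<in> Ob B" "e \<in> hom A X (FO R Z)"
    and "\<And>W f. W \<in> Ob B \<Longrightarrow> f \<in> hom A X (FO R W) \<Longrightarrow> \<exists>g\<in>hom B Z W. Cmp A (FA R g) e = f"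
    and "\<And>W g h. W \<in> Ob B \<Longrightarrow> g \<in> hom B Z W \<Longrightarrow> h \<in> hom B Z W \<Longrightarrow>
      Cmp A (FA R g) e = Cmp A (FA R h) e \<Longrightarrow> g = h"
  shows "universal R X Z e"
proof -
  have s: "Src R = B" "Trg R = A" using assms(1) by (simp_all add: func_def)
  have "\<exists>!g. g \<in> hom B Z W \<and> Cmp A (FA R g) e = f"
    if W: "W \<in> Ob B" and f: "f \<in> hom A X (FO R W)" for W f
  proof -
    obtain g where g: "g \<in> hom B Z W" "Cmp A (FA R g) e = f" using assms(4)[OF W f] by blast
    show ?thesis
    proof (rule ex1I[of _ g])
      show "g \<in> hom B Z W \<and> Cmp A (FA R g) e = f" using g by simp
      show "h = g" if "h \<in> hom B Z W \<and> Cmp A (FA R h) e = f" for h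
        using assms(5)[OF W _ g(1), of h] that g(2) by simp
    qed
  qed
  then show ?thesis unfolding universal_def s using assms(2,3) by simp
qed

lemma universal_hom: "func B A R \<Longrightarrow> universal R X Z e \<Longrightarrow> e \<in> hom A X (FO R Z)"
  and universal_ob: "func B A R \<Longrightarrow> universal R X Z e \<Longrightarrow> Z \<in> Ob B"
  by (auto simp: universal_def func_def)

lemma universal_factor:
  assumes "func B A R" "universal R X Z e" "W \<in> Ob B" "f \<in> hom A X (FO R W)"
  obtains g where "g \<in> hom B Z W" "Cmp A (FA R g) e = f"
  using assms unfolding universal_def func_def by blast

lemma universal_unique:
  assumes R: "func B A R" and e: "universal R X Z e" and W: "W \<in> Ob B"
    and g: "g \<in> hom B Z W" and h: "h \<in> hom B Z W"
    and eq: "Cmp A (FA R g) e = Cmp A (FA R h) e"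
  shows "g = h"
proof -
  have "Cmp A (FA R h) e \<in> hom A X (FO R W)"
    using cat_comp[OF func_cat(2)[OF R] func_hom[OF R h] universal_hom[OF R e]] .
  then have "\<exists>!k. k \<in> hom B Z W \<and> Cmp A (FA R k) e = Cmp A (FA R h) e"
    using R e W unfolding universal_def func_def by blast
  then show ?thesis using g h eq by blast
qed

text \<open>Initial objects of the comma category are unique up to isomorphism.\<close>

lemma universal_iso:
  assumes R: "func B A R" and e: "universal R X Z e" and e': "universal R X Z' e'"
    and g: "g \<in> hom B Z Z'" and ge: "Cmp A (FA R g) e = e'"
  shows "g \<in> isos B Z Z'"
proof -
  note A = func_cat(2)[OF R] and B = func_cat(1)[OF R]
  have Z: "Z \<in> Ob B" "Z' \<in> Ob B" using universal_ob[OF R] e e' by auto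
  have eh: "e \<in> hom A X (FO R Z)" "e' \<in> hom A X (FO R Z')" using universal_hom[OF R] e e' by auto
  obtain h where h: "h \<in> hom B Z' Z" "Cmp A (FA R h) e' = e"
    using universal_factor[OF R e' Z(1) eh(1)] .
  have "Cmp A (FA R (Cmp B h g)) e = Cmp A (FA R (Idn B Z)) e"
    using func_comp[OF R h(1) g] cat_assoc[OF A eh(1) func_hom[OF R g] func_hom[OF R h(1)]] ge h(2)
      func_id[OF R Z(1)] cat_id_left[OF A eh(1)] by simp
  then have 1: "Cmp B h g = Idn B Z"
    using universal_unique[OF R e Z(1) cat_comp[OF B h(1) g] cat_id[OF B Z(1)]] by simp
  have "Cmp A (FA R (Cmp B g h)) e' = Cmp A (FA R (Idn B Z')) e'"
    using func_comp[OF R g h(1)] cat_assoc[OF A eh(2) func_hom[OF R h(1)] func_hom[OF R g]] ge h(2)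
      func_id[OF R Z(2)] cat_id_left[OF A eh(2)] by simp
  then have 2: "Cmp B g h = Idn B Z'"
    using universal_unique[OF R e' Z(2) cat_comp[OF B g h(1)] cat_id[OF B Z(2)]] by simp
  show ?thesis using isosI[OF g h(1) 1 2] .
qed

lemma universal_comp_iso:
  assumes R: "func B A R" and e: "universal R X Z e" and i: "i \<in> isos B Z Z'"
  shows "universal R X Z' (Cmp A (FA R i) e)"
proof -
  note A = func_cat(2)[OF R] and B = func_cat(1)[OF R]
  obtain j where j: "i \<in> hom B Z Z'" "j \<in> hom B Z' Z" "Cmp B j i = Idn B Z" "Cmp B i j = Idn B Z'"
    using i by (rule isosE)
  note eh = universal_hom[OF R e]
  have Z': "Z' \<in> Ob B" using hom_ob[OF B j(1)] by simp
  have fac: "Cmp A (FA R g) (Cmp A (FA R i) e) = Cmp A (FA R (Cmp B g i)) e"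
    if "g \<in> hom B Z' W" for g W
    using func_comp[OF R that j(1)] cat_assoc[OF A eh func_hom[OF R j(1)] func_hom[OF R that]] by simp
  show ?thesis
  proof (rule universalI[OF R Z'])
    show "Cmp A (FA R i) e \<in> hom A X (FO R Z')" using cat_comp[OF A func_hom[OF R j(1)] eh] .
    show "\<exists>g\<in>hom B Z' W. Cmp A (FA R g) (Cmp A (FA R i) e) = f"
      if W: "W \<in> Ob B" and f: "f \<in> hom A X (FO R W)" for W f
    proof -
      obtain g where g: "g \<in> hom B Z W" "Cmp A (FA R g) e = f" using universal_factor[OF R e W f] .
      have "Cmp B (Cmp B g j) i = g"
        using cat_assoc[OF B j(1,2) g(1)] j(3) cat_id_right[OF B g(1)] by simp
      then show ?thesis using cat_comp[OF B g(1) j(2)] fac g(2) by (intro bexI[of _ "Cmp B g j"]) simp_all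
    qed
    show "g = h" if W: "W \<in> Ob B" and g: "g \<in> hom B Z' W" and h: "h \<in> hom B Z' W"
      and eq: "Cmp A (FA R g) (Cmp A (FA R i) e) = Cmp A (FA R h) (Cmp A (FA R i) e)" for W g h
    proof -
      have "Cmp B g i = Cmp B h i"
        using universal_unique[OF R e W cat_comp[OF B g j(1)] cat_comp[OF B h j(1)]] eq fac[OF g] fac[OF h]
        by simp
      then show ?thesis using iso_right_cancel[OF B i g h] by simp
    qed
  qed
qed

lemma universal_precomp_iso:
  assumes R: "func B A R" and e: "universal R X Z e" and i: "i \<in> isos A X' X"
  shows "universal R X' Z (Cmp A e i)"
proof -
  note A = func_cat(2)[OF R] and B = func_cat(1)[OF R]
  obtain j where j: "i \<in> hom A X' X" "j \<in> hom A X X'" "Cmp A j i = Idn A X'" "Cmp A i j = Idn A X"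
    using i by (rule isosE)
  note eh = universal_hom[OF R e]
  have fac: "Cmp A (FA R g) (Cmp A e i) = Cmp A (Cmp A (FA R g) e) i"
    if "g \<in> hom B Z W" for g W
    using cat_assoc[OF A j(1) eh func_hom[OF R that]] .
  show ?thesis
  proof (rule universalI[OF R universal_ob[OF R e] cat_comp[OF A eh j(1)]])
    show "\<exists>g\<in>hom B Z W. Cmp A (FA R g) (Cmp A e i) = f"
      if W: "W \<in> Ob B" and f: "f \<in> hom A X' (FO R W)" for W f
    proof -
      obtain g where g: "g \<in> hom B Z W" "Cmp A (FA R g) e = Cmp A f j"
        using universal_factor[OF R e W cat_comp[OF A f j(2)]] .
      have "Cmp A (Cmp A f j) i = f"
        using cat_assoc[OF A j(1,2) f] j(3) cat_id_right[OF A f] by simp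
      then show ?thesis using g fac[OF g(1)] by (intro bexI[of _ g]) simp_all
    qed
    show "g = h" if W: "W \<in> Ob B" and g: "g \<in> hom B Z W" and h: "h \<in> hom B Z W"
      and eq: "Cmp A (FA R g) (Cmp A e i) = Cmp A (FA R h) (Cmp A e i)" for W g h
    proof -
      have "Cmp A (FA R g) e = Cmp A (FA R h) e"
        using iso_right_cancel[OF A i cat_comp[OF A func_hom[OF R g] eh] cat_comp[OF A func_hom[OF R h] eh]]
          eq fac[OF g] fac[OF h] by simp
      then show ?thesis using universal_unique[OF R e W g h] by simp
    qed
  qed
qed

lemma universal_precomp_iso_iff:
  assumes R: "func B A R" and i: "i \<in> isos A X' X" and e: "e \<in> hom A X (FO R Z)"
    and u: "universal R X' Z (Cmp A e i)"
  shows "universal R X Z e"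
proof -
  note A = func_cat(2)[OF R]
  obtain j where j: "i \<in> hom A X' X" "j \<in> hom A X X'" "Cmp A j i = Idn A X'" "Cmp A i j = Idn A X"
    "j \<in> isos A X X'"
    using i by (rule isosE)
  have "Cmp A (Cmp A e i) j = e" using cat_assoc[OF A j(2,1) e] j(4) cat_id_right[OF A e] by simp
  then show ?thesis using universal_precomp_iso[OF R u j(5)] by simp
qed

text \<open>Left adjoints compose; this is the same fact for a single object.\<close>

lemma universal_comp:
  assumes R: "func B A R" and S: "func C B S"
    and e: "universal R X Z e" and e': "universal S Z W e'"
  shows "universal (R \<bullet> S) X W (Cmp A (FA R e') e)"
proof -
  note A = func_cat(2)[OF R] and B = func_cat(1)[OF R]
  note RS = func_comp_ftr[OF S R]
  note eh = universal_hom[OF R e] and e'h = universal_hom[OF S e']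
  have fo: "FO (R \<bullet> S) V = FO R (FO S V)" if "V \<in> Ob C" for V using comp_ob[OF S that] .
  have fac: "Cmp A (FA (R \<bullet> S) g) (Cmp A (FA R e') e) = Cmp A (FA R (Cmp B (FA S g) e')) e"
    if "g \<in> hom C W V" for g V
    using cat_assoc[OF A eh func_hom[OF R e'h] func_hom[OF R func_hom[OF S that]]]
      func_comp[OF R func_hom[OF S that] e'h] by (simp add: comp_hom[OF S that])
  show ?thesis
  proof (rule universalI[OF RS universal_ob[OF S e']])
    show "Cmp A (FA R e') e \<in> hom A X (FO (R \<bullet> S) W)"
      using cat_comp[OF A func_hom[OF R e'h] eh] fo[OF universal_ob[OF S e']] by simp
    show "\<exists>g\<in>hom C W V. Cmp A (FA (R \<bullet> S) g) (Cmp A (FA R e') e) = f"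
      if V: "V \<in> Ob C" and f: "f \<in> hom A X (FO (R \<bullet> S) V)" for V f
    proof -
      obtain h where h: "h \<in> hom B Z (FO S V)" "Cmp A (FA R h) e = f"
        using universal_factor[OF R e func_ob[OF S V]] f fo[OF V] by metis
      obtain g where g: "g \<in> hom C W V" "Cmp B (FA S g) e' = h"
        using universal_factor[OF S e' V h(1)] .
      show ?thesis using g h fac[OF g(1)] by (intro bexI[of _ g]) simp_all
    qed
    show "g = h" if V: "V \<in> Ob C" and g: "g \<in> hom C W V" and h: "h \<in> hom C W V"
      and eq: "Cmp A (FA (R \<bullet> S) g) (Cmp A (FA R e') e) = Cmp A (FA (R \<bullet> S) h) (Cmp A (FA R e') e)"
      for V g h
    proof -
      have "Cmp B (FA S g) e' = Cmp B (FA S h) e'"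
        using universal_unique[OF R e func_ob[OF S V] cat_comp[OF B func_hom[OF S g] e'h]
            cat_comp[OF B func_hom[OF S h] e'h]] eq fac[OF g] fac[OF h] by simp
      then show ?thesis using universal_unique[OF S e' V g h] by simp
    qed
  qed
qed

subsection \<open>Adjunctions\<close>

lemma adjunction_data:
  assumes "adjunction L R \<eta> \<epsilon>" and R: "func B A R"
  shows "func A B L" "ntr (id_ftr A) (R \<bullet> L) \<eta>" "ntr (L \<bullet> R) (id_ftr B) \<epsilon>"
  using assms by (auto simp: adjunction_def func_def ntr_def)

lemma adjunction_unit:
  assumes adj: "adjunction L R \<eta> \<epsilon>" and R: "func B A R" and X: "X \<in> Ob A"
  shows "Cpt \<eta> X \<in> hom A X (FO R (FO L X))"
    and "Cmp B (Cpt \<epsilon> (FO L X)) (FA L (Cpt \<eta> X)) = Idn B (FO L X)"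
proof -
  note d = adjunction_data[OF adj R]
  show "Cpt \<eta> X \<in> hom A X (FO R (FO L X))"
    using ntr_hom[OF d(2) func_id_ftr[OF func_cat(1)[OF d(1)]] X] X by (simp add: comp_ob[OF d(1) X])
  have s: "Src L = A" "Trg L = B" "NDom \<eta> = id_ftr A" "NDom \<epsilon> = L \<bullet> R" "Src R = B"
    using R d by (auto simp: func_def ntr_def)
  have "Cpt ((\<epsilon> \<rhd> L) \<odot> (L \<lhd> \<eta>)) X = Cpt (id_ntr L) X" using adj by (simp add: adjunction_def)
  then show "Cmp B (Cpt \<epsilon> (FO L X)) (FA L (Cpt \<eta> X)) = Idn B (FO L X)"
    using X by (simp add: s)
qed

lemma adjunction_counit:
  assumes adj: "adjunction L R \<eta> \<epsilon>" and R: "func B A R" and Z: "Z \<in> Ob B"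
  shows "Cpt \<epsilon> Z \<in> hom B (FO L (FO R Z)) Z"
    and "Cmp A (FA R (Cpt \<epsilon> Z)) (Cpt \<eta> (FO R Z)) = Idn A (FO R Z)"
proof -
  note d = adjunction_data[OF adj R]
  show "Cpt \<epsilon> Z \<in> hom B (FO L (FO R Z)) Z"
    using ntr_hom[OF d(3) func_comp_ftr[OF R d(1)] Z] Z by (simp add: comp_ob[OF R Z])
  have s: "Src R = B" "Trg R = A" "NDom \<eta> = id_ftr A" "NDom \<epsilon> = L \<bullet> R" "Src L = A"
    using R d by (auto simp: func_def ntr_def)
  have "Cpt ((R \<lhd> \<epsilon>) \<odot> (\<eta> \<rhd> R)) Z = Cpt (id_ntr R) Z" using adj by (simp add: adjunction_def)
  then show "Cmp A (FA R (Cpt \<epsilon> Z)) (Cpt \<eta> (FO R Z)) = Idn A (FO R Z)"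
    using Z by (simp add: s)
qed

lemma adjunction_unit_natural:
  assumes adj: "adjunction L R \<eta> \<epsilon>" and R: "func B A R" and f: "f \<in> hom A X Y"
  shows "Cmp A (Cpt \<eta> Y) f = Cmp A (FA R (FA L f)) (Cpt \<eta> X)"
proof -
  note d = adjunction_data[OF adj R]
  show ?thesis
    using ntr_nat[OF d(2) func_id_ftr[OF func_cat(1)[OF d(1)]] f] f
    by (simp add: comp_hom[OF d(1) f], simp add: hom_iff)
qed

lemma adjunction_counit_natural:
  assumes adj: "adjunction L R \<eta> \<epsilon>" and R: "func B A R" and f: "f \<in> hom B X Y"
  shows "Cmp B (Cpt \<epsilon> Y) (FA L (FA R f)) = Cmp B f (Cpt \<epsilon> X)"
proof -
  note d = adjunction_data[OF adj R]
  show ?thesis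
    using ntr_nat[OF d(3) func_comp_ftr[OF R d(1)] f] f
    by (simp add: comp_hom[OF R f], simp add: hom_iff)
qed

lemma adjunction_transpose:
  assumes adj: "adjunction L R \<eta> \<epsilon>" and R: "func B A R" and W: "W \<in> Ob B"
    and f: "f \<in> hom A X (FO R W)"
  shows "Cmp B (Cpt \<epsilon> W) (FA L f) \<in> hom B (FO L X) W"
    and "Cmp A (FA R (Cmp B (Cpt \<epsilon> W) (FA L f))) (Cpt \<eta> X) = f"
proof -
  note A = func_cat(2)[OF R] and B = func_cat(1)[OF R] and L = adjunction_data(1)[OF adj R]
  have X: "X \<in> Ob A" using hom_ob[OF A f] by simp
  note eW = adjunction_counit[OF adj R W] and nX = adjunction_unit[OF adj R X]
  have nW: "Cpt \<eta> (FO R W) \<in> hom A (FO R W) (FO R (FO L (FO R W)))"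
    using adjunction_unit(1)[OF adj R func_ob[OF R W]] .
  show "Cmp B (Cpt \<epsilon> W) (FA L f) \<in> hom B (FO L X) W"
    using cat_comp[OF B eW(1) func_hom[OF L f]] .
  have "Cmp A (FA R (Cmp B (Cpt \<epsilon> W) (FA L f))) (Cpt \<eta> X) =
      Cmp A (FA R (Cpt \<epsilon> W)) (Cmp A (FA R (FA L f)) (Cpt \<eta> X))"
    using func_comp[OF R eW(1) func_hom[OF L f]]
      cat_assoc[OF A nX(1) func_hom[OF R func_hom[OF L f]] func_hom[OF R eW(1)]] by simp
  also have "\<dots> = Cmp A (Cmp A (FA R (Cpt \<epsilon> W)) (Cpt \<eta> (FO R W))) f"
    using adjunction_unit_natural[OF adj R f] cat_assoc[OF A f nW func_hom[OF R eW(1)]] by simp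
  also have "\<dots> = f" using eW(2) cat_id_left[OF A f] by simp
  finally show "Cmp A (FA R (Cmp B (Cpt \<epsilon> W) (FA L f))) (Cpt \<eta> X) = f" .
qed

lemma adjunction_unit_universal:
  assumes adj: "adjunction L R \<eta> \<epsilon>" and R: "func B A R" and X: "X \<in> Ob A"
  shows "universal R X (FO L X) (Cpt \<eta> X)"
proof -
  note A = func_cat(2)[OF R] and B = func_cat(1)[OF R] and L = adjunction_data(1)[OF adj R]
  note nX = adjunction_unit[OF adj R X]
  have LX: "FO L X \<in> Ob B" using func_ob[OF L X] .
  have retr: "Cmp B (Cpt \<epsilon> W) (FA L (Cmp A (FA R g) (Cpt \<eta> X))) = g"
    if g: "g \<in> hom B (FO L X) W" for g W
  proof -
    have W: "W \<in> Ob B" using hom_ob[OF B g] by simp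
    have "Cmp B (Cpt \<epsilon> W) (FA L (Cmp A (FA R g) (Cpt \<eta> X))) =
        Cmp B (Cmp B (Cpt \<epsilon> W) (FA L (FA R g))) (FA L (Cpt \<eta> X))"
      using func_comp[OF L func_hom[OF R g] nX(1)]
        cat_assoc[OF B func_hom[OF L nX(1)] func_hom[OF L func_hom[OF R g]] adjunction_counit(1)[OF adj R W]]
      by simp
    also have "\<dots> = Cmp B g (Cmp B (Cpt \<epsilon> (FO L X)) (FA L (Cpt \<eta> X)))"
      using adjunction_counit_natural[OF adj R g]
        cat_assoc[OF B func_hom[OF L nX(1)] adjunction_counit(1)[OF adj R LX] g] by simp
    also have "\<dots> = g" using nX(2) cat_id_right[OF B g] by simp
    finally show ?thesis .
  qed
  show ?thesis
  proof (rule universalI[OF R LX nX(1)])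
    show "\<exists>g\<in>hom B (FO L X) W. Cmp A (FA R g) (Cpt \<eta> X) = f"
      if "W \<in> Ob B" "f \<in> hom A X (FO R W)" for W f
      using adjunction_transpose[OF adj R that] by blast
    show "g = h" if "g \<in> hom B (FO L X) W" "h \<in> hom B (FO L X) W"
      "Cmp A (FA R g) (Cpt \<eta> X) = Cmp A (FA R h) (Cpt \<eta> X)" for W g h
      using retr[OF that(1)] retr[OF that(2)] that(3) by metis
  qed
qed

text \<open>
  A mate is the transpose of a composite 2-cell, so its components are isomorphisms exactly when
  that 2-cell consists of universal arrows.  This is how universal arrows replace mates below.
\<close>

lemma transpose_iso_iff_universal:
  assumes adj: "adjunction L R \<eta> \<epsilon>" and R: "func B A R" and W: "W \<in> Ob B"
    and f: "f \<in> hom A X (FO R W)"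
  shows "Cmp B (Cpt \<epsilon> W) (FA L f) \<in> isos B (FO L X) W \<longleftrightarrow> universal R X W f"
proof -
  have X: "X \<in> Ob A" using hom_ob[OF func_cat(2)[OF R] f] by simp
  note t = adjunction_transpose[OF adj R W f] and u = adjunction_unit_universal[OF adj R X]
  show ?thesis using universal_iso[OF R u _ t] universal_comp_iso[OF R u] t(2) by metis
qed

definition fully_faithful :: "('o, 'm, 'p, 'n) ftr \<Rightarrow> bool" where
  "fully_faithful F \<longleftrightarrow> (\<forall>x\<in>Ob (Src F). \<forall>y\<in>Ob (Src F).
     bij_betw (FA F) (hom (Src F) x y) (hom (Trg F) (FO F x) (FO F y)))"

text \<open>
  If \<open>L\<close> is fully faithful, the counit at \<open>L Y\<close> is the image of an arrow \<open>R L Y \<rightarrow> Y\<close>, and this arrow is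
  inverse to the unit.
\<close>

lemma adjunction_unit_iso:
  assumes adj: "adjunction L R \<eta> \<epsilon>" and R: "func B A R" and ff: "fully_faithful L" and Y: "Y \<in> Ob A"
  shows "Cpt \<eta> Y \<in> isos A Y (FO R (FO L Y))"
proof -
  note A = func_cat(2)[OF R] and B = func_cat(1)[OF R] and L = adjunction_data(1)[OF adj R]
  let ?RLY = "FO R (FO L Y)"
  have LY: "FO L Y \<in> Ob B" and RLY: "?RLY \<in> Ob A" using func_ob[OF L Y] func_ob[OF R] by auto
  note nY = adjunction_unit[OF adj R Y] and nR = adjunction_unit[OF adj R RLY]
    and eY = adjunction_counit[OF adj R LY]
  have bij: "bij_betw (FA L) (hom A x y) (hom B (FO L x) (FO L y))" if "x \<in> Ob A" "y \<in> Ob A" for x y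
    using ff that L unfolding fully_faithful_def func_def by blast
  obtain g where g: "g \<in> hom A ?RLY Y" "FA L g = Cpt \<epsilon> (FO L Y)"
    using bij[OF RLY Y] eY(1) unfolding bij_betw_def by (metis imageE)
  have "FA L (Cmp A g (Cpt \<eta> Y)) = FA L (Idn A Y)"
    using func_comp[OF L g(1) nY(1)] g(2) nY(2) func_id[OF L Y] by simp
  then have 1: "Cmp A g (Cpt \<eta> Y) = Idn A Y"
    using bij[OF Y Y] cat_comp[OF A g(1) nY(1)] cat_id[OF A Y]
    unfolding bij_betw_def inj_on_def by blast
  have 2: "Cmp A (Cpt \<eta> Y) g = Idn A ?RLY"
    using adjunction_unit_natural[OF adj R g(1)] g(2) eY(2) by simp
  show ?thesis using isosI[OF nY(1) g(1) 1 2] .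
qed

text \<open>
  Conversely, full faithfulness of \<open>L\<close> on arrows into one object \<open>P\<close> only needs the unit at \<open>P\<close>: arrows
  \<open>L X \<rightarrow> L P\<close> correspond to arrows \<open>X \<rightarrow> R L P \<cong> P\<close>.
\<close>

lemma adjunction_bij_if_unit_iso:
  assumes adj: "adjunction L R \<eta> \<epsilon>" and R: "func B A R" and X: "X \<in> Ob A"
    and i: "Cpt \<eta> P \<in> isos A P (FO R (FO L P))"
  shows "bij_betw (FA L) (hom A X P) (hom B (FO L X) (FO L P))"
proof -
  note A = func_cat(2)[OF R] and B = func_cat(1)[OF R] and L = adjunction_data(1)[OF adj R]
  have P: "P \<in> Ob A" using hom_ob[OF A isos_hom[OF i]] by simp
  note nX = adjunction_unit[OF adj R X] and nP = adjunction_unit[OF adj R P]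
  have LP: "FO L P \<in> Ob B" using func_ob[OF L P] .
  note u = adjunction_unit_universal[OF adj R X]
  have nat: "Cmp A (FA R (FA L \<psi>)) (Cpt \<eta> X) = Cmp A (Cpt \<eta> P) \<psi>" if "\<psi> \<in> hom A X P" for \<psi>
    using adjunction_unit_natural[OF adj R that] by simp
  obtain j where j: "j \<in> hom A (FO R (FO L P)) P" "Cmp A (Cpt \<eta> P) j = Idn A (FO R (FO L P))"
    using i by (rule isosE)
  show ?thesis unfolding bij_betw_def
  proof
    show "inj_on (FA L) (hom A X P)"
    proof (rule inj_onI)
      fix f g assume f: "f \<in> hom A X P" and g: "g \<in> hom A X P" and "FA L f = FA L g"
      then have "Cmp A (Cpt \<eta> P) f = Cmp A (Cpt \<eta> P) g" using nat[OF f] nat[OF g] by simp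
      then show "f = g" using iso_left_cancel[OF A i f g] by simp
    qed
    have "f \<in> FA L ` hom A X P" if f: "f \<in> hom B (FO L X) (FO L P)" for f
    proof -
      let ?k = "Cmp A (FA R f) (Cpt \<eta> X)"
      have k: "?k \<in> hom A X (FO R (FO L P))" using cat_comp[OF A func_hom[OF R f] nX(1)] .
      have jk: "Cmp A j ?k \<in> hom A X P" using cat_comp[OF A j(1) k] .
      have "Cmp A (FA R (FA L (Cmp A j ?k))) (Cpt \<eta> X) = ?k"
        using nat[OF jk] cat_assoc[OF A k j(1) nP(1)] j(2) cat_id_left[OF A k] by simp
      then have "FA L (Cmp A j ?k) = f"
        using universal_unique[OF R u LP func_hom[OF L jk] f] by simp
      then show ?thesis using jk by (metis imageI)
    qed
    then show "FA L ` hom A X P = hom B (FO L X) (FO L P)" using func_hom[OF L] by blast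
  qed
qed

section \<open>Smallness\<close>

lemma universe_infinite:
  assumes "universe TYPE('u)" shows "infinite (UNIV :: 'u set)"
proof -
  obtain N :: "'u set" where "infinite N" using assms unfolding universe_def by auto
  then show ?thesis using infinite_super[OF subset_UNIV] by metis
qed

lemma small_finite:
  assumes "universe TYPE('u)" and "finite (S :: 'u set)" shows "small_set S"
proof -
  obtain N :: "'u set" where N: "infinite N" "small_set N"
    using assms(1) unfolding universe_def by blast
  have "|S| <o |N|" 
    using finite_ordLess_infinite[OF card_of_Well_order card_of_Well_order, of S N] assms(2) N(1)
    by (simp add: Field_card_of)
  then show ?thesis using N(2) ordLess_transitive unfolding small_set_def by blast
qed

lemma code_inj: "inj (f :: 'a \<Rightarrow> 'u) \<Longrightarrow> inj (code :: 'a \<Rightarrow> 'u)"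
  unfolding code_def by (rule someI[of inj])

lemma decode_code [simp]: "inj (code :: 'a \<Rightarrow> 'u) \<Longrightarrow> decode (code (x :: 'a) :: 'u) = x"
  unfolding decode_def by (rule inv_f_f)

text \<open>An infinite set is in bijection with its square.\<close>

lemma code_inj_prod:
  assumes U: "universe TYPE('u)" and a: "inj (code :: 'a \<Rightarrow> 'u)" and b: "inj (code :: 'b \<Rightarrow> 'u)"
  shows "inj (code :: 'a \<times> 'b \<Rightarrow> 'u)"
proof -
  have "|(UNIV :: 'u set) \<times> (UNIV :: 'u set)| =o |UNIV :: 'u set|"
    using card_of_Times_same_infinite[OF universe_infinite[OF U]] .
  then obtain p :: "'u \<times> 'u \<Rightarrow> 'u" where "bij_betw p (UNIV \<times> UNIV) UNIV"
    using card_of_ordIso by blast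
  then have p: "inj p" by (simp add: bij_betw_def)
  have "inj (\<lambda>(x :: 'a, y :: 'b). p (code x, code y))"
    by (rule injI) (auto simp: inj_eq[OF p] inj_eq[OF a] inj_eq[OF b])
  then show ?thesis by (rule code_inj)
qed

lemma code_inj_self: "inj (code :: 'u \<Rightarrow> 'u)"
  by (rule code_inj[of id]) simp

lemma code_inj_nat:
  assumes U: "universe TYPE('u)" shows "inj (code :: nat \<Rightarrow> 'u)"
proof -
  obtain f :: "nat \<Rightarrow> 'u" where "inj f" using infinite_countable_subset[OF universe_infinite[OF U]] by auto
  then show ?thesis by (rule code_inj)
qed

lemma code_inj_instances:
  assumes U: "universe TYPE('u)"
  shows "inj (code :: 'u \<times> 'u \<Rightarrow> 'u)" "inj (code :: 'u \<times> 'u \<times> 'u \<Rightarrow> 'u)"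
    "inj (code :: ('u \<times> 'u) \<times> 'u \<times> ('u \<times> 'u) \<Rightarrow> 'u)"
    "inj (code :: nat \<times> nat \<Rightarrow> 'u)" "inj (code :: (nat \<times> nat) \<times> (nat \<times> nat) \<Rightarrow> 'u)"
  by (intro code_inj_prod[OF U] code_inj_self code_inj_nat[OF U])+

definition sfunc :: "'u scat \<Rightarrow> 'u scat \<Rightarrow> 'u sftr \<Rightarrow> bool" where
  "sfunc A B u \<longleftrightarrow> small_cat A \<and> small_cat B \<and> func A B u"

lemma sfunc_iff: "small_ftr u \<longleftrightarrow> sfunc (Src u) (Trg u) u"
  by (auto simp: small_ftr_def sfunc_def func_def)

lemma sfunc_func: "sfunc A B u \<Longrightarrow> func A B u"
  and sfunc_small: "sfunc A B u \<Longrightarrow> small_cat A" "sfunc A B u \<Longrightarrow> small_cat B"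
  by (auto simp: sfunc_def)

lemma sfunc_ends: "sfunc A B u \<Longrightarrow> small_ftr u \<and> Src u = A \<and> Trg u = B"
  by (auto simp: small_ftr_def sfunc_def func_def)

lemma sfunc_comp: "sfunc A B u \<Longrightarrow> sfunc B C v \<Longrightarrow> sfunc A C (v \<bullet> u)"
  by (auto simp: sfunc_def intro: func_comp_ftr)

lemma sfunc_id: "small_cat A \<Longrightarrow> sfunc A A (id_ftr A)"
  by (auto simp: sfunc_def small_cat_def intro: func_id_ftr)

definition sntr :: "'u scat \<Rightarrow> 'u scat \<Rightarrow> 'u sftr \<Rightarrow> 'u sftr \<Rightarrow> 'u sntr \<Rightarrow> bool" where
  "sntr A B u v \<alpha> \<longleftrightarrow> sfunc A B u \<and> ntr u v \<alpha>"

lemma sntr_func: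
  assumes "sntr A B u v \<alpha>" shows "sfunc A B u" "sfunc A B v" "ntr u v \<alpha>"
  using assms ntr_func[of u v \<alpha>] unfolding sntr_def sfunc_def func_def by auto

lemma sntr_small: "sntr A B u v \<alpha> \<Longrightarrow> small_ntr \<alpha> \<and> NDom \<alpha> = u \<and> NCod \<alpha> = v"
  using sntr_func[of A B u v \<alpha>] sfunc_ends[of A B u] sfunc_ends[of A B v]
  unfolding small_ntr_def ntr_def by auto

lemma is_cat_one: "is_cat one_cat"
  unfolding one_cat_def by (rule is_cat_mk_cat) auto

lemma one_cat_simps [simp]: "Ob one_cat = {undefined}" "Ar one_cat = {undefined}"
  by (simp_all add: one_cat_def)

lemma hom_one: "f \<in> hom one_cat x y \<longleftrightarrow> f = undefined \<and> x = undefined \<and> y = undefined"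
  by (auto simp: hom_iff one_cat_def)

lemma small_one: "universe TYPE('u) \<Longrightarrow> small_cat (one_cat :: 'u scat)"
  unfolding small_cat_def using small_finite is_cat_one by auto

lemma func_to_one_unique:
  assumes F: "func C one_cat F" and G: "func C one_cat G" shows "F = G"
proof (rule ftr_eqI[OF F G])
  show "FO F x = FO G x" if "x \<in> Ob C" for x
    using func_ob[OF F that] func_ob[OF G that] by simp
  show "FA F f = FA G f" if "f \<in> Ar C" for f
    using func_ar[OF F that] func_ar[OF G that] by simp
qed

lemma func_to_one: "is_cat A \<Longrightarrow> func A one_cat (to_one A)"
  unfolding to_one_def by (rule func_mk_ftr) (auto simp: is_cat_one hom_one, auto simp: one_cat_def)

lemma sfunc_to_one: "universe TYPE('u) \<Longrightarrow> small_cat (A :: 'u scat) \<Longrightarrow> sfunc A one_cat (to_one A)"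
  by (simp add: sfunc_def func_to_one small_one, simp add: small_cat_def func_to_one)

lemma to_one_comp: "func A B u \<Longrightarrow> to_one B \<bullet> u = to_one A"
  by (meson func_cat func_comp_ftr func_to_one func_to_one_unique)

lemma to_one_one: "to_one one_cat = id_ftr one_cat"
  by (rule func_to_one_unique[OF func_to_one[OF is_cat_one] func_id_ftr[OF is_cat_one]])

lemma func_point:
  assumes A: "is_cat A" and a: "a \<in> Ob A" shows "func one_cat A (point A a)"
  unfolding point_def
proof (rule func_mk_ftr[OF is_cat_one A])
  show "Idn A a \<in> hom A a a" using cat_id[OF A a] .
  then show "Idn A a = Cmp A (Idn A a) (Idn A a)" using cat_id_left[OF A] by simp
qed (use a in auto)

lemma sfunc_point:
  "universe TYPE('u) \<Longrightarrow> small_cat (A :: 'u scat) \<Longrightarrow> a \<in> Ob A \<Longrightarrow> sfunc one_cat A (point A a)"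
  by (simp add: sfunc_def small_one, simp add: small_cat_def func_point)

lemma point_simps [simp]: "FO (point A a) undefined = a" "FA (point A a) undefined = Idn A a"
  by (simp_all add: point_def)

section \<open>Small copies and slices\<close>

definition enc :: "('o, 'm) cat \<Rightarrow> ('o, 'm, 'u, 'u) ftr" where
  "enc C = mk_ftr C (small_copy C) code code"

definition dec :: "('o, 'm) cat \<Rightarrow> ('u, 'u, 'o, 'm) ftr" where
  "dec C = mk_ftr (small_copy C) C decode decode"

context
  fixes C :: "('o, 'm) cat" and U :: "'u itself"
  assumes C: "is_cat C" and io: "inj (code :: 'o \<Rightarrow> 'u)" and im: "inj (code :: 'm \<Rightarrow> 'u)"
begin

lemma is_cat_small_copy: "is_cat (small_copy C :: 'u scat)"
  unfolding small_copy_def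
proof (rule is_cat_mk_cat)
  fix f :: 'u assume "f \<in> code ` Ar C"
  then obtain f' where f: "f = code f'" "f' \<in> hom C (Dom C f') (Cod C f')" by (auto simp: hom_iff)
  then show "code (Dom C (decode f)) \<in> (code ` Ob C :: 'u set) \<and> code (Cod C (decode f)) \<in> (code ` Ob C :: 'u set)"
    using C im by (auto dest: hom_ob)
  show "code (Cmp C (decode f) (decode (code (Idn C (decode (code (Dom C (decode f)) :: 'u))) :: 'u))) = f \<and>
     code (Cmp C (decode (code (Idn C (decode (code (Cod C (decode f)) :: 'u))) :: 'u)) (decode f)) = f"
    using f io im cat_id_left[OF C f(2)] cat_id_right[OF C f(2)] by simp
next
  fix x :: 'u assume "x \<in> code ` Ob C"
  then obtain x' where x: "x = code x'" "x' \<in> Ob C" by auto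
  then show "code (Idn C (decode x)) \<in> (code ` Ar C :: 'u set) \<and>
      code (Dom C (decode (code (Idn C (decode x)) :: 'u))) = x \<and>
      code (Cod C (decode (code (Idn C (decode x)) :: 'u))) = x"
    using io im cat_id[OF C x(2)] by (simp add: hom_iff)
next
  fix f g :: 'u assume "f \<in> code ` Ar C" "g \<in> code ` Ar C"
    "(code (Cod C (decode f)) :: 'u) = code (Dom C (decode g))"
  then obtain f' g' where fg: "f = code f'" "g = code g'" "f' \<in> Ar C" "g' \<in> Ar C" "Cod C f' = Dom C g'"
    using io im by (auto simp: inj_eq)
  then have "Cmp C g' f' \<in> hom C (Dom C f') (Cod C g')" using cat_comp[OF C] by (simp add: hom_iff)
  then show "code (Cmp C (decode g) (decode f)) \<in> (code ` Ar C :: 'u set) \<and>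
       (code (Dom C (decode (code (Cmp C (decode g) (decode f)) :: 'u))) :: 'u) = code (Dom C (decode f)) \<and>
       (code (Cod C (decode (code (Cmp C (decode g) (decode f)) :: 'u))) :: 'u) = code (Cod C (decode g))"
    using fg im by (simp add: hom_iff)
next
  fix f g h :: 'u assume "f \<in> code ` Ar C" "g \<in> code ` Ar C" "h \<in> code ` Ar C"
    "(code (Cod C (decode f)) :: 'u) = code (Dom C (decode g))"
    "(code (Cod C (decode g)) :: 'u) = code (Dom C (decode h))"
  then obtain f' g' h' where fg: "f = code f'" "g = code g'" "h = code h'" "f' \<in> Ar C" "g' \<in> Ar C"
    "h' \<in> Ar C" "Cod C f' = Dom C g'" "Cod C g' = Dom C h'"
    using io im by (auto simp: inj_eq)
  then have "Cmp C h' (Cmp C g' f') = Cmp C (Cmp C h' g') f'"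
    using cat_assoc[OF C, of f' "Dom C f'" "Dom C g'" g' "Dom C h'" h' "Cod C h'"] by (simp add: hom_iff)
  then show "(code (Cmp C (decode h) (decode (code (Cmp C (decode g) (decode f)) :: 'u))) :: 'u) =
       code (Cmp C (decode (code (Cmp C (decode h) (decode g)) :: 'u)) (decode f))"
    using fg im by simp
qed

lemma small_copy_simps:
  "Ob (small_copy C :: 'u scat) = code ` Ob C" "Ar (small_copy C :: 'u scat) = code ` Ar C"
  "f \<in> Ar C \<Longrightarrow> Dom (small_copy C) (code f :: 'u) = code (Dom C f)"
  "f \<in> Ar C \<Longrightarrow> Cod (small_copy C) (code f :: 'u) = code (Cod C f)"
  "x \<in> Ob C \<Longrightarrow> Idn (small_copy C) (code x :: 'u) = code (Idn C x)"
  using io im by (simp_all add: small_copy_def)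

lemma small_copy_comp:
  "f \<in> hom C x y \<Longrightarrow> g \<in> hom C y z \<Longrightarrow> Cmp (small_copy C) (code g :: 'u) (code f) = code (Cmp C g f)"
  using io im by (simp add: small_copy_def hom_iff)

lemma small_copy_hom:
  "f \<in> hom (small_copy C :: 'u scat) x y \<longleftrightarrow>
     (\<exists>f' x' y'. f = code f' \<and> x = code x' \<and> y = code y' \<and> f' \<in> hom C x' y')"
  by (auto simp: hom_iff small_copy_simps)

lemma func_enc: "func C (small_copy C :: 'u scat) (enc C)"
  unfolding enc_def
  by (rule func_mk_ftr[OF C is_cat_small_copy])
    (auto simp: small_copy_simps small_copy_comp small_copy_hom)

lemma func_dec: "func (small_copy C :: 'u scat) C (dec C)"
  unfolding dec_def
  by (rule func_mk_ftr[OF is_cat_small_copy C])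
    (use io im cat_id[OF C] cat_comp[OF C] in
      \<open>auto simp: small_copy_simps small_copy_hom small_copy_comp inj_eq\<close>)

lemma enc_dec_simps:
  "x \<in> Ob C \<Longrightarrow> FO (enc C) x = (code x :: 'u)" "f \<in> Ar C \<Longrightarrow> FA (enc C) f = (code f :: 'u)"
  "x \<in> Ob C \<Longrightarrow> FO (dec C) (code x :: 'u) = x" "f \<in> Ar C \<Longrightarrow> FA (dec C) (code f :: 'u) = f"
  using io im by (simp_all add: enc_def dec_def small_copy_simps)

lemma dec_enc: "dec C \<bullet> (enc C :: ('o, 'm, 'u, 'u) ftr) = id_ftr C"
  by (rule ftr_eqI[OF func_comp_ftr[OF func_enc func_dec] func_id_ftr[OF C]])
    (use func_enc in \<open>auto simp: func_def enc_dec_simps\<close>)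

lemma enc_dec: "enc C \<bullet> dec C = id_ftr (small_copy C :: 'u scat)"
  by (rule ftr_eqI[OF func_comp_ftr[OF func_dec func_enc] func_id_ftr[OF is_cat_small_copy]])
    (use func_dec in \<open>auto simp: func_def enc_dec_simps small_copy_simps\<close>)

end

lemma slice_over_ob:
  "func A B u \<Longrightarrow> s \<in> Ob (slice_over u b) \<longleftrightarrow> fst s \<in> Ob A \<and> snd s \<in> hom B (FO u (fst s)) b"
  by (cases s) (auto simp: slice_over_def Let_def func_def hom_iff)

lemma slice_over_hom:
  "func A B u \<Longrightarrow> m \<in> hom (slice_over u b) s t \<longleftrightarrow>
     s \<in> Ob (slice_over u b) \<and> t \<in> Ob (slice_over u b) \<and>
     (\<exists>g. m = (s, g, t) \<and> g \<in> hom A (fst s) (fst t) \<and> Cmp B (snd t) (FA u g) = snd s)"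
  by (cases m) (auto simp: slice_over_def Let_def func_def hom_iff)

lemma is_cat_slice_over:
  assumes u: "func A B u" and b: "b \<in> Ob B" shows "is_cat (slice_over u b)"
proof -
  note A = func_cat(1)[OF u] and B = func_cat(2)[OF u]
  have s: "Src u = A" "Trg u = B" using u by (simp_all add: func_def)
  show ?thesis unfolding slice_over_def Let_def s
  proof (rule is_cat_mk_cat, goal_cases)
    case (1 f) then show ?case by auto
  next
    case (2 x)
    then have x: "fst x \<in> Ob A" "snd x \<in> hom B (FO u (fst x)) b" by (auto simp: hom_iff)
    then show ?case using 2 cat_id[OF A x(1)] func_id[OF u x(1)] cat_id_right[OF B x(2)]
      by (auto simp: hom_iff)
  next
    case (3 f g)
    obtain s f' t where f: "f = (s, f', t)" by (cases f)
    obtain t' g' r where g: "g = (t', g', r)" by (cases g)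
    have t: "t' = t" using 3 f g by simp
    have h: "f' \<in> hom A (fst s) (fst t)" "g' \<in> hom A (fst t) (fst r)" "snd r \<in> hom B (FO u (fst r)) b"
      using 3 f g t by (auto simp: hom_iff)
    have "Cmp B (snd r) (FA u (Cmp A g' f')) = snd s"
      using 3 f g t func_comp[OF u h(2,1)] cat_assoc[OF B func_hom[OF u h(1)] func_hom[OF u h(2)] h(3)]
      by auto
    then show ?case using 3 f g t cat_comp[OF A h(2,1)] by (auto simp: hom_iff)
  next
    case (4 f)
    obtain s f' t where f: "f = (s, f', t)" by (cases f)
    have h: "f' \<in> hom A (fst s) (fst t)" using 4 f by (auto simp: hom_iff)
    then show ?case using f cat_id_left[OF A h] cat_id_right[OF A h] by simp
  next
    case (5 f g h)
    obtain s f' t where f: "f = (s, f', t)" by (cases f)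
    obtain t' g' r where g: "g = (t', g', r)" by (cases g)
    obtain r' h' q where h: "h = (r', h', q)" by (cases h)
    have "f' \<in> hom A (fst s) (fst t)" "g' \<in> hom A (fst t) (fst r)" "h' \<in> hom A (fst r) (fst q)"
      using 5 f g h by (auto simp: hom_iff)
    then show ?case using f g h cat_assoc[OF A] by simp
  qed
qed

lemma slice_over_id: "func A B u \<Longrightarrow> s \<in> Ob (slice_over u b) \<Longrightarrow>
    Idn (slice_over u b) s = (s, Idn A (fst s), s)"
  by (simp add: slice_over_def Let_def func_def)

lemma slice_over_comp:
  "func A B u \<Longrightarrow> (s, f, t) \<in> hom (slice_over u b) s t \<Longrightarrow> (t, g, r) \<in> hom (slice_over u b) t r \<Longrightarrow>
    Cmp (slice_over u b) (t, g, r) (s, f, t) = (s, Cmp A g f, r)"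
  by (simp add: slice_over_def Let_def func_def hom_iff)

lemma slice_under_ob:
  "func A B u \<Longrightarrow> s \<in> Ob (slice_under u b) \<longleftrightarrow> fst s \<in> Ob A \<and> snd s \<in> hom B b (FO u (fst s))"
  by (cases s) (auto simp: slice_under_def Let_def func_def hom_iff)

lemma slice_under_hom:
  "func A B u \<Longrightarrow> m \<in> hom (slice_under u b) s t \<longleftrightarrow>
     s \<in> Ob (slice_under u b) \<and> t \<in> Ob (slice_under u b) \<and>
     (\<exists>g. m = (s, g, t) \<and> g \<in> hom A (fst s) (fst t) \<and> Cmp B (FA u g) (snd s) = snd t)"
  by (cases m) (auto simp: slice_under_def Let_def func_def hom_iff)

lemma is_cat_slice_under:
  assumes u: "func A B u" and b: "b \<in> Ob B" shows "is_cat (slice_under u b)"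
proof -
  note A = func_cat(1)[OF u] and B = func_cat(2)[OF u]
  have s: "Src u = A" "Trg u = B" using u by (simp_all add: func_def)
  show ?thesis unfolding slice_under_def Let_def s
  proof (rule is_cat_mk_cat, goal_cases)
    case (1 f) then show ?case by auto
  next
    case (2 x)
    then have x: "fst x \<in> Ob A" "snd x \<in> hom B b (FO u (fst x))" by (auto simp: hom_iff)
    then show ?case using 2 cat_id[OF A x(1)] func_id[OF u x(1)] cat_id_left[OF B x(2)]
      by (auto simp: hom_iff)
  next
    case (3 f g)
    obtain s f' t where f: "f = (s, f', t)" by (cases f)
    obtain t' g' r where g: "g = (t', g', r)" by (cases g)
    have t: "t' = t" using 3 f g by simp
    have h: "f' \<in> hom A (fst s) (fst t)" "g' \<in> hom A (fst t) (fst r)" "snd s \<in> hom B b (FO u (fst s))"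
      using 3 f g t by (auto simp: hom_iff)
    have "Cmp B (FA u (Cmp A g' f')) (snd s) = snd r"
      using 3 f g t func_comp[OF u h(2,1)] cat_assoc[OF B h(3) func_hom[OF u h(1)] func_hom[OF u h(2)]]
      by auto
    then show ?case using 3 f g t cat_comp[OF A h(2,1)] by (auto simp: hom_iff)
  next
    case (4 f)
    obtain s f' t where f: "f = (s, f', t)" by (cases f)
    have h: "f' \<in> hom A (fst s) (fst t)" using 4 f by (auto simp: hom_iff)
    then show ?case using f cat_id_left[OF A h] cat_id_right[OF A h] by simp
  next
    case (5 f g h)
    obtain s f' t where f: "f = (s, f', t)" by (cases f)
    obtain t' g' r where g: "g = (t', g', r)" by (cases g)
    obtain r' h' q where h: "h = (r', h', q)" by (cases h)
    have "f' \<in> hom A (fst s) (fst t)" "g' \<in> hom A (fst t) (fst r)" "h' \<in> hom A (fst r) (fst q)"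
      using 5 f g h by (auto simp: hom_iff)
    then show ?case using f g h cat_assoc[OF A] by simp
  qed
qed

lemma slice_under_id: "func A B u \<Longrightarrow> s \<in> Ob (slice_under u b) \<Longrightarrow>
    Idn (slice_under u b) s = (s, Idn A (fst s), s)"
  by (simp add: slice_under_def Let_def func_def)

lemma slice_under_comp:
  "func A B u \<Longrightarrow> (s, f, t) \<in> hom (slice_under u b) s t \<Longrightarrow> (t, g, r) \<in> hom (slice_under u b) t r \<Longrightarrow>
    Cmp (slice_under u b) (t, g, r) (s, f, t) = (s, Cmp A g f, r)"
  by (simp add: slice_under_def Let_def func_def hom_iff)

context
  fixes u :: "'u sftr" and A B :: "'u scat" and b :: 'u
  assumes U: "universe TYPE('u)" and u: "func A B u" and b: "b \<in> Ob B"
begin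

lemma is_cat_over: "is_cat (over u b)"
  and is_cat_under: "is_cat (under u b)"
  unfolding over_def under_def
  using is_cat_small_copy is_cat_slice_over[OF u b] is_cat_slice_under[OF u b] code_inj_instances[OF U]
  by blast+



lemma over_ob: "x \<in> Ob (over u b) \<longleftrightarrow> (\<exists>s. x = code s \<and> s \<in> Ob (slice_over u b))"
  using small_copy_simps(1)[OF is_cat_slice_over[OF u b]] code_inj_instances[OF U]
  unfolding over_def by blast

lemma over_hom: "m \<in> hom (over u b) x y \<longleftrightarrow>
    (\<exists>m' s t. m = code m' \<and> x = code s \<and> y = code t \<and> m' \<in> hom (slice_over u b) s t)"
  unfolding over_def
  by (rule small_copy_hom[OF is_cat_slice_over[OF u b]]) (rule code_inj_instances[OF U])+

lemma under_ob: "x \<in> Ob (under u b) \<longleftrightarrow> (\<exists>s. x = code s \<and> s \<in> Ob (slice_under u b))"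
  using small_copy_simps(1)[OF is_cat_slice_under[OF u b]] code_inj_instances[OF U]
  unfolding under_def by blast

lemma under_hom: "m \<in> hom (under u b) x y \<longleftrightarrow>
    (\<exists>m' s t. m = code m' \<and> x = code s \<and> y = code t \<and> m' \<in> hom (slice_under u b) s t)"
  unfolding under_def
  by (rule small_copy_hom[OF is_cat_slice_under[OF u b]]) (rule code_inj_instances[OF U])+

lemma over_comp:
  "f \<in> hom (slice_over u b) x y \<Longrightarrow> g \<in> hom (slice_over u b) y z \<Longrightarrow>
     Cmp (over u b) (code g) (code f) = code (Cmp (slice_over u b) g f)"
  unfolding over_def
  by (rule small_copy_comp[OF is_cat_slice_over[OF u b]]) (use code_inj_instances[OF U] in auto)

lemma under_comp:
  "f \<in> hom (slice_under u b) x y \<Longrightarrow> g \<in> hom (slice_under u b) y z \<Longrightarrow>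
     Cmp (under u b) (code g) (code f) = code (Cmp (slice_under u b) g f)"
  unfolding under_def
  by (rule small_copy_comp[OF is_cat_slice_under[OF u b]]) (use code_inj_instances[OF U] in auto)

lemma over_id: "s \<in> Ob (slice_over u b) \<Longrightarrow> Idn (over u b) (code s) = code (Idn (slice_over u b) s)"
  unfolding over_def
  using small_copy_simps(5)[OF is_cat_slice_over[OF u b]] code_inj_instances[OF U] by blast

lemma under_id: "s \<in> Ob (slice_under u b) \<Longrightarrow> Idn (under u b) (code s) = code (Idn (slice_under u b) s)"
  unfolding under_def
  using small_copy_simps(5)[OF is_cat_slice_under[OF u b]] code_inj_instances[OF U] by blast

lemma over_proj_ob: "s \<in> Ob (slice_over u b) \<Longrightarrow> FO (over_proj u b) (code s) = fst s"
  and over_proj_ar: "m \<in> hom (slice_over u b) s t \<Longrightarrow> FA (over_proj u b) (code m) = fst (snd m)"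
  and under_proj_ob: "s \<in> Ob (slice_under u b) \<Longrightarrow> FO (under_proj u b) (code s) = fst s"
  and under_proj_ar: "m' \<in> hom (slice_under u b) s t \<Longrightarrow> FA (under_proj u b) (code m') = fst (snd m')"
proof -
  note i = code_inj_instances[OF U]
  show "FO (over_proj u b) (code s) = fst s" if "s \<in> Ob (slice_over u b)"
  proof -
    have "code s \<in> Ob (over u b)" using over_ob that by blast
    then show ?thesis using i unfolding over_proj_def by simp
  qed
  show "FA (over_proj u b) (code m) = fst (snd m)" if "m \<in> hom (slice_over u b) s t"
  proof -
    have "code m \<in> hom (over u b) (code s) (code t)" using over_hom that by blast
    have "decode (code m :: 'u) = m" by (rule decode_code[OF i(3)])
    then have "fst (snd (decode (code m :: 'u) :: ('u \<times> 'u) \<times> 'u \<times> ('u \<times> 'u))) = fst (snd m)" by simp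
    then show ?thesis using mk_ftr_hom[OF \<open>code m \<in> _\<close>] unfolding over_proj_def by metis
  qed
  show "FO (under_proj u b) (code s) = fst s" if "s \<in> Ob (slice_under u b)"
  proof -
    have "code s \<in> Ob (under u b)" using under_ob that by blast
    then show ?thesis using i unfolding under_proj_def by simp
  qed
  show "FA (under_proj u b) (code m') = fst (snd m')" if "m' \<in> hom (slice_under u b) s t"
  proof -
    have "code m' \<in> hom (under u b) (code s) (code t)" using under_hom that by blast
    have "decode (code m' :: 'u) = m'" by (rule decode_code[OF i(3)])
    then have "fst (snd (decode (code m' :: 'u) :: ('u \<times> 'u) \<times> 'u \<times> ('u \<times> 'u))) = fst (snd m')" by simp
    then show ?thesis using mk_ftr_hom[OF \<open>code m' \<in> _\<close>] unfolding under_proj_def by metis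
  qed
qed

lemma func_over_proj: "func (over u b) A (over_proj u b)"
proof -
  note i = code_inj_instances[OF U]
  have s: "Src u = A" using u by (simp add: func_def)
  show ?thesis unfolding over_proj_def s
  proof (rule func_mk_ftr[OF is_cat_over func_cat(1)[OF u]], goal_cases)
    case (1 a) then show ?case using i by (auto simp: over_ob slice_over_ob[OF u])
  next
    case (2 f x y) then show ?case using i by (auto simp: over_hom slice_over_hom[OF u])
  next
    case (3 a)
    then obtain s where "a = code s" "s \<in> Ob (slice_over u b)" by (auto simp: over_ob)
    then show ?case using i by (simp add: over_id slice_over_id[OF u])
  next
    case (4 f g x y z)
    then obtain f' g' s t t' r where fg: "f = code f'" "g = code g'" "y = code t" "y = code t'"
      "f' \<in> hom (slice_over u b) s t" "g' \<in> hom (slice_over u b) t' r"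
      by (auto simp: over_hom)
    then have t: "t' = t" using i by (simp add: inj_eq)
    obtain f'' g'' where h: "f' = (s, f'', t)" "g' = (t, g'', r)"
      using fg(5,6) t by (auto simp: slice_over_hom[OF u])
    show ?case
      using fg i t h over_comp[OF fg(5) fg(6)[unfolded t]] slice_over_comp[OF u, of s f'' t b g'' r]
      by simp
  qed
qed

lemma func_under_proj: "func (under u b) A (under_proj u b)"
proof -
  note i = code_inj_instances[OF U]
  have s: "Src u = A" using u by (simp add: func_def)
  show ?thesis unfolding under_proj_def s
  proof (rule func_mk_ftr[OF is_cat_under func_cat(1)[OF u]], goal_cases)
    case (1 a) then show ?case using i by (auto simp: under_ob slice_under_ob[OF u])
  next
    case (2 f x y) then show ?case using i by (auto simp: under_hom slice_under_hom[OF u])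
  next
    case (3 a)
    then obtain s where "a = code s" "s \<in> Ob (slice_under u b)" by (auto simp: under_ob)
    then show ?case using i by (simp add: under_id slice_under_id[OF u])
  next
    case (4 f g x y z)
    then obtain f' g' s t t' r where fg: "f = code f'" "g = code g'" "y = code t" "y = code t'"
      "f' \<in> hom (slice_under u b) s t" "g' \<in> hom (slice_under u b) t' r"
      by (auto simp: under_hom)
    then have t: "t' = t" using i by (simp add: inj_eq)
    obtain f'' g'' where h: "f' = (s, f'', t)" "g' = (t, g'', r)"
      using fg(5,6) t by (auto simp: slice_under_hom[OF u])
    show ?case
      using fg i t h under_comp[OF fg(5) fg(6)[unfolded t]] slice_under_comp[OF u, of s f'' t b g'' r]
      by simp
  qed
qed

lemma ntr_over_cell:
  "ntr (u \<bullet> over_proj u b) (point B b \<bullet> to_one (over u b)) (over_cell u b)"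
proof -
  note i = code_inj_instances[OF U] and B = func_cat(2)[OF u]
  have s: "Trg u = B" using u by (simp add: func_def)
  note p = func_over_proj and t = func_to_one[OF is_cat_over]
  note up = func_comp_ftr[OF p u] and bt = func_comp_ftr[OF t func_point[OF B b]]
  show ?thesis unfolding over_cell_def s
  proof (rule ntr_mk_ntr[OF up bt], goal_cases)
    case (1 x)
    have "FO (point B b \<bullet> to_one (over u b)) x = b"
      using 1 by (simp add: comp_ob[OF t 1], simp add: to_one_def)
    moreover obtain s where s: "x = code s" "s \<in> Ob (slice_over u b)" using 1 over_ob by auto
    moreover have "FO (u \<bullet> over_proj u b) x = FO u (fst s)"
      using comp_ob[OF p 1] s by (simp add: over_proj_ob)
    ultimately show ?case using i by (simp add: slice_over_ob[OF u])
  next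
    case (2 f x y)
    obtain m s t' where m: "f = code m" "x = code s" "y = code t'" "m \<in> hom (slice_over u b) s t'"
      using 2 by (auto simp: over_hom)
    then obtain g where g: "m = (s, g, t')" "Cmp B (snd t') (FA u g) = snd s"
      "snd s \<in> hom B (FO u (fst s)) b"
      by (auto simp: slice_over_hom[OF u] slice_over_ob[OF u])
    have "FA (point B b \<bullet> to_one (over u b)) f = Idn B b"
      using 2 by (simp add: comp_hom[OF t 2], simp add: to_one_def)
    moreover have "FA (u \<bullet> over_proj u b) f = FA u g"
      using comp_hom[OF p 2] m g over_proj_ar[OF m(4)] by simp
    ultimately show ?case using g m i cat_id_left[OF B g(3)] by simp
  qed
qed

lemma ntr_under_cell:
  "ntr (point B b \<bullet> to_one (under u b)) (u \<bullet> under_proj u b) (under_cell u b)"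
proof -
  note i = code_inj_instances[OF U] and B = func_cat(2)[OF u]
  have s: "Trg u = B" using u by (simp add: func_def)
  note p = func_under_proj and t = func_to_one[OF is_cat_under]
  note up = func_comp_ftr[OF p u] and bt = func_comp_ftr[OF t func_point[OF B b]]
  show ?thesis unfolding under_cell_def s
  proof (rule ntr_mk_ntr[OF bt up], goal_cases)
    case (1 x)
    have "FO (point B b \<bullet> to_one (under u b)) x = b"
      using 1 by (simp add: comp_ob[OF t 1], simp add: to_one_def)
    moreover obtain s where s: "x = code s" "s \<in> Ob (slice_under u b)" using 1 under_ob by auto
    moreover have "FO (u \<bullet> under_proj u b) x = FO u (fst s)"
      using comp_ob[OF p 1] s by (simp add: under_proj_ob)
    ultimately show ?case using i by (simp add: slice_under_ob[OF u])
  next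
    case (2 f x y)
    obtain m s t' where m: "f = code m" "x = code s" "y = code t'" "m \<in> hom (slice_under u b) s t'"
      using 2 by (auto simp: under_hom)
    then obtain g where g: "m = (s, g, t')" "Cmp B (FA u g) (snd s) = snd t'"
      "snd t' \<in> hom B b (FO u (fst t'))"
      by (auto simp: slice_under_hom[OF u] slice_under_ob[OF u])
    have "FA (point B b \<bullet> to_one (under u b)) f = Idn B b"
      using 2 by (simp add: comp_hom[OF t 2], simp add: to_one_def)
    moreover have "FA (u \<bullet> under_proj u b) f = FA u g"
      using comp_hom[OF p 2] m g under_proj_ar[OF m(4)] by simp
    moreover have "snd s \<in> hom B b (FO u (fst s))"
      using m(4) by (auto simp: slice_under_hom[OF u] slice_under_ob[OF u])
    ultimately show ?case using g m i cat_id_right[OF B] by simp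
  qed
qed

end

section \<open>Prederivators\<close>

context
  fixes D :: "('u, 'o, 'm) prederiv"
  assumes pd: "prederivator D"
begin

lemma pd_cat: "small_cat A \<Longrightarrow> is_cat (DO D A)"
  and pd_id: "small_cat A \<Longrightarrow> DF D (id_ftr A) = id_ftr (DO D A)"
  using pd unfolding prederivator_def by blast+

lemma pd_func: "sfunc A B u \<Longrightarrow> func (DO D B) (DO D A) (DF D u)"
  using pd sfunc_ends[of A B u] unfolding prederivator_def func_def by blast

lemma pd_comp: "sfunc A B u \<Longrightarrow> sfunc B C v \<Longrightarrow> DF D (v \<bullet> u) = DF D u \<bullet> DF D v"
  using pd sfunc_ends[of A B u] sfunc_ends[of B C v] unfolding prederivator_def by blast

lemma pd_comp_ob: "sfunc A B u \<Longrightarrow> sfunc B C v \<Longrightarrow> Z \<in> Ob (DO D C) \<Longrightarrow>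
    FO (DF D (v \<bullet> u)) Z = FO (DF D u) (FO (DF D v) Z)"
  using comp_ob[OF pd_func[of B C v]] by (simp add: pd_comp)

lemma pd_comp_hom: "sfunc A B u \<Longrightarrow> sfunc B C v \<Longrightarrow> f \<in> hom (DO D C) Z W \<Longrightarrow>
    FA (DF D (v \<bullet> u)) f = FA (DF D u) (FA (DF D v) f)"
  using comp_hom[OF pd_func[of B C v]] by (simp add: pd_comp)

lemma pd_id_ob: "small_cat A \<Longrightarrow> Z \<in> Ob (DO D A) \<Longrightarrow> FO (DF D (id_ftr A)) Z = Z"
  and pd_id_hom: "small_cat A \<Longrightarrow> f \<in> hom (DO D A) Z W \<Longrightarrow> FA (DF D (id_ftr A)) f = f"
  by (simp_all add: pd_id hom_iff)

lemma pd_ntr: "sntr A B u v \<alpha> \<Longrightarrow> ntr (DF D u) (DF D v) (DN D \<alpha>)"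
  using pd sntr_small[of A B u v \<alpha>] unfolding prederivator_def ntr_def by blast

lemma pd_cpt_hom: "sntr A B u v \<alpha> \<Longrightarrow> Z \<in> Ob (DO D B) \<Longrightarrow>
    Cpt (DN D \<alpha>) Z \<in> hom (DO D A) (FO (DF D u) Z) (FO (DF D v) Z)"
  using ntr_hom[OF pd_ntr pd_func] sntr_func(1) by blast

lemma pd_nat: "sntr A B u v \<alpha> \<Longrightarrow> f \<in> hom (DO D B) Z W \<Longrightarrow>
    Cmp (DO D A) (Cpt (DN D \<alpha>) W) (FA (DF D u) f) =
    Cmp (DO D A) (FA (DF D v) f) (Cpt (DN D \<alpha>) Z)"
  using ntr_nat[OF pd_ntr pd_func] sntr_func(1) by blast

lemma pd_vcomp:
  assumes a: "sntr A B u v \<alpha>" and b: "sntr A B v w \<beta>" and Z: "Z \<in> Ob (DO D B)"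
  shows "Cpt (DN D (\<beta> \<odot> \<alpha>)) Z = Cmp (DO D A) (Cpt (DN D \<beta>) Z) (Cpt (DN D \<alpha>) Z)"
proof -
  have "DN D (\<beta> \<odot> \<alpha>) = DN D \<beta> \<odot> DN D \<alpha>"
    using pd sntr_small[OF a] sntr_small[OF b] unfolding prederivator_def by auto
  moreover have "NDom (DN D \<alpha>) = DF D u" "Src (DF D u) = DO D B" "Trg (DF D u) = DO D A"
    using pd_ntr[OF a] pd_func[OF sntr_func(1)[OF a]] by (auto simp: ntr_def func_def)
  ultimately show ?thesis using Z by simp
qed

lemma pd_whisker_left:
  assumes a: "sntr A B u v \<alpha>" and w: "sfunc B C w" and Z: "Z \<in> Ob (DO D C)"
  shows "Cpt (DN D (w \<lhd> \<alpha>)) Z = Cpt (DN D \<alpha>) (FO (DF D w) Z)"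
proof -
  have t: "Trg (NDom \<alpha>) = B" using a by (auto simp: sntr_def sfunc_def func_def ntr_def)
  have "DN D (w \<lhd> \<alpha>) = DN D \<alpha> \<rhd> DF D w"
    using pd sntr_small[OF a] sfunc_ends[OF w] t unfolding prederivator_def by auto
  moreover have "Src (DF D w) = DO D C" using pd_func[OF w] by (simp add: func_def)
  ultimately show ?thesis using Z by simp
qed

lemma pd_whisker_right:
  assumes a: "sntr A B u v \<alpha>" and t: "sfunc T A t" and Z: "Z \<in> Ob (DO D B)"
  shows "Cpt (DN D (\<alpha> \<rhd> t)) Z = FA (DF D t) (Cpt (DN D \<alpha>) Z)"
proof -
  have s: "Src (NDom \<alpha>) = A" using a by (auto simp: sntr_def sfunc_def func_def ntr_def)
  have "DN D (\<alpha> \<rhd> t) = DF D t \<lhd> DN D \<alpha>"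
    using pd sntr_small[OF a] sfunc_ends[OF t] s unfolding prederivator_def by auto
  moreover have "NDom (DN D \<alpha>) = DF D u" "Src (DF D u) = DO D B"
    using pd_ntr[OF a] pd_func[OF sntr_func(1)[OF a]] by (auto simp: ntr_def func_def)
  ultimately show ?thesis using Z by simp
qed

lemma pd_id_ntr:
  assumes u: "sfunc A B u" and Z: "Z \<in> Ob (DO D B)"
  shows "Cpt (DN D (id_ntr u)) Z = Idn (DO D A) (FO (DF D u) Z)"
proof -
  have "DN D (id_ntr u) = id_ntr (DF D u)"
    using pd sfunc_ends[OF u] unfolding prederivator_def by blast
  moreover have "Src (DF D u) = DO D B" "Trg (DF D u) = DO D A"
    using pd_func[OF u] by (auto simp: func_def)
  ultimately show ?thesis using Z by simp
qed

lemma sntr_id: "sfunc A B u \<Longrightarrow> sntr A B u u (id_ntr u)"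
  by (auto simp: sntr_def sfunc_def intro: ntr_id_ntr)

text \<open>
  Constant diagrams do not see 2-cells: a 2-cell followed by the functor to the terminal category is an
  identity.
\<close>

lemma pd_const:
  assumes U: "universe TYPE('u)" and a: "sntr A B u v \<alpha>" and Y: "Y \<in> Ob (DO D one_cat)"
  shows "Cpt (DN D \<alpha>) (FO (DF D (to_one B)) Y) = Idn (DO D A) (FO (DF D (to_one A)) Y)"
proof -
  note f = sntr_func[OF a]
  have tB: "sfunc B one_cat (to_one B)" and tA: "sfunc A one_cat (to_one A)"
    using sfunc_to_one[OF U] sfunc_small[OF f(1)] by auto
  have 1: "to_one B \<bullet> u = to_one A" "to_one B \<bullet> v = to_one A"
    using to_one_comp sfunc_func[OF f(1)] sfunc_func[OF f(2)] by auto
  have w: "ntr (to_one A) (to_one A) (to_one B \<lhd> \<alpha>)"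
    using ntr_whisker_left[OF f(3) sfunc_func[OF f(1)] sfunc_func[OF tB]] 1 by simp
  have "to_one B \<lhd> \<alpha> = id_ntr (to_one A)"
  proof (rule ntr_eqI[OF w ntr_id_ntr[OF sfunc_func[OF tA]]])
    fix x assume "x \<in> Ob (Src (to_one A))"
    then have x: "x \<in> Ob A" using sfunc_ends[OF tA] by simp
    show "Cpt (to_one B \<lhd> \<alpha>) x = Cpt (id_ntr (to_one A)) x"
      using ntr_hom[OF w sfunc_func[OF tA] x] ntr_hom[OF ntr_id_ntr sfunc_func[OF tA] x]
        sfunc_func[OF tA] by (simp add: hom_one)
  qed
  then show ?thesis using pd_whisker_left[OF a tB Y] pd_id_ntr[OF tA Y] by simp
qed

subsection \<open>Pasting an arrow with a 2-cell\<close>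

text \<open>
  For \<open>\<alpha> : u p \<Rightarrow> w q\<close> and \<open>e : X \<rightarrow> u\<^sup>* Z\<close> this is \<open>p\<^sup>* X \<rightarrow> p\<^sup>* u\<^sup>* Z \<rightarrow> q\<^sup>* w\<^sup>* Z\<close>.  For the cell of a slice
  \<open>u/b\<close> and the unit \<open>e\<close> it is the colimiting cocone whose vertex is the value of \<open>u\<^sub>! X\<close> at \<open>b\<close>.
\<close>

definition pasted :: "'u sftr \<Rightarrow> 'u sntr \<Rightarrow> 'o \<Rightarrow> 'm \<Rightarrow> 'm" where
  "pasted p \<alpha> Z e = Cmp (DO D (Src p)) (Cpt (DN D \<alpha>) Z) (FA (DF D p) e)"

lemma pasted_hom:
  assumes p: "sfunc P A p" and u: "sfunc A B u" and q: "sfunc P Q q" and w: "sfunc Q B w"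
    and a: "sntr P B (u \<bullet> p) (w \<bullet> q) \<alpha>"
    and Z: "Z \<in> Ob (DO D B)" and e: "e \<in> hom (DO D A) X (FO (DF D u) Z)"
  shows "pasted p \<alpha> Z e \<in> hom (DO D P) (FO (DF D p) X) (FO (DF D q) (FO (DF D w) Z))"
proof -
  have s: "Src p = P" using sfunc_ends[OF p] by simp
  show ?thesis unfolding pasted_def s
    using cat_comp[OF pd_cat[OF sfunc_small(1)[OF p]] pd_cpt_hom[OF a Z]] func_hom[OF pd_func[OF p] e]
    by (simp add: pd_comp_ob[OF p u Z] pd_comp_ob[OF q w Z])
qed

lemma pasted_natural:
  assumes p: "sfunc P A p" and u: "sfunc A B u" and q: "sfunc P Q q" and w: "sfunc Q B w"
    and a: "sntr P B (u \<bullet> p) (w \<bullet> q) \<alpha>"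
    and g: "g \<in> hom (DO D B) Z W" and e: "e \<in> hom (DO D A) X (FO (DF D u) Z)"
  shows "pasted p \<alpha> W (Cmp (DO D A) (FA (DF D u) g) e) =
    Cmp (DO D P) (FA (DF D q) (FA (DF D w) g)) (pasted p \<alpha> Z e)"
proof -
  have s: "Src p = P" using sfunc_ends[OF p] by simp
  note P = pd_cat[OF sfunc_small(1)[OF p]]
  have Z: "Z \<in> Ob (DO D B)" and W: "W \<in> Ob (DO D B)"
    using hom_ob[OF pd_cat[OF sfunc_small(2)[OF u]] g] by auto
  note up = sfunc_comp[OF p u] and wq = sfunc_comp[OF q w]
  have pe: "FA (DF D p) e \<in> hom (DO D P) (FO (DF D p) X) (FO (DF D (u \<bullet> p)) Z)"
    using func_hom[OF pd_func[OF p] e] pd_comp_ob[OF p u Z] by simp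
  have "pasted p \<alpha> W (Cmp (DO D A) (FA (DF D u) g) e) =
      Cmp (DO D P) (Cpt (DN D \<alpha>) W) (Cmp (DO D P) (FA (DF D (u \<bullet> p)) g) (FA (DF D p) e))"
    unfolding pasted_def s
    using func_comp[OF pd_func[OF p] func_hom[OF pd_func[OF u] g] e] pd_comp_hom[OF p u g] by simp
  also have "\<dots> = Cmp (DO D P) (Cmp (DO D P) (FA (DF D (w \<bullet> q)) g) (Cpt (DN D \<alpha>) Z)) (FA (DF D p) e)"
    using cat_assoc[OF P pe func_hom[OF pd_func[OF up] g] pd_cpt_hom[OF a W]] pd_nat[OF a g] by simp
  also have "\<dots> = Cmp (DO D P) (FA (DF D (w \<bullet> q)) g) (pasted p \<alpha> Z e)"
    unfolding pasted_def s
    using cat_assoc[OF P pe pd_cpt_hom[OF a Z] func_hom[OF pd_func[OF wq] g]] by simp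
  finally show ?thesis using pd_comp_hom[OF q w g] by simp
qed

text \<open>
  The mate of \<open>\<alpha>\<close> at \<open>X\<close> is the transpose of the unit of \<open>u\<^sub>! \<stileturn> u\<^sup>*\<close> pasted with \<open>\<alpha>\<close>; so if the mate is
  invertible, pasting with \<open>\<alpha>\<close> takes universal arrows to universal arrows.
\<close>

lemma left_mate_universal:
  assumes p: "sfunc P A p" and u: "sfunc A B u" and q: "sfunc P Q q" and w: "sfunc Q B w"
    and a: "sntr P B (u \<bullet> p) (w \<bullet> q) \<alpha>"
    and Lu: "left_kan D u Lu \<eta>u \<epsilon>u" and Lq: "left_kan D q Lq \<eta>q \<epsilon>q"
    and iso: "nat_iso (left_mate D p w \<alpha> Lu \<eta>u Lq \<epsilon>q)"
    and e: "universal (DF D u) X Z e"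
  shows "universal (DF D q) (FO (DF D p) X) (FO (DF D w) Z) (pasted p \<alpha> Z e)"
proof -
  note adu = Lu[unfolded left_kan_def] and adq = Lq[unfolded left_kan_def]
  note fu = pd_func[OF u] and fq = pd_func[OF q] and fp = pd_func[OF p] and fw = pd_func[OF w]
  note eh = universal_hom[OF fu e] and Z = universal_ob[OF fu e]
  have X: "X \<in> Ob (DO D A)" using hom_ob[OF func_cat(2)[OF fu] eh] by simp
  note fLu = adjunction_data(1)[OF adu fu] and fLq = adjunction_data(1)[OF adq fq]
  let ?LX = "FO Lu X"
  have LX: "?LX \<in> Ob (DO D B)" using func_ob[OF fLu X] .
  have wLX: "FO (DF D w) ?LX \<in> Ob (DO D Q)" using func_ob[OF fw LX] .
  note nX = adjunction_unit(1)[OF adu fu X] and un = adjunction_unit_universal[OF adu fu X]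
  have s: "Src p = P" using sfunc_ends[OF p] by simp
  have ends: "NDom \<eta>u = id_ftr (DO D A)" "NDom (DN D \<alpha>) = DF D (u \<bullet> p)" "NDom \<epsilon>q = Lq \<bullet> DF D q"
    "Src Lu = DO D A" "Trg Lq = DO D Q" "Src (DF D (u \<bullet> p)) = DO D B"
    using adjunction_data[OF adu fu] adjunction_data[OF adq fq] pd_ntr[OF a]
      pd_func[OF sfunc_comp[OF p u]] fLu fLq by (auto simp: ntr_def func_def)
  note pn = pasted_hom[OF p u q w a LX nX]
  have ph: "FA (DF D p) (Cpt \<eta>u X) \<in> hom (DO D P) (FO (DF D p) X) (FO (DF D (u \<bullet> p)) ?LX)"
    using func_hom[OF fp nX] pd_comp_ob[OF p u LX] by simp
  have "iso_arrow (DO D Q) (Cpt (left_mate D p w \<alpha> Lu \<eta>u Lq \<epsilon>q) X)"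
    using iso X unfolding nat_iso_def left_mate_def by (simp add: ends)
  moreover have "Cpt (left_mate D p w \<alpha> Lu \<eta>u Lq \<epsilon>q) X = Cmp (DO D Q) (Cpt \<epsilon>q (FO (DF D w) ?LX))
      (Cmp (DO D Q) (FA Lq (Cpt (DN D \<alpha>) ?LX)) (FA Lq (FA (DF D p) (Cpt \<eta>u X))))"
    using X unfolding left_mate_def by (simp add: ends)
  moreover have "\<dots> = Cmp (DO D Q) (Cpt \<epsilon>q (FO (DF D w) ?LX)) (FA Lq (pasted p \<alpha> ?LX (Cpt \<eta>u X)))"
    unfolding pasted_def s using func_comp[OF fLq pd_cpt_hom[OF a LX] ph] by simp
  ultimately have "universal (DF D q) (FO (DF D p) X) (FO (DF D w) ?LX) (pasted p \<alpha> ?LX (Cpt \<eta>u X))"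
    using transpose_iso_iff_universal[OF adq fq wLX pn] adjunction_transpose(1)[OF adq fq wLX pn]
    by (simp add: isos_def)
  moreover obtain g where g: "g \<in> hom (DO D B) ?LX Z" "Cmp (DO D A) (FA (DF D u) g) (Cpt \<eta>u X) = e"
    using universal_factor[OF fu un Z eh] .
  then have "g \<in> isos (DO D B) ?LX Z" using universal_iso[OF fu un e] by simp
  moreover have "pasted p \<alpha> Z e =
      Cmp (DO D P) (FA (DF D q) (FA (DF D w) g)) (pasted p \<alpha> ?LX (Cpt \<eta>u X))"
    using pasted_natural[OF p u q w a g(1) nX] g(2) by simp
  ultimately show ?thesis using universal_comp_iso[OF fq _ func_isos[OF fw]] by metis
qed

end

section \<open>Pointwise Kan extensions\<close>

lemma derivator_prederivator: "derivator D \<Longrightarrow> prederivator D"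
  by (simp add: derivator_def)

context
  fixes D :: "('u, 'o, 'm) prederiv"
  assumes U: "universe TYPE('u)" and der: "derivator D"
begin

lemmas pd = derivator_prederivator[OF der]

lemma kan_exists:
  assumes u: "sfunc A B u"
  obtains L \<eta> \<epsilon> where "left_kan D u L \<eta> \<epsilon>"
  using der sfunc_ends[OF u] unfolding derivator_def Der3_def by blast

lemma universal_exists:
  assumes u: "sfunc A B u" and X: "X \<in> Ob (DO D A)"
  obtains Z e where "universal (DF D u) X Z e"
proof -
  obtain L \<eta> \<epsilon> where "left_kan D u L \<eta> \<epsilon>" using kan_exists[OF u] .
  from adjunction_unit_universal[OF this[unfolded left_kan_def] pd_func[OF pd u] X] that
  show thesis by blast
qed

lemma pointwise_iso:
  assumes A: "small_cat A" and f: "f \<in> hom (DO D A) X Y"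
    and "\<And>a. a \<in> Ob A \<Longrightarrow> iso_arrow (DO D one_cat) (FA (DF D (point A a)) f)"
  shows "f \<in> isos (DO D A) X Y"
  using assms der unfolding derivator_def Der2_def isos_def by (auto simp: hom_iff)

context
  fixes A B :: "'u scat" and u :: "'u sftr" and b :: 'u
  assumes u: "sfunc A B u" and b: "b \<in> Ob B"
begin

lemma sfunc_over_proj: "small_cat (over u b) \<Longrightarrow> sfunc (over u b) A (over_proj u b)"
  using u func_over_proj[OF U sfunc_func[OF u] b] by (simp add: sfunc_def)

lemma sfunc_under_proj: "small_cat (under u b) \<Longrightarrow> sfunc (under u b) A (under_proj u b)"
  using u func_under_proj[OF U sfunc_func[OF u] b] by (simp add: sfunc_def)

lemma sntr_over_cell: "small_cat (over u b) \<Longrightarrow>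
    sntr (over u b) B (u \<bullet> over_proj u b) (point B b \<bullet> to_one (over u b)) (over_cell u b)"
  using ntr_over_cell[OF U sfunc_func[OF u] b] sfunc_comp[OF sfunc_over_proj u] by (simp add: sntr_def)

lemma sntr_under_cell: "small_cat (under u b) \<Longrightarrow>
    sntr (under u b) B (point B b \<bullet> to_one (under u b)) (u \<bullet> under_proj u b) (under_cell u b)"
  using ntr_under_cell[OF U sfunc_func[OF u] b] u
    sfunc_comp[OF sfunc_to_one[OF U] sfunc_point[OF U _ b]] by (simp add: sntr_def sfunc_def)

lemma over_universal:
  assumes s: "small_cat (over u b)" and e: "universal (DF D u) X Z e"
  shows "universal (DF D (to_one (over u b))) (FO (DF D (over_proj u b)) X)
    (FO (DF D (point B b)) Z) (pasted D (over_proj u b) (over_cell u b) Z e)"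
proof -
  note t = sfunc_to_one[OF U s] and pt = sfunc_point[OF U sfunc_small(2)[OF u] b]
  obtain Lu \<eta>u \<epsilon>u where Lu: "left_kan D u Lu \<eta>u \<epsilon>u" using kan_exists[OF u] .
  obtain Lq \<eta>q \<epsilon>q where Lq: "left_kan D (to_one (over u b)) Lq \<eta>q \<epsilon>q" using kan_exists[OF t] .
  have "nat_iso (left_mate D (over_proj u b) (point B b) (over_cell u b) Lu \<eta>u Lq \<epsilon>q)"
    using der sfunc_ends[OF u] b Lu Lq unfolding derivator_def Der4_def by blast
  from left_mate_universal[OF pd sfunc_over_proj[OF s] u t pt sntr_over_cell[OF s] Lu Lq this e]
  show ?thesis .
qed

end

text \<open>
  The comparison of \<open>e\<close> with a universal arrow is, at every point, a comparison of two colimiting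
  cocones, hence an isomorphism.
\<close>

lemma universal_pointwise:
  assumes u: "sfunc A B u" and s: "\<And>b. b \<in> Ob B \<Longrightarrow> small_cat (over u b)"
    and Z: "Z \<in> Ob (DO D B)" and e: "e \<in> hom (DO D A) X (FO (DF D u) Z)"
    and pw: "\<And>b. b \<in> Ob B \<Longrightarrow> universal (DF D (to_one (over u b))) (FO (DF D (over_proj u b)) X)
      (FO (DF D (point B b)) Z) (pasted D (over_proj u b) (over_cell u b) Z e)"
  shows "universal (DF D u) X Z e"
proof -
  note fu = pd_func[OF pd u]
  have X: "X \<in> Ob (DO D A)" using hom_ob[OF func_cat(2)[OF fu] e] by simp
  obtain Z0 e0 where e0: "universal (DF D u) X Z0 e0" using universal_exists[OF u X] .
  obtain g where g: "g \<in> hom (DO D B) Z0 Z" "Cmp (DO D A) (FA (DF D u) g) e0 = e"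
    using universal_factor[OF fu e0 Z e] .
  note e0h = universal_hom[OF fu e0]
  have "g \<in> isos (DO D B) Z0 Z"
  proof (rule pointwise_iso[OF sfunc_small(2)[OF u] g(1)])
    fix b assume b: "b \<in> Ob B"
    note t = sfunc_to_one[OF U s[OF b]] and pt = sfunc_point[OF U sfunc_small(2)[OF u] b]
    note nat = pasted_natural[OF pd sfunc_over_proj[OF u b s[OF b]] u t pt
        sntr_over_cell[OF u b s[OF b]] g(1) e0h]
    have "FA (DF D (point B b)) g \<in>
        isos (DO D one_cat) (FO (DF D (point B b)) Z0) (FO (DF D (point B b)) Z)"
      using universal_iso[OF pd_func[OF pd t] over_universal[OF u b s[OF b] e0] pw[OF b]
          func_hom[OF pd_func[OF pd pt] g(1)]] nat g(2) by simp
    then show "iso_arrow (DO D one_cat) (FA (DF D (point B b)) g)" by (rule isos_arrow)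
  qed
  then show ?thesis using universal_comp_iso[OF fu e0] g(2) by metis
qed

end

section \<open>Finality\<close>

text \<open>
  Universal cocones on \<open>X\<close> restrict to universal cocones on \<open>q\<^sup>* X\<close>.  By uniqueness this says that the
  comparison from the colimit of \<open>q\<^sup>* X\<close> to the colimit of \<open>X\<close> is invertible.
\<close>

definition colimit_final :: "('u, 'o, 'm) prederiv \<Rightarrow> 'u sftr \<Rightarrow> bool" where
  "colimit_final D q \<longleftrightarrow> (\<forall>X Z e. universal (DF D (to_one (Trg q))) X Z e \<longrightarrow>
     universal (DF D (to_one (Src q))) (FO (DF D q) X) Z (FA (DF D q) e))"

text \<open>
  By the universal property, \<open>q\<close> is final as soon as cocones on \<open>X\<close> are the same as cocones on the
  restriction of \<open>X\<close> along \<open>q\<close>.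
\<close>

lemma colimit_finalI:
  fixes D :: "('u, 'o, 'm) prederiv"
  assumes U: "universe TYPE('u)" and pd: "prederivator D" and q: "sfunc K C q"
    and bij: "\<And>X W. X \<in> Ob (DO D C) \<Longrightarrow> W \<in> Ob (DO D one_cat) \<Longrightarrow>
      bij_betw (FA (DF D q)) (hom (DO D C) X (FO (DF D (to_one C)) W))
        (hom (DO D K) (FO (DF D q) X) (FO (DF D (to_one K)) W))"
  shows "colimit_final D q"
  unfolding colimit_final_def
proof (intro allI impI)
  fix X Z e assume "universal (DF D (to_one (Trg q))) X Z e"
  then have e: "universal (DF D (to_one C)) X Z e" using sfunc_ends[OF q] by simp
  note tC = sfunc_to_one[OF U sfunc_small(2)[OF q]] and tK = sfunc_to_one[OF U sfunc_small(1)[OF q]]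
  note fC = pd_func[OF pd tC] and fK = pd_func[OF pd tK] and fq = pd_func[OF pd q]
  note eh = universal_hom[OF fC e] and Z = universal_ob[OF fC e]
  have X: "X \<in> Ob (DO D C)" using hom_ob[OF func_cat(2)[OF fC] eh] by simp
  have t: "to_one C \<bullet> q = to_one K" using to_one_comp sfunc_func[OF q] by blast
  have ob: "FO (DF D q) (FO (DF D (to_one C)) W) = FO (DF D (to_one K)) W"
    if "W \<in> Ob (DO D one_cat)" for W
    using pd_comp_ob[OF pd q tC that] t by simp
  have comp: "Cmp (DO D K) (FA (DF D (to_one K)) g) (FA (DF D q) e) =
      FA (DF D q) (Cmp (DO D C) (FA (DF D (to_one C)) g) e)" if "g \<in> hom (DO D one_cat) Z W" for g W
    using pd_comp_hom[OF pd q tC that] t func_comp[OF fq func_hom[OF fC that] eh] by simp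
  have "universal (DF D (to_one K)) (FO (DF D q) X) Z (FA (DF D q) e)"
  proof (rule universalI[OF fK Z])
    show "FA (DF D q) e \<in> hom (DO D K) (FO (DF D q) X) (FO (DF D (to_one K)) Z)"
      using func_hom[OF fq eh] ob[OF Z] by simp
    show "\<exists>g\<in>hom (DO D one_cat) Z W. Cmp (DO D K) (FA (DF D (to_one K)) g) (FA (DF D q) e) = f"
      if W: "W \<in> Ob (DO D one_cat)" and f: "f \<in> hom (DO D K) (FO (DF D q) X) (FO (DF D (to_one K)) W)"
      for W f
    proof -
      obtain f' where f': "f' \<in> hom (DO D C) X (FO (DF D (to_one C)) W)" "FA (DF D q) f' = f"
        using bij[OF X W] f unfolding bij_betw_def by (metis imageE)
      obtain g where g: "g \<in> hom (DO D one_cat) Z W" "Cmp (DO D C) (FA (DF D (to_one C)) g) e = f'"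
        using universal_factor[OF fC e W f'(1)] .
      show ?thesis using g comp[OF g(1)] f'(2) by (intro bexI[of _ g]) simp_all
    qed
    show "g = h" if W: "W \<in> Ob (DO D one_cat)" and g: "g \<in> hom (DO D one_cat) Z W"
      and h: "h \<in> hom (DO D one_cat) Z W"
      and eq: "Cmp (DO D K) (FA (DF D (to_one K)) g) (FA (DF D q) e) =
        Cmp (DO D K) (FA (DF D (to_one K)) h) (FA (DF D q) e)" for W g h
    proof -
      have "Cmp (DO D C) (FA (DF D (to_one C)) g) e = Cmp (DO D C) (FA (DF D (to_one C)) h) e"
        using bij[OF X W] eq comp[OF g] comp[OF h] cat_comp[OF func_cat(2)[OF fC] func_hom[OF fC g] eh]
          cat_comp[OF func_cat(2)[OF fC] func_hom[OF fC h] eh]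
        unfolding bij_betw_def inj_on_def by metis
      then show ?thesis using universal_unique[OF fC e W g h] by simp
    qed
  qed
  then show "universal (DF D (to_one (Src q))) (FO (DF D q) X) Z (FA (DF D q) e)"
    using sfunc_ends[OF q] by simp
qed

text \<open>Pasting with the identity 2-cell of \<open>\<pi> v = \<pi>\<close> is restriction along \<open>v\<close>.\<close>

lemma homotopy_final_colimit_final:
  fixes D :: "('u, 'o, 'm) prederiv"
  assumes U: "universe TYPE('u)" and der: "derivator D" and v: "homotopy_final TYPE('o \<times> 'm) v"
  shows "colimit_final D v"
  unfolding colimit_final_def
proof (intro allI impI)
  fix X Z e assume e: "universal (DF D (to_one (Trg v))) X Z e"
  note pd = derivator_prederivator[OF der]
  let ?C = "Src v" and ?D = "Trg v"
  have v': "sfunc ?C ?D v" using v sfunc_iff unfolding homotopy_final_def by blast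
  note tD = sfunc_to_one[OF U sfunc_small(2)[OF v']] and tC = sfunc_to_one[OF U sfunc_small(1)[OF v']]
  note one = sfunc_id[OF small_one[OF U]]
  have t: "to_one ?D \<bullet> v = to_one ?C" "id_ftr one_cat \<bullet> to_one ?C = to_one ?C"
    using to_one_comp[OF sfunc_func[OF v']] comp_id_left[OF sfunc_func[OF tC]] by auto
  obtain LD \<eta>D \<epsilon>D where LD: "left_kan D (to_one ?D) LD \<eta>D \<epsilon>D" using kan_exists[OF U der tD] .
  obtain LC \<eta>C \<epsilon>C where LC: "left_kan D (to_one ?C) LC \<eta>C \<epsilon>C" using kan_exists[OF U der tC] .
  have iso: "nat_iso (left_mate D v (id_ftr one_cat) (id_ntr (to_one ?C)) LD \<eta>D LC \<epsilon>C)"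
    using v der LD LC unfolding homotopy_final_def by blast
  have a: "sntr ?C one_cat (to_one ?D \<bullet> v) (id_ftr one_cat \<bullet> to_one ?C) (id_ntr (to_one ?C))"
    using sntr_id[OF pd tC] t by simp
  note fD = pd_func[OF pd tD] and fC = pd_func[OF pd tC] and fv = pd_func[OF pd v']
  note Z = universal_ob[OF fD e] and eh = universal_hom[OF fD e]
  have "FA (DF D v) e \<in> hom (DO D ?C) (FO (DF D v) X) (FO (DF D (to_one ?C)) Z)"
    using func_hom[OF fv eh] pd_comp_ob[OF pd v' tD Z] t by simp
  then have "pasted D v (id_ntr (to_one ?C)) Z e = FA (DF D v) e"
    unfolding pasted_def[OF pd] using pd_id_ntr[OF pd tC Z] cat_id_left[OF func_cat(2)[OF fC]] by simp
  then show "universal (DF D (to_one ?C)) (FO (DF D v) X) Z (FA (DF D v) e)"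
    using left_mate_universal[OF pd v' tD tC one a LD LC iso e] pd_id_ob[OF pd small_one[OF U] Z] by simp
qed

text \<open>
  A left adjoint \<open>l\<close> of \<open>G\<close> makes \<open>G\<close> final, because \<open>G\<^sup>*\<close> is then left adjoint to \<open>l\<^sup>*\<close>, which
  preserves constant diagrams.  Only the composite \<open>G \<rightarrow> G l G \<rightarrow> G\<close> of unit and counit matters, and it need
  only be invertible; so the statement also covers equivalences without making them adjoint ones.
\<close>

lemma colimit_final_adjoint:
  fixes D :: "('u, 'o, 'm) prederiv"
  assumes U: "universe TYPE('u)" and pd: "prederivator D"
    and G: "sfunc K C G" and l: "sfunc C K l"
    and \<eta>: "sntr C C (id_ftr C) (G \<bullet> l) \<eta>" and \<epsilon>: "sntr K K (l \<bullet> G) (id_ftr K) \<epsilon>"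
    and iso: "\<And>X. X \<in> Ob (DO D C) \<Longrightarrow>
      Cmp (DO D K) (Cpt (DN D \<epsilon>) (FO (DF D G) X)) (FA (DF D G) (Cpt (DN D \<eta>) X))
      \<in> isos (DO D K) (FO (DF D G) X) (FO (DF D G) X)"
  shows "colimit_final D G"
proof (rule colimit_finalI[OF U pd G])
  fix X W assume X: "X \<in> Ob (DO D C)" and W: "W \<in> Ob (DO D one_cat)"
  note sK = sfunc_small(1)[OF G] and sC = sfunc_small(2)[OF G]
  note K = pd_cat[OF pd sK] and C = pd_cat[OF pd sC]
  note tC = sfunc_to_one[OF U sC] and tK = sfunc_to_one[OF U sK]
  note fG = pd_func[OF pd G] and fl = pd_func[OF pd l]
  let ?PC = "FO (DF D (to_one C)) W" and ?PK = "FO (DF D (to_one K)) W"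
  have PC: "?PC \<in> Ob (DO D C)" and PK: "?PK \<in> Ob (DO D K)"
    using func_ob[OF pd_func[OF pd tC] W] func_ob[OF pd_func[OF pd tK] W] by auto
  have GP: "FO (DF D G) ?PC = ?PK"
    using pd_comp_ob[OF pd G tC W] to_one_comp[OF sfunc_func[OF G]] by simp
  have lP: "FO (DF D l) ?PK = ?PC"
    using pd_comp_ob[OF pd l tK W] to_one_comp[OF sfunc_func[OF l]] by simp
  note GX = func_ob[OF fG X]
  have nX: "Cpt (DN D \<eta>) X \<in> hom (DO D C) X (FO (DF D l) (FO (DF D G) X))"
    using pd_cpt_hom[OF pd \<eta> X] pd_comp_ob[OF pd l G X] pd_id_ob[OF pd sC X] by simp
  have eX: "Cpt (DN D \<epsilon>) (FO (DF D G) X) \<in>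
      hom (DO D K) (FO (DF D G) (FO (DF D l) (FO (DF D G) X))) (FO (DF D G) X)"
    using pd_cpt_hom[OF pd \<epsilon> GX] pd_comp_ob[OF pd G l GX] pd_id_ob[OF pd sK GX] by simp
  have recover: "f = Cmp (DO D C) (FA (DF D l) (FA (DF D G) f)) (Cpt (DN D \<eta>) X)"
    if f: "f \<in> hom (DO D C) X ?PC" for f
    using pd_nat[OF pd \<eta> f] pd_const[OF pd U \<eta> W] pd_comp_hom[OF pd l G f] pd_id_hom[OF pd sC f]
      cat_id_left[OF C f] by simp
  show "bij_betw (FA (DF D G)) (hom (DO D C) X ?PC) (hom (DO D K) (FO (DF D G) X) ?PK)"
    unfolding bij_betw_def
  proof
    show "inj_on (FA (DF D G)) (hom (DO D C) X ?PC)"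
      by (rule inj_on_inverseI[where g = "\<lambda>h. Cmp (DO D C) (FA (DF D l) h) (Cpt (DN D \<eta>) X)"])
        (rule recover[symmetric])
    have "f \<in> FA (DF D G) ` hom (DO D C) X ?PC" if f: "f \<in> hom (DO D K) (FO (DF D G) X) ?PK" for f
    proof -
      let ?t = "Cmp (DO D K) (Cpt (DN D \<epsilon>) (FO (DF D G) X)) (FA (DF D G) (Cpt (DN D \<eta>) X))"
      obtain j where t: "?t \<in> hom (DO D K) (FO (DF D G) X) (FO (DF D G) X)"
        "j \<in> hom (DO D K) (FO (DF D G) X) (FO (DF D G) X)"
        "Cmp (DO D K) j ?t = Idn (DO D K) (FO (DF D G) X)"
        using iso[OF X] by (rule isosE)
      \<comment> \<open>Restricting the transpose of an arrow composes that arrow with \<open>?t\<close>, so the preimage of \<open>f\<close> is the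
        transpose of \<open>f\<close> composed with the inverse \<open>j\<close> of \<open>?t\<close>.\<close>
      let ?f = "Cmp (DO D K) f j"
      have f': "?f \<in> hom (DO D K) (FO (DF D G) X) ?PK" using cat_comp[OF K f t(2)] .
      let ?g = "Cmp (DO D C) (FA (DF D l) ?f) (Cpt (DN D \<eta>) X)"
      have g: "?g \<in> hom (DO D C) X ?PC" using cat_comp[OF C func_hom[OF fl f'] nX] lP by simp
      have eq: "FA (DF D G) (FA (DF D l) ?f) = Cmp (DO D K) ?f (Cpt (DN D \<epsilon>) (FO (DF D G) X))"
      proof -
        have "FA (DF D G) (FA (DF D l) ?f) \<in> hom (DO D K) (FO (DF D G) (FO (DF D l) (FO (DF D G) X))) ?PK"
          using func_hom[OF fG func_hom[OF fl f']] lP GP by simp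
        then show ?thesis
          using pd_nat[OF pd \<epsilon> f'] pd_const[OF pd U \<epsilon> W] pd_comp_hom[OF pd G l f'] pd_id_hom[OF pd sK f']
            cat_id_left[OF K] by simp
      qed
      have "FA (DF D G) ?g = Cmp (DO D K) (FA (DF D G) (FA (DF D l) ?f)) (FA (DF D G) (Cpt (DN D \<eta>) X))"
        using func_comp[OF fG func_hom[OF fl f'] nX] .
      also have "\<dots> = Cmp (DO D K) ?f ?t"
        unfolding eq using cat_assoc[OF K func_hom[OF fG nX] eX f'] by simp
      also have "\<dots> = f" using cat_assoc[OF K t(1,2) f] t(3) cat_id_right[OF K f] by simp
      finally show ?thesis using g by (metis imageI)
    qed
    then show "FA (DF D G) ` hom (DO D C) X ?PC = hom (DO D K) (FO (DF D G) X) ?PK"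
      using func_hom[OF fG, of _ X ?PC] GP by auto
  qed
qed

text \<open>
  If the identity of \<open>J\<close> is connected to a constant functor by 2-cells, then arrows between constant
  diagrams on \<open>J\<close> are constant: 2-cells act trivially on constant diagrams, so by naturality an arrow
  equals its restriction along \<open>T\<close> and also along the constant functor.
\<close>

lemma contraction_fully_faithful:
  fixes D :: "('u, 'o, 'm) prederiv"
  assumes U: "universe TYPE('u)" and pd: "prederivator D" and j: "j \<in> Ob J"
    and a: "sntr J J T (id_ftr J) \<alpha>" and b: "sntr J J T (point J j \<bullet> to_one J) \<beta>"
  shows "fully_faithful (DF D (to_one J))"
proof -
  have sJ: "small_cat J" using sfunc_small(1)[OF sntr_func(1)[OF a]] .
  note t = sfunc_to_one[OF U sJ] and p = sfunc_point[OF U sJ j]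
  note J = pd_cat[OF pd sJ] and T = sntr_func(1)[OF a]
  note ft = pd_func[OF pd t] and fp = pd_func[OF pd p]
  have pt: "to_one J \<bullet> point J j = id_ftr one_cat"
    using to_one_comp[OF sfunc_func[OF p]] to_one_one by simp
  have tT: "to_one J \<bullet> T = to_one J" using to_one_comp[OF sfunc_func[OF T]] .
  have bij: "bij_betw (FA (DF D (to_one J))) (hom (DO D one_cat) Y Z)
     (hom (DO D J) (FO (DF D (to_one J)) Y) (FO (DF D (to_one J)) Z))"
    if Y: "Y \<in> Ob (DO D one_cat)" and Z: "Z \<in> Ob (DO D one_cat)" for Y Z
    unfolding bij_betw_def
  proof
    have "FA (DF D (point J j)) (FA (DF D (to_one J)) f) = f" if "f \<in> hom (DO D one_cat) Y Z" for f
      using pd_comp_hom[OF pd p t that] pt pd_id_hom[OF pd small_one[OF U] that] by simp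
    then show "inj_on (FA (DF D (to_one J))) (hom (DO D one_cat) Y Z)" by (rule inj_on_inverseI)
    have "f \<in> FA (DF D (to_one J)) ` hom (DO D one_cat) Y Z"
      if f: "f \<in> hom (DO D J) (FO (DF D (to_one J)) Y) (FO (DF D (to_one J)) Z)" for f
    proof -
      have Tf: "FA (DF D T) f \<in> hom (DO D J) (FO (DF D (to_one J)) Y) (FO (DF D (to_one J)) Z)"
        using func_hom[OF pd_func[OF pd T] f] pd_comp_ob[OF pd T t Y] pd_comp_ob[OF pd T t Z] tT by simp
      let ?g = "FA (DF D (point J j)) f"
      have g: "?g \<in> hom (DO D one_cat) Y Z"
        using func_hom[OF fp f] pd_comp_ob[OF pd p t Y] pd_comp_ob[OF pd p t Z] pt
          pd_id_ob[OF pd small_one[OF U]] Y Z by simp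
      have "FA (DF D T) f = f"
        using pd_nat[OF pd a f] pd_const[OF pd U a] Y Z pd_id_hom[OF pd sJ f]
          cat_id_left[OF J Tf] cat_id_right[OF J f] by simp
      moreover have "FA (DF D T) f = FA (DF D (to_one J)) ?g"
        using pd_nat[OF pd b f] pd_const[OF pd U b] Y Z pd_comp_hom[OF pd t p f]
          cat_id_left[OF J Tf] cat_id_right[OF J func_hom[OF ft g]] by simp
      ultimately show ?thesis using g by (metis imageI)
    qed
    then show "FA (DF D (to_one J)) ` hom (DO D one_cat) Y Z =
        hom (DO D J) (FO (DF D (to_one J)) Y) (FO (DF D (to_one J)) Z)"
      using func_hom[OF ft] by blast
  qed
  then show ?thesis unfolding fully_faithful_def using ft by (simp add: func_def)
qed

text \<open>
  By adjunction, \<open>q\<close> is final if the unit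
  \<open>P \<rightarrow> q\<^sub>* q\<^sup>* P\<close> is invertible for constant \<open>P\<close>.  At a point \<open>c\<close>, the limit formula for \<open>q\<^sub>*\<close>
  identifies that unit with the one for the projection of \<open>c/q\<close> to a point.
\<close>

lemma colimit_final_under:
  fixes D :: "('u, 'o, 'm) prederiv"
  assumes U: "universe TYPE('u)" and der: "derivator D" and q: "sfunc K C q"
    and s: "\<And>c. c \<in> Ob C \<Longrightarrow> small_cat (under q c)"
    and ff: "\<And>c. c \<in> Ob C \<Longrightarrow> fully_faithful (DF D (to_one (under q c)))"
  shows "colimit_final D q"
proof -
  note pd = derivator_prederivator[OF der]
  note tC = sfunc_to_one[OF U sfunc_small(2)[OF q]] and tK = sfunc_to_one[OF U sfunc_small(1)[OF q]]
  note fC = pd_func[OF pd tC] and fq = pd_func[OF pd q]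
  have t: "to_one C \<bullet> q = to_one K" using to_one_comp sfunc_func[OF q] by blast
  obtain R \<eta> \<epsilon> where R: "right_kan D q R \<eta> \<epsilon>"
    using der sfunc_ends[OF q] unfolding derivator_def Der3_def by blast
  note adj = R[unfolded right_kan_def]
  have fR: "func (DO D K) (DO D C) R"
    using adj fq unfolding adjunction_def func_def by auto
  note ads = adjunction_data[OF adj fR]
  have unit_iso: "Cpt \<eta> P \<in> isos (DO D C) P (FO R (FO (DF D q) P))"
    if W: "W \<in> Ob (DO D one_cat)" and P_def: "P = FO (DF D (to_one C)) W" for P W
  proof -
    have P: "P \<in> Ob (DO D C)" using func_ob[OF fC W] P_def by simp
    note nP = adjunction_unit[OF adj fR P]
    let ?QP = "FO (DF D q) P"
    have QP: "?QP \<in> Ob (DO D K)" using func_ob[OF fq P] .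
    have RQP: "FO R ?QP \<in> Ob (DO D C)" using func_ob[OF fR QP] .
    show ?thesis
    proof (rule pointwise_iso[OF U der sfunc_small(2)[OF q] nP(1)])
      fix c assume c: "c \<in> Ob C"
      let ?J = "under q c" and ?p = "under_proj q c" and ?c = "point C c" and ?\<alpha> = "under_cell q c"
      note tJ = sfunc_to_one[OF U s[OF c]] and pc = sfunc_point[OF U sfunc_small(2)[OF q] c]
      note p = sfunc_under_proj[OF U der q c s[OF c]] and a = sntr_under_cell[OF U der q c s[OF c]]
      note fJ = pd_func[OF pd tJ] and fc = pd_func[OF pd pc] and fp = pd_func[OF pd p]
      note J = func_cat(2)[OF fJ] and one = func_cat(1)[OF fJ]
      obtain Rq \<eta>q \<epsilon>q where Rq: "right_kan D (to_one ?J) Rq \<eta>q \<epsilon>q"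
        using der sfunc_ends[OF tJ] unfolding derivator_def Der3_def by blast
      note adq = Rq[unfolded right_kan_def]
      have fRq: "func (DO D ?J) (DO D one_cat) Rq"
        using adq fJ unfolding adjunction_def func_def by auto
      have iso: "nat_iso (right_mate D ?p ?c ?\<alpha> R \<epsilon> Rq \<eta>q)"
        using der sfunc_ends[OF q] c R Rq unfolding derivator_def Der4_def by blast
      have ends: "NDom \<eta>q = id_ftr (DO D one_cat)" "Src R = DO D K" "Src (DF D ?c) = DO D C"
        "NDom (DN D ?\<alpha>) = DF D (?c \<bullet> to_one ?J)" "Src (DF D (?c \<bullet> to_one ?J)) = DO D C"
        "NDom \<epsilon> = DF D q \<bullet> R"
        using adjunction_data[OF adq fRq] fR fc pd_ntr[OF pd a] ads
          pd_func[OF pd sfunc_comp[OF tJ pc]] by (auto simp: ntr_def func_def)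
      let ?cRQP = "FO (DF D ?c) (FO R ?QP)" and ?cP = "FO (DF D ?c) P" and ?n = "FA (DF D ?c) (Cpt \<eta> P)"
      have cRQP: "?cRQP \<in> Ob (DO D one_cat)" and cP: "?cP \<in> Ob (DO D one_cat)"
        using func_ob[OF fc RQP] func_ob[OF fc P] by auto
      let ?A = "Cpt (DN D ?\<alpha>) (FO R ?QP)" and ?E = "FA (DF D ?p) (Cpt \<epsilon> ?QP)"
      have n: "?n \<in> hom (DO D one_cat) ?cP ?cRQP" using func_hom[OF fc nP(1)] .
      note eQ = adjunction_counit(1)[OF adj fR QP]
      have A: "?A \<in> hom (DO D ?J) (FO (DF D (to_one ?J)) ?cRQP) (FO (DF D ?p) (FO (DF D q) (FO R ?QP)))"
        using pd_cpt_hom[OF pd a RQP] pd_comp_ob[OF pd tJ pc RQP] pd_comp_ob[OF pd p q RQP] by simp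
      have Eh: "?E \<in> hom (DO D ?J) (FO (DF D ?p) (FO (DF D q) (FO R ?QP))) (FO (DF D ?p) ?QP)"
        using func_hom[OF fp eQ] .
      let ?h = "Cpt \<eta>q ?cRQP"
      have h: "?h \<in> hom (DO D one_cat) ?cRQP (FO Rq (FO (DF D (to_one ?J)) ?cRQP))"
        using adjunction_unit(1)[OF adq fRq cRQP] .
      \<comment> \<open>The component of the mate at \<open>q\<^sup>* P\<close>.  Composed with the unit of \<open>q\<^sup>* \<stileturn> q\<^sub>*\<close> at \<open>c\<close>, it becomes the unit
        of the adjunction for the slice \<open>c/q\<close>.\<close>
      let ?M = "Cmp (DO D one_cat) (FA Rq ?E) (Cmp (DO D one_cat) (FA Rq ?A) ?h)"
      have Mh: "?M \<in> hom (DO D one_cat) ?cRQP (FO Rq (FO (DF D ?p) ?QP))"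
        using cat_comp[OF one func_hom[OF fRq Eh] cat_comp[OF one func_hom[OF fRq A] h]] .
      have "iso_arrow (DO D one_cat) (Cpt (right_mate D ?p ?c ?\<alpha> R \<epsilon> Rq \<eta>q) ?QP)"
        using iso QP unfolding nat_iso_def right_mate_def by (simp add: ends)
      moreover have "Cpt (right_mate D ?p ?c ?\<alpha> R \<epsilon> Rq \<eta>q) ?QP = ?M"
        using QP unfolding right_mate_def by (simp add: ends)
      ultimately have Mi: "?M \<in> isos (DO D one_cat) ?cRQP (FO Rq (FO (DF D ?p) ?QP))"
        using Mh by (simp add: isos_def)
      have pi: "FO (DF D ?p) ?QP = FO (DF D (to_one ?J)) W" "?cP = W"
      proof -
        show "FO (DF D ?p) ?QP = FO (DF D (to_one ?J)) W"
          using pd_comp_ob[OF pd q tC W] t pd_comp_ob[OF pd p tK W] to_one_comp[OF sfunc_func[OF p]]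
            P_def by simp
        show "?cP = W"
          using pd_comp_ob[OF pd pc tC W] pd_id_ob[OF pd small_one[OF U] W] P_def
          by (simp add: to_one_comp[OF sfunc_func[OF pc], unfolded to_one_one])
      qed
      let ?t = "FA (DF D (to_one ?J)) ?n"
      have th: "?t \<in> hom (DO D ?J) (FO (DF D (to_one ?J)) ?cP) (FO (DF D (to_one ?J)) ?cRQP)"
        using func_hom[OF fJ n] .
      have EAt: "Cmp (DO D ?J) ?E (Cmp (DO D ?J) ?A ?t) = Idn (DO D ?J) (FO (DF D (to_one ?J)) W)"
      proof -
        have qn: "FA (DF D q) (Cpt \<eta> P) \<in> hom (DO D K) ?QP (FO (DF D q) (FO R ?QP))"
          using func_hom[OF fq nP(1)] .
        have "Cmp (DO D ?J) ?A ?t = Cmp (DO D ?J) (FA (DF D ?p) (FA (DF D q) (Cpt \<eta> P))) (Cpt (DN D ?\<alpha>) P)"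
          using pd_nat[OF pd a nP(1)] pd_comp_hom[OF pd tJ pc nP(1)] pd_comp_hom[OF pd p q nP(1)] by simp
        also have "Cpt (DN D ?\<alpha>) P = Idn (DO D ?J) (FO (DF D ?p) ?QP)"
          using pd_const[OF pd U a W] P_def pi(1) by simp
        also have "Cmp (DO D ?J) (FA (DF D ?p) (FA (DF D q) (Cpt \<eta> P))) \<dots> =
            FA (DF D ?p) (FA (DF D q) (Cpt \<eta> P))"
          using cat_id_right[OF J func_hom[OF fp qn]] .
        finally have "Cmp (DO D ?J) ?E (Cmp (DO D ?J) ?A ?t) =
            FA (DF D ?p) (Cmp (DO D K) (Cpt \<epsilon> ?QP) (FA (DF D q) (Cpt \<eta> P)))"
          using func_comp[OF fp eQ qn] by simp
        then show ?thesis using nP(2) func_id[OF fp QP] pi(1) by simp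
      qed
      have nq: "Cpt \<eta>q W \<in> isos (DO D one_cat) W (FO Rq (FO (DF D (to_one ?J)) W))"
        using adjunction_unit_iso[OF adq fRq ff[OF c] W] .
      have "Cmp (DO D one_cat) ?M ?n = Cmp (DO D one_cat) (FA Rq ?E)
          (Cmp (DO D one_cat) (FA Rq ?A) (Cmp (DO D one_cat) ?h ?n))"
        using cat_assoc[OF one n h func_hom[OF fRq A]]
          cat_assoc[OF one n cat_comp[OF one func_hom[OF fRq A] h] func_hom[OF fRq Eh]] by simp
      also have "\<dots> = Cmp (DO D one_cat) (FA Rq ?E) (Cmp (DO D one_cat) (FA Rq (Cmp (DO D ?J) ?A ?t))
          (Cpt \<eta>q ?cP))"
        using adjunction_unit_natural[OF adq fRq n] func_comp[OF fRq A th]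
          cat_assoc[OF one adjunction_unit(1)[OF adq fRq cP] func_hom[OF fRq th] func_hom[OF fRq A]] by simp
      also have "\<dots> = Cmp (DO D one_cat) (FA Rq (Cmp (DO D ?J) ?E (Cmp (DO D ?J) ?A ?t))) (Cpt \<eta>q ?cP)"
        using func_comp[OF fRq Eh cat_comp[OF J A th]]
          cat_assoc[OF one adjunction_unit(1)[OF adq fRq cP] func_hom[OF fRq cat_comp[OF J A th]]
            func_hom[OF fRq Eh]] by simp
      also have "\<dots> = Cpt \<eta>q W"
        using EAt func_id[OF fRq func_ob[OF fJ W]] cat_id_left[OF one isos_hom[OF nq]] pi(2) by simp
      finally have "Cmp (DO D one_cat) ?M ?n = Cpt \<eta>q W" .
      then have "?n \<in> isos (DO D one_cat) ?cP ?cRQP"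
        using iso_left_factor[OF one Mi n] nq pi by simp
      then show "iso_arrow (DO D one_cat) ?n" by (rule isos_arrow)
    qed
  qed
  show ?thesis
  proof (rule colimit_finalI[OF U pd q])
    fix X W assume X: "X \<in> Ob (DO D C)" and W: "W \<in> Ob (DO D one_cat)"
    show "bij_betw (FA (DF D q)) (hom (DO D C) X (FO (DF D (to_one C)) W))
        (hom (DO D K) (FO (DF D q) X) (FO (DF D (to_one K)) W))"
      using adjunction_bij_if_unit_iso[OF adj fR X unit_iso[OF W refl]] pd_comp_ob[OF pd q tC W] t by simp
  qed
qed

section \<open>Morphisms of derivators\<close>

context
  fixes D E :: "('u, 'o, 'm) prederiv" and F :: "('u, 'o, 'm) dmor"
  assumes D: "prederivator D" and E: "prederivator E" and F: "derivator_morphism D E F"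
begin

lemma mor_func: "small_cat A \<Longrightarrow> func (DO D A) (DO E A) (MF F A)"
  using F unfolding derivator_morphism_def func_def by blast

lemma mor_ntr:
  assumes u: "sfunc A B u"
  shows "nat_iso (MN F u)" "ntr (DF E u \<bullet> MF F B) (MF F A \<bullet> DF D u) (MN F u)"
    "func (DO D B) (DO E A) (DF E u \<bullet> MF F B)" "func (DO D B) (DO E A) (MF F A \<bullet> DF D u)"
proof -
  have "nat_iso (MN F u) \<and> NDom (MN F u) = DF E u \<bullet> MF F B \<and> NCod (MN F u) = MF F A \<bullet> DF D u"
    using F sfunc_ends[OF u] unfolding derivator_morphism_def by blast
  then show "nat_iso (MN F u)" "ntr (DF E u \<bullet> MF F B) (MF F A \<bullet> DF D u) (MN F u)"
    by (auto simp: nat_iso_def ntr_def)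
  show "func (DO D B) (DO E A) (DF E u \<bullet> MF F B)"
    using func_comp_ftr[OF mor_func[OF sfunc_small(2)[OF u]] pd_func[OF E u]] .
  show "func (DO D B) (DO E A) (MF F A \<bullet> DF D u)"
    using func_comp_ftr[OF pd_func[OF D u] mor_func[OF sfunc_small(1)[OF u]]] .
qed

text \<open>The inverse of the structure isomorphism of \<open>F\<close>, in the direction in which mates use it.\<close>

definition exch :: "'u sftr \<Rightarrow> 'o \<Rightarrow> 'm" where
  "exch u Z = Cpt (nat_inv (MN F u)) Z"

lemma exch:
  assumes u: "sfunc A B u" and Z: "Z \<in> Ob (DO D B)"
  shows "Cpt (MN F u) Z \<in> isos (DO E A) (FO (DF E u) (FO (MF F B) Z)) (FO (MF F A) (FO (DF D u) Z))"
    "exch u Z \<in> isos (DO E A) (FO (MF F A) (FO (DF D u) Z)) (FO (DF E u) (FO (MF F B) Z))"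
    "Cmp (DO E A) (exch u Z) (Cpt (MN F u) Z) = Idn (DO E A) (FO (DF E u) (FO (MF F B) Z))"
    "Cmp (DO E A) (Cpt (MN F u) Z) (exch u Z) = Idn (DO E A) (FO (MF F A) (FO (DF D u) Z))"
proof -
  note m = mor_ntr[OF u]
  have ob: "FO (DF E u \<bullet> MF F B) Z = FO (DF E u) (FO (MF F B) Z)"
    "FO (MF F A \<bullet> DF D u) Z = FO (MF F A) (FO (DF D u) Z)"
    using comp_ob[OF mor_func[OF sfunc_small(2)[OF u]] Z] comp_ob[OF pd_func[OF D u] Z] by auto
  note i = nat_inv_inverse[OF m(1,2,3) Z, folded exch_def, unfolded ob]
  note h = ntr_hom[OF m(2,3) Z, unfolded ob]
  show "Cmp (DO E A) (exch u Z) (Cpt (MN F u) Z) = Idn (DO E A) (FO (DF E u) (FO (MF F B) Z))"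
    "Cmp (DO E A) (Cpt (MN F u) Z) (exch u Z) = Idn (DO E A) (FO (MF F A) (FO (DF D u) Z))"
    by (rule i)+
  show "Cpt (MN F u) Z \<in> isos (DO E A) (FO (DF E u) (FO (MF F B) Z)) (FO (MF F A) (FO (DF D u) Z))"
    using isosI[OF h i(1) i(2,3)] .
  show "exch u Z \<in> isos (DO E A) (FO (MF F A) (FO (DF D u) Z)) (FO (DF E u) (FO (MF F B) Z))"
    using isosI[OF i(1) h i(3,2)] .
qed

lemma exch_natural:
  assumes u: "sfunc A B u" and g: "g \<in> hom (DO D B) Z W"
  shows "Cmp (DO E A) (exch u W) (FA (MF F A) (FA (DF D u) g)) =
    Cmp (DO E A) (FA (DF E u) (FA (MF F B) g)) (exch u Z)"
  using ntr_nat[OF ntr_nat_inv[OF mor_ntr(1,2,3)[OF u]] mor_ntr(4)[OF u] g]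
  by (simp add: exch_def comp_hom[OF mor_func[OF sfunc_small(2)[OF u]] g] comp_hom[OF pd_func[OF D u] g])

lemma exch_comp:
  assumes v: "sfunc A B v" and w: "sfunc B C w" and Z: "Z \<in> Ob (DO D C)"
  shows "exch (w \<bullet> v) Z = Cmp (DO E A) (FA (DF E v) (exch w Z)) (exch v (FO (DF D w) Z))"
proof -
  note wv = sfunc_comp[OF v w]
  note A = pd_cat[OF E sfunc_small(1)[OF v]]
  note fv = pd_func[OF E v]
  have wZ: "FO (DF D w) Z \<in> Ob (DO D B)" using func_ob[OF pd_func[OF D w] Z] .
  have FZ: "FO (MF F C) Z \<in> Ob (DO E C)" using func_ob[OF mor_func[OF sfunc_small(2)[OF w]] Z] .
  note ev = exch[OF v wZ] and ew = exch[OF w Z]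
  note ewv = exch[OF wv Z, unfolded pd_comp_ob[OF D v w Z] pd_comp_ob[OF E v w FZ]]
  let ?a = "Cpt (MN F v) (FO (DF D w) Z)" and ?b = "FA (DF E v) (Cpt (MN F w) Z)"
    and ?a' = "exch v (FO (DF D w) Z)" and ?b' = "FA (DF E v) (exch w Z)"
  have h: "?a \<in> hom (DO E A) (FO (DF E v) (FO (MF F B) (FO (DF D w) Z)))
      (FO (MF F A) (FO (DF D v) (FO (DF D w) Z)))"
    "?b \<in> hom (DO E A) (FO (DF E v) (FO (DF E w) (FO (MF F C) Z))) (FO (DF E v) (FO (MF F B) (FO (DF D w) Z)))"
    "?a' \<in> hom (DO E A) (FO (MF F A) (FO (DF D v) (FO (DF D w) Z))) (FO (DF E v) (FO (MF F B) (FO (DF D w) Z)))"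
    "?b' \<in> hom (DO E A) (FO (DF E v) (FO (MF F B) (FO (DF D w) Z))) (FO (DF E v) (FO (DF E w) (FO (MF F C) Z)))"
    using isos_hom[OF ev(1)] isos_hom[OF ev(2)] func_hom[OF fv isos_hom[OF ew(1)]]
      func_hom[OF fv isos_hom[OF ew(2)]] by auto
  have "MN F (w \<bullet> v) = (MN F v \<rhd> DF D w) \<odot> (DF E v \<lhd> MN F w)"
    using F sfunc_ends[OF v] sfunc_ends[OF w] unfolding derivator_morphism_def by auto
  moreover have "NDom (MN F w) = DF E w \<bullet> MF F C" "Src (MF F C) = DO D C" "Trg (DF E v) = DO E A"
    "Src (DF D w) = DO D C"
    using mor_ntr(2)[OF w] mor_func[OF sfunc_small(2)[OF w]] fv pd_func[OF D w]
    by (auto simp: ntr_def func_def)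
  ultimately have wv_eq: "Cpt (MN F (w \<bullet> v)) Z = Cmp (DO E A) ?a ?b" using Z by simp
  have bb: "Cmp (DO E A) ?b' ?b = Idn (DO E A) (FO (DF E v) (FO (DF E w) (FO (MF F C) Z)))"
    using func_comp[OF fv isos_hom[OF ew(2)] isos_hom[OF ew(1)]] ew(3)
      func_id[OF fv func_ob[OF pd_func[OF E w] FZ]] by simp
  have "Cmp (DO E A) (Cmp (DO E A) ?b' ?a') (Cmp (DO E A) ?a ?b) =
      Cmp (DO E A) ?b' (Cmp (DO E A) (Cmp (DO E A) ?a' ?a) ?b)"
    using cat_assoc[OF A cat_comp[OF A h(1,2)] h(3,4)] cat_assoc[OF A h(2,1,3)] by simp
  also have "\<dots> = Idn (DO E A) (FO (DF E v) (FO (DF E w) (FO (MF F C) Z)))"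
    using ev(3) cat_id_left[OF A h(2)] bb by simp
  finally have "Cmp (DO E A) (Cmp (DO E A) ?b' ?a') (Cpt (MN F (w \<bullet> v)) Z) =
      Cmp (DO E A) (exch (w \<bullet> v) Z) (Cpt (MN F (w \<bullet> v)) Z)"
    using ewv(3) wv_eq by simp
  then show ?thesis
    using iso_right_cancel[OF A ewv(1) cat_comp[OF A h(4,3)] isos_hom[OF ewv(2)]] by simp
qed

lemma exch_cell:
  assumes a: "sntr A B u v \<alpha>" and Z: "Z \<in> Ob (DO D B)"
  shows "Cmp (DO E A) (exch v Z) (FA (MF F A) (Cpt (DN D \<alpha>) Z)) =
    Cmp (DO E A) (Cpt (DN E \<alpha>) (FO (MF F B) Z)) (exch u Z)"
proof -
  note u = sntr_func(1)[OF a] and v = sntr_func(2)[OF a]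
  note A = pd_cat[OF E sfunc_small(1)[OF u]]
  note fA = mor_func[OF sfunc_small(1)[OF u]] and fB = mor_func[OF sfunc_small(2)[OF u]]
  note eu = exch[OF u Z] and ev = exch[OF v Z]
  have Eh: "Cpt (DN E \<alpha>) (FO (MF F B) Z) \<in> hom (DO E A) (FO (DF E u) (FO (MF F B) Z)) (FO (DF E v) (FO (MF F B) Z))"
    using pd_cpt_hom[OF E a func_ob[OF fB Z]] .
  have Dh: "FA (MF F A) (Cpt (DN D \<alpha>) Z) \<in> hom (DO E A) (FO (MF F A) (FO (DF D u) Z)) (FO (MF F A) (FO (DF D v) Z))"
    using func_hom[OF fA pd_cpt_hom[OF D a Z]] .
  have ends: "NDom \<alpha> = u" "NCod \<alpha> = v" "Src u = A" "Trg u = B" "Src (MF F B) = DO D B"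
    "NDom (MN F u) = DF E u \<bullet> MF F B" "NDom (DN E \<alpha>) = DF E u" "Trg (DF E u) = DO E A"
    "NDom (DN D \<alpha>) = DF D u" "Src (DF D u) = DO D B"
    using sntr_small[OF a] sfunc_ends[OF u] fB mor_ntr(2)[OF u] pd_ntr[OF E a] pd_ntr[OF D a]
      pd_func[OF E u] pd_func[OF D u]
    by (auto simp: func_def ntr_def)
  have "(MF F A \<lhd> DN D \<alpha>) \<odot> MN F u = MN F v \<odot> (DN E \<alpha> \<rhd> MF F B)"
    using F sntr_small[OF a] ends unfolding derivator_morphism_def by metis
  from arg_cong[OF this, of "\<lambda>t. Cpt t Z"]
  have sq: "Cmp (DO E A) (FA (MF F A) (Cpt (DN D \<alpha>) Z)) (Cpt (MN F u) Z) =
      Cmp (DO E A) (Cpt (MN F v) Z) (Cpt (DN E \<alpha>) (FO (MF F B) Z))"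
    using Z by (simp add: ends)
  let ?l = "Cmp (DO E A) (exch v Z) (FA (MF F A) (Cpt (DN D \<alpha>) Z))"
    and ?r = "Cmp (DO E A) (Cpt (DN E \<alpha>) (FO (MF F B) Z)) (exch u Z)"
  have "Cmp (DO E A) ?l (Cpt (MN F u) Z) = Cpt (DN E \<alpha>) (FO (MF F B) Z)"
    using cat_assoc[OF A isos_hom[OF eu(1)] Dh isos_hom[OF ev(2)]] sq
      cat_assoc[OF A Eh isos_hom[OF ev(1)] isos_hom[OF ev(2)]] ev(3) cat_id_left[OF A Eh] by simp
  moreover have "Cmp (DO E A) ?r (Cpt (MN F u) Z) = Cpt (DN E \<alpha>) (FO (MF F B) Z)"
    using cat_assoc[OF A isos_hom[OF eu(1)] isos_hom[OF eu(2)] Eh] eu(3) cat_id_right[OF A Eh] by simp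
  ultimately show ?thesis
    using iso_right_cancel[OF A eu(1) cat_comp[OF A isos_hom[OF ev(2)] Dh]
        cat_comp[OF A Eh isos_hom[OF eu(2)]]] by simp
qed

subsection \<open>The action on arrows over a functor\<close>

text \<open>
  \<open>F\<close> sends an arrow \<open>e : X \<rightarrow> u\<^sup>* Z\<close> to an arrow \<open>F X \<rightarrow> u\<^sup>* F Z\<close>.  Applied to the unit of \<open>u\<^sub>! \<stileturn> u\<^sup>*\<close>, this
  is the transpose of the mate that expresses preservation of left Kan extensions.
\<close>

definition lift :: "'u sftr \<Rightarrow> 'o \<Rightarrow> 'm \<Rightarrow> 'm" where
  "lift u Z e = Cmp (DO E (Src u)) (exch u Z) (FA (MF F (Src u)) e)"

lemma lift_eq: "sfunc A B u \<Longrightarrow> lift u Z e = Cmp (DO E A) (exch u Z) (FA (MF F A) e)"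
  using sfunc_ends[of A B u] by (simp add: lift_def)

lemma lift_hom:
  assumes u: "sfunc A B u" and Z: "Z \<in> Ob (DO D B)" and e: "e \<in> hom (DO D A) X (FO (DF D u) Z)"
  shows "lift u Z e \<in> hom (DO E A) (FO (MF F A) X) (FO (DF E u) (FO (MF F B) Z))"
  unfolding lift_eq[OF u]
  using cat_comp[OF pd_cat[OF E sfunc_small(1)[OF u]] isos_hom[OF exch(2)[OF u Z]]
      func_hom[OF mor_func[OF sfunc_small(1)[OF u]] e]] .

lemma lift_natural:
  assumes u: "sfunc A B u" and g: "g \<in> hom (DO D B) Z W" and e: "e \<in> hom (DO D A) X (FO (DF D u) Z)"
  shows "lift u W (Cmp (DO D A) (FA (DF D u) g) e) =
    Cmp (DO E A) (FA (DF E u) (FA (MF F B) g)) (lift u Z e)"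
proof -
  note A = pd_cat[OF E sfunc_small(1)[OF u]]
  note fA = mor_func[OF sfunc_small(1)[OF u]] and fB = mor_func[OF sfunc_small(2)[OF u]]
  have Z: "Z \<in> Ob (DO D B)" and W: "W \<in> Ob (DO D B)"
    using hom_ob[OF pd_cat[OF D sfunc_small(2)[OF u]] g] by auto
  note ug = func_hom[OF pd_func[OF D u] g]
  show ?thesis unfolding lift_eq[OF u]
    using func_comp[OF fA ug e]
      cat_assoc[OF A func_hom[OF fA e] func_hom[OF fA ug] isos_hom[OF exch(2)[OF u W]]]
      exch_natural[OF u g]
      cat_assoc[OF A func_hom[OF fA e] isos_hom[OF exch(2)[OF u Z]]
        func_hom[OF pd_func[OF E u] func_hom[OF fB g]]] by simp
qed

text \<open>
  An arrow \<open>X \<rightarrow> v\<^sup>* w\<^sup>* Z\<close> lies over \<open>v\<close> with target \<open>w\<^sup>* Z\<close>, and also over \<open>w v\<close> with target \<open>Z\<close>; the two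
  lifts differ by the isomorphism \<open>F w\<^sup>* Z \<cong> w\<^sup>* F Z\<close>.
\<close>

lemma lift_via:
  assumes v: "sfunc A B v" and w: "sfunc B C w" and Z: "Z \<in> Ob (DO D C)"
    and e: "e \<in> hom (DO D A) X (FO (DF D v) (FO (DF D w) Z))"
  shows "lift (w \<bullet> v) Z e = Cmp (DO E A) (FA (DF E v) (exch w Z)) (lift v (FO (DF D w) Z) e)"
proof -
  note A = pd_cat[OF E sfunc_small(1)[OF v]]
  have wZ: "FO (DF D w) Z \<in> Ob (DO D B)" using func_ob[OF pd_func[OF D w] Z] .
  show ?thesis unfolding lift_eq[OF v] lift_eq[OF sfunc_comp[OF v w]] exch_comp[OF v w Z]
    using cat_assoc[OF A func_hom[OF mor_func[OF sfunc_small(1)[OF v]] e] isos_hom[OF exch(2)[OF v wZ]]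
        func_hom[OF pd_func[OF E v] isos_hom[OF exch(2)[OF w Z]]]] by simp
qed

lemma lift_comp:
  assumes v: "sfunc A B v" and w: "sfunc B C w" and W: "W \<in> Ob (DO D C)"
    and e: "e \<in> hom (DO D A) X (FO (DF D v) Z)" and e': "e' \<in> hom (DO D B) Z (FO (DF D w) W)"
  shows "lift (w \<bullet> v) W (Cmp (DO D A) (FA (DF D v) e') e) =
    Cmp (DO E A) (FA (DF E v) (lift w W e')) (lift v Z e)"
proof -
  note A = pd_cat[OF E sfunc_small(1)[OF v]] and fv = pd_func[OF E v]
  have Z: "Z \<in> Ob (DO D B)" using hom_ob[OF pd_cat[OF D sfunc_small(1)[OF w]] e'] by simp
  note fe' = func_hom[OF mor_func[OF sfunc_small(1)[OF w]] e']
  note x = isos_hom[OF exch(2)[OF w W]]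
  have "Cmp (DO D A) (FA (DF D v) e') e \<in> hom (DO D A) X (FO (DF D v) (FO (DF D w) W))"
    using cat_comp[OF pd_cat[OF D sfunc_small(1)[OF v]] func_hom[OF pd_func[OF D v] e'] e] .
  from lift_via[OF v w W this] show ?thesis
    unfolding lift_natural[OF v e' e] lift_eq[OF w, of W e'] func_comp[OF fv x fe']
    using cat_assoc[OF A lift_hom[OF v Z e] func_hom[OF fv fe'] func_hom[OF fv x]] by simp
qed

text \<open>Restriction along \<open>q\<close> is composition with the identity of \<open>q\<^sup>* X\<close>, viewed as an arrow over \<open>q\<close>.\<close>

lemma lift_restrict:
  assumes q: "sfunc K C q" and u: "sfunc C B u" and Z: "Z \<in> Ob (DO D B)"
    and e: "e \<in> hom (DO D C) X (FO (DF D u) Z)"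
  shows "lift (u \<bullet> q) Z (FA (DF D q) e) = Cmp (DO E K) (FA (DF E q) (lift u Z e)) (exch q X)"
proof -
  note sK = sfunc_small(1)[OF q] and sC = sfunc_small(2)[OF q]
  have X: "X \<in> Ob (DO D C)" using hom_ob[OF pd_cat[OF D sC] e] by simp
  note qX = func_ob[OF pd_func[OF D q] X] and K = pd_cat[OF D sK] and EK = pd_cat[OF E sK]
  have i: "Idn (DO D K) (FO (DF D q) X) \<in> hom (DO D K) (FO (DF D q) X) (FO (DF D q) X)"
    using cat_id[OF K qX] .
  have "lift q X (Idn (DO D K) (FO (DF D q) X)) = exch q X"
    unfolding lift_eq[OF q] func_id[OF mor_func[OF sK] qX]
    using cat_id_right[OF EK isos_hom[OF exch(2)[OF q X]]] .
  then show ?thesis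
    using lift_comp[OF q u Z i e] cat_id_right[OF K func_hom[OF pd_func[OF D q] e]] by simp
qed

text \<open>
  Pasting is restriction followed by a 2-cell, and lifts respect both; the equation holds up to the
  isomorphisms \<open>F p\<^sup>* \<cong> p\<^sup>* F\<close> and \<open>F w\<^sup>* \<cong> w\<^sup>* F\<close>, which do not affect universality.
\<close>

lemma lift_pasted:
  assumes p: "sfunc P A p" and u: "sfunc A B u" and q: "sfunc P Q q" and w: "sfunc Q B w"
    and a: "sntr P B (u \<bullet> p) (w \<bullet> q) \<alpha>"
    and Z: "Z \<in> Ob (DO D B)" and e: "e \<in> hom (DO D A) X (FO (DF D u) Z)"
  shows "Cmp (DO E P) (FA (DF E q) (exch w Z)) (lift q (FO (DF D w) Z) (pasted D p \<alpha> Z e)) =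
    Cmp (DO E P) (pasted E p \<alpha> (FO (MF F B) Z) (lift u Z e)) (exch p X)"
proof -
  have s: "Src p = P" using sfunc_ends[OF p] by simp
  note sP = sfunc_small(1)[OF p]
  note P = pd_cat[OF E sP]
  have X: "X \<in> Ob (DO D A)" using hom_ob[OF pd_cat[OF D sfunc_small(1)[OF u]] e] by simp
  have FZ: "FO (MF F B) Z \<in> Ob (DO E B)" using func_ob[OF mor_func[OF sfunc_small(2)[OF u]] Z] .
  note up = sfunc_comp[OF p u] and wq = sfunc_comp[OF q w]
  note ph = pasted_hom[OF D p u q w a Z e]
  have pe: "FA (DF D p) e \<in> hom (DO D P) (FO (DF D p) X) (FO (DF D (u \<bullet> p)) Z)"
    using func_hom[OF pd_func[OF D p] e] pd_comp_ob[OF D p u Z] by simp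
  note Fpe = func_hom[OF mor_func[OF sP] pe]
  have "Cmp (DO E P) (FA (DF E q) (exch w Z)) (lift q (FO (DF D w) Z) (pasted D p \<alpha> Z e)) =
      lift (w \<bullet> q) Z (pasted D p \<alpha> Z e)"
    using lift_via[OF q w Z ph] by simp
  also have "\<dots> = Cmp (DO E P) (Cmp (DO E P) (exch (w \<bullet> q) Z) (FA (MF F P) (Cpt (DN D \<alpha>) Z)))
      (FA (MF F P) (FA (DF D p) e))"
    unfolding lift_eq[OF wq] pasted_def[OF D] s
    using func_comp[OF mor_func[OF sP] pd_cpt_hom[OF D a Z] pe]
      cat_assoc[OF P Fpe func_hom[OF mor_func[OF sP] pd_cpt_hom[OF D a Z]] isos_hom[OF exch(2)[OF wq Z]]]
    by simp
  also have "\<dots> = Cmp (DO E P) (Cpt (DN E \<alpha>) (FO (MF F B) Z)) (lift (u \<bullet> p) Z (FA (DF D p) e))"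
    unfolding exch_cell[OF a Z] lift_eq[OF up]
    using cat_assoc[OF P Fpe isos_hom[OF exch(2)[OF up Z]] pd_cpt_hom[OF E a FZ]] by simp
  also have "\<dots> = Cmp (DO E P) (pasted E p \<alpha> (FO (MF F B) Z) (lift u Z e)) (exch p X)"
  proof -
    have "FA (DF E p) (lift u Z e) \<in>
        hom (DO E P) (FO (DF E p) (FO (MF F A) X)) (FO (DF E (u \<bullet> p)) (FO (MF F B) Z))"
      using func_hom[OF pd_func[OF E p] lift_hom[OF u Z e]] pd_comp_ob[OF E p u FZ] by simp
    from cat_assoc[OF P isos_hom[OF exch(2)[OF p X]] this pd_cpt_hom[OF E a FZ]]
    show ?thesis unfolding lift_restrict[OF p u Z e] pasted_def[OF E] s .
  qed
  finally show ?thesis .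
qed

end

section \<open>Preservation of universal arrows\<close>

definition preserves_universal :: "('u, 'o, 'm) prederiv \<Rightarrow> ('u, 'o, 'm) prederiv \<Rightarrow>
    ('u, 'o, 'm) dmor \<Rightarrow> 'u sftr \<Rightarrow> bool" where
  "preserves_universal D E F u \<longleftrightarrow> (\<forall>X Z e. universal (DF D u) X Z e \<longrightarrow>
     universal (DF E u) (FO (MF F (Src u)) X) (FO (MF F (Trg u)) Z) (lift E F u Z e))"

lemma preserves_universalD:
  "preserves_universal D E F u \<Longrightarrow> sfunc A B u \<Longrightarrow> universal (DF D u) X Z e \<Longrightarrow>
     universal (DF E u) (FO (MF F A) X) (FO (MF F B) Z) (lift E F u Z e)"
  using sfunc_ends[of A B u] unfolding preserves_universal_def by blast

context
  fixes D E :: "('u, 'o, 'm) prederiv" and F :: "('u, 'o, 'm) dmor"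
  assumes U: "universe TYPE('u)" and derD: "derivator D" and derE: "derivator E"
    and F: "derivator_morphism D E F"
begin

lemmas pdD = derivator_prederivator[OF derD]
lemmas pdE = derivator_prederivator[OF derE]

lemmas mfunc = mor_func[OF pdD pdE F]
lemmas lift_in = lift_hom[OF pdD pdE F]
lemmas exch_iso = exch(2)[OF pdD pdE F]

text \<open>Universal arrows being unique, one for each object decides.\<close>

lemma preserves_universalI:
  assumes u: "sfunc A B u"
    and ex: "\<And>X. X \<in> Ob (DO D A) \<Longrightarrow> \<exists>Z e. universal (DF D u) X Z e \<and>
      universal (DF E u) (FO (MF F A) X) (FO (MF F B) Z) (lift E F u Z e)"
  shows "preserves_universal D E F u"
  unfolding preserves_universal_def
proof (intro allI impI)
  fix X Z e assume e: "universal (DF D u) X Z e"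
  note fD = pd_func[OF pdD u] and fE = pd_func[OF pdE u] and fB = mfunc[OF sfunc_small(2)[OF u]]
  note eh = universal_hom[OF fD e] and Z = universal_ob[OF fD e]
  have X: "X \<in> Ob (DO D A)" using hom_ob[OF func_cat(2)[OF fD] eh] by simp
  obtain Z0 e0 where e0: "universal (DF D u) X Z0 e0"
    "universal (DF E u) (FO (MF F A) X) (FO (MF F B) Z0) (lift E F u Z0 e0)"
    using ex[OF X] by blast
  obtain g where g: "g \<in> hom (DO D B) Z0 Z" "Cmp (DO D A) (FA (DF D u) g) e0 = e"
    using universal_factor[OF fD e0(1) Z eh] .
  have "g \<in> isos (DO D B) Z0 Z" using universal_iso[OF fD e0(1) e g] .
  from universal_comp_iso[OF fE e0(2) func_isos[OF fB this]]
  have "universal (DF E u) (FO (MF F A) X) (FO (MF F B) Z) (lift E F u Z e)"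
    using lift_natural[OF pdD pdE F u g(1) universal_hom[OF fD e0(1)]] g(2) by simp
  then show "universal (DF E u) (FO (MF F (Src u)) X) (FO (MF F (Trg u)) Z) (lift E F u Z e)"
    using sfunc_ends[OF u] by simp
qed

lemma ntr_morphism_mate:
  assumes u: "sfunc A B u" and LD: "left_kan D u LD \<eta>D \<epsilon>D" and LE: "left_kan E u LE \<eta>E \<epsilon>E"
  shows "ntr (LE \<bullet> MF F A) (MF F B \<bullet> LD) (morphism_mate F u LD \<eta>D LE \<epsilon>E)"
proof -
  note fD = pd_func[OF pdD u] and fE = pd_func[OF pdE u]
  note adD = adjunction_data[OF LD[unfolded left_kan_def] fD]
    and adE = adjunction_data[OF LE[unfolded left_kan_def] fE]
  note fA = mfunc[OF sfunc_small(1)[OF u]] and fB = mfunc[OF sfunc_small(2)[OF u]]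
  note m = mor_ntr[OF pdD pdE F u]
  note DA = func_cat(1)[OF adD(1)]
  have s: "Src u = A" "Trg u = B" using sfunc_ends[OF u] by auto
  have 1: "ntr (LE \<bullet> MF F A) (LE \<bullet> (MF F A \<bullet> (DF D u \<bullet> LD))) (LE \<lhd> (MF F A \<lhd> \<eta>D))"
  proof -
    have "ntr (MF F A \<bullet> id_ftr (DO D A)) (MF F A \<bullet> (DF D u \<bullet> LD)) (MF F A \<lhd> \<eta>D)"
      using ntr_whisker_left[OF adD(2) func_id_ftr[OF DA] fA] .
    from ntr_whisker_left[OF this func_comp_ftr[OF func_id_ftr[OF DA] fA] adE(1)]
    show ?thesis unfolding comp_id_right[OF fA] .
  qed
  have 2: "ntr (LE \<bullet> ((MF F A \<bullet> DF D u) \<bullet> LD)) (LE \<bullet> ((DF E u \<bullet> MF F B) \<bullet> LD))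
      (LE \<lhd> (nat_inv (MN F u) \<rhd> LD))"
    using ntr_whisker_left[OF ntr_whisker_right[OF ntr_nat_inv[OF m(1,2,3)] m(4) adD(1)]
        func_comp_ftr[OF adD(1) m(4)] adE(1)] .
  note BL = func_comp_ftr[OF adD(1) fB] and EL = func_comp_ftr[OF fE adE(1)]
  have 3: "ntr ((LE \<bullet> DF E u) \<bullet> (MF F B \<bullet> LD)) (MF F B \<bullet> LD) (\<epsilon>E \<rhd> (MF F B \<bullet> LD))"
    using ntr_whisker_right[OF adE(3) EL BL] comp_id_left[OF BL] by simp
  have a1: "LE \<bullet> (MF F A \<bullet> (DF D u \<bullet> LD)) = LE \<bullet> ((MF F A \<bullet> DF D u) \<bullet> LD)"
    using comp_assoc[OF adD(1) fD fA] by simp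
  have a2: "LE \<bullet> ((DF E u \<bullet> MF F B) \<bullet> LD) = (LE \<bullet> DF E u) \<bullet> (MF F B \<bullet> LD)"
    using comp_assoc[OF adD(1) fB fE] comp_assoc[OF BL fE adE(1)] by simp
  show ?thesis unfolding morphism_mate_def s
    using ntr_vcomp[OF ntr_vcomp[OF 1 2[folded a1]] 3[folded a2]] .
qed

text \<open>
  The mate at \<open>X\<close> is the transpose of the lift of the unit; so it is invertible if and only if that lift
  is universal.
\<close>

lemma preserves_left_kan_iff:
  assumes u: "sfunc A B u"
  shows "preserves_left_kan D E F u \<longleftrightarrow> preserves_universal D E F u"
proof -
  note fD = pd_func[OF pdD u] and fE = pd_func[OF pdE u]
  note fA = mfunc[OF sfunc_small(1)[OF u]] and fB = mfunc[OF sfunc_small(2)[OF u]]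
  note A = func_cat(2)[OF fE]
  have s: "Src u = A" "Trg u = B" using sfunc_ends[OF u] by auto
  have key: "nat_iso (morphism_mate F u LD \<eta>D LE \<epsilon>E) \<longleftrightarrow>
      (\<forall>X\<in>Ob (DO D A). universal (DF E u) (FO (MF F A) X) (FO (MF F B) (FO LD X))
        (lift E F u (FO LD X) (Cpt \<eta>D X)))"
    if LD: "left_kan D u LD \<eta>D \<epsilon>D" and LE: "left_kan E u LE \<eta>E \<epsilon>E" for LD \<eta>D \<epsilon>D LE \<eta>E \<epsilon>E
  proof -
    note adjD = LD[unfolded left_kan_def] and adjE = LE[unfolded left_kan_def]
    note adD = adjunction_data[OF adjD fD] and adE = adjunction_data[OF adjE fE]
    note n = ntr_morphism_mate[OF u LD LE]
    have nd: "NDom (morphism_mate F u LD \<eta>D LE \<epsilon>E) = LE \<bullet> MF F A" using n by (simp add: ntr_def)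
    have ends: "NDom \<eta>D = id_ftr (DO D A)" "Src (MF F A) = DO D A" "Trg LE = DO E B"
      "NDom (nat_inv (MN F u)) = MF F A \<bullet> DF D u" "Src LD = DO D A" "NDom \<epsilon>E = LE \<bullet> DF E u"
      using adD adE fA ntr_nat_inv[OF mor_ntr(1,2,3)[OF pdD pdE F u]] by (auto simp: ntr_def func_def)
    have "iso_arrow (DO E B) (Cpt (morphism_mate F u LD \<eta>D LE \<epsilon>E) X) \<longleftrightarrow>
        universal (DF E u) (FO (MF F A) X) (FO (MF F B) (FO LD X)) (lift E F u (FO LD X) (Cpt \<eta>D X))"
      if X: "X \<in> Ob (DO D A)" for X
    proof -
      have LX: "FO LD X \<in> Ob (DO D B)" using func_ob[OF adD(1) X] .
      have FLX: "FO (MF F B) (FO LD X) \<in> Ob (DO E B)" using func_ob[OF fB LX] .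
      note nX = adjunction_unit(1)[OF adjD fD X]
      note li = lift_in[OF u LX nX]
      have "Cpt (morphism_mate F u LD \<eta>D LE \<epsilon>E) X = Cmp (DO E B) (Cpt \<epsilon>E (FO (MF F B) (FO LD X)))
          (FA LE (lift E F u (FO LD X) (Cpt \<eta>D X)))"
        unfolding lift_eq[OF pdD pdE F u] exch_def[OF pdD pdE F]
          func_comp[OF adE(1) isos_hom[OF exch_iso[OF u LX, unfolded exch_def[OF pdD pdE F]]] func_hom[OF fA nX]]
        using X unfolding morphism_mate_def s by (simp add: ends)
      then show ?thesis
        using transpose_iso_iff_universal[OF adjE fE FLX li] adjunction_transpose(1)[OF adjE fE FLX li]
        by (simp add: isos_def)
    qed
    then show ?thesis using n unfolding nat_iso_def nd by (simp add: ends ntr_def)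
  qed
  show ?thesis
  proof
    assume p: "preserves_left_kan D E F u"
    obtain LD \<eta>D \<epsilon>D where LD: "left_kan D u LD \<eta>D \<epsilon>D" using kan_exists[OF U derD u] .
    obtain LE \<eta>E \<epsilon>E where LE: "left_kan E u LE \<eta>E \<epsilon>E" using kan_exists[OF U derE u] .
    have "nat_iso (morphism_mate F u LD \<eta>D LE \<epsilon>E)"
      using p LD LE unfolding preserves_left_kan_def by blast
    then show "preserves_universal D E F u"
      using preserves_universalI[OF u] key[OF LD LE]
        adjunction_unit_universal[OF LD[unfolded left_kan_def] fD] by blast
  next
    assume p: "preserves_universal D E F u"
    show "preserves_left_kan D E F u"
      unfolding preserves_left_kan_def
      using key adjunction_unit_universal[OF _ fD] preserves_universalD[OF p u]
      unfolding left_kan_def by blast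
  qed
qed

text \<open>
  A universal \<open>e\<close> gives colimiting cocones over all slices \<open>u/b\<close>.  Their lifts are colimiting and agree,
  up to isomorphism, with the cocones obtained from the lift of \<open>e\<close>.
\<close>

lemma preserves_universal_pointwise:
  assumes u: "sfunc A B u" and s: "\<And>b. b \<in> Ob B \<Longrightarrow> small_cat (over u b)"
    and p: "\<And>b. b \<in> Ob B \<Longrightarrow> preserves_universal D E F (to_one (over u b))"
  shows "preserves_universal D E F u"
  unfolding preserves_universal_def
proof (intro allI impI)
  fix X Z e assume e: "universal (DF D u) X Z e"
  note fD = pd_func[OF pdD u] and fE = pd_func[OF pdE u]
  note eh = universal_hom[OF fD e] and Z = universal_ob[OF fD e]
  have X: "X \<in> Ob (DO D A)" using hom_ob[OF func_cat(2)[OF fD] eh] by simp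
  have FZ: "FO (MF F B) Z \<in> Ob (DO E B)" using func_ob[OF mfunc[OF sfunc_small(2)[OF u]] Z] .
  have "universal (DF E u) (FO (MF F A) X) (FO (MF F B) Z) (lift E F u Z e)"
  proof (rule universal_pointwise[OF U derE u s FZ lift_in[OF u Z eh]])
    fix b assume b: "b \<in> Ob B"
    let ?p = "over_proj u b" and ?\<alpha> = "over_cell u b" and ?b = "point B b" and ?t = "to_one (over u b)"
    note t = sfunc_to_one[OF U s[OF b]] and pb = sfunc_point[OF U sfunc_small(2)[OF u] b]
      and pr = sfunc_over_proj[OF U derD u b s[OF b]] and c = sntr_over_cell[OF U derD u b s[OF b]]
    note ft = pd_func[OF pdE t]
    from preserves_universalD[OF p[OF b] t over_universal[OF U derD u b s[OF b] e]]
    have "universal (DF E ?t) (FO (MF F (over u b)) (FO (DF D ?p) X)) (FO (MF F one_cat) (FO (DF D ?b) Z))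
        (lift E F ?t (FO (DF D ?b) Z) (pasted D ?p ?\<alpha> Z e))" .
    from universal_comp_iso[OF ft this exch_iso[OF pb Z]]
    have "universal (DF E ?t) (FO (MF F (over u b)) (FO (DF D ?p) X)) (FO (DF E ?b) (FO (MF F B) Z))
        (Cmp (DO E (over u b)) (pasted E ?p ?\<alpha> (FO (MF F B) Z) (lift E F u Z e)) (exch F ?p X))"
      unfolding lift_pasted[OF pdD pdE F pr u t pb c Z eh] .
    then show "universal (DF E ?t) (FO (DF E ?p) (FO (MF F A) X)) (FO (DF E ?b) (FO (MF F B) Z))
        (pasted E ?p ?\<alpha> (FO (MF F B) Z) (lift E F u Z e))"
      by (rule universal_precomp_iso_iff[OF ft exch_iso[OF pr X]
            pasted_hom[OF pdE pr u t pb c FZ lift_in[OF u Z eh]]])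
  qed
  then show "universal (DF E u) (FO (MF F (Src u)) X) (FO (MF F (Trg u)) Z) (lift E F u Z e)"
    using sfunc_ends[OF u] by simp
qed

text \<open>
  If \<open>e\<close> is a colimiting cocone, its restriction to \<open>K\<close> is colimiting, and so is the restriction of its
  lift.  The comparison of the lift with a colimiting cocone in \<open>E\<close> is therefore invertible, since it
  becomes a comparison of colimiting cocones after restriction to \<open>K\<close>.
\<close>

lemma preserves_colimits_final:
  assumes q: "sfunc K C q" and fD: "colimit_final D q" and fE: "colimit_final E q"
    and p: "preserves_universal D E F (to_one K)"
  shows "preserves_universal D E F (to_one C)"
  unfolding preserves_universal_def
proof (intro allI impI)
  fix X Z e assume e: "universal (DF D (to_one C)) X Z e"
  note tC = sfunc_to_one[OF U sfunc_small(2)[OF q]] and tK = sfunc_to_one[OF U sfunc_small(1)[OF q]]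
  have t: "to_one C \<bullet> q = to_one K" using to_one_comp sfunc_func[OF q] by blast
  have s: "Src q = K" "Trg q = C" using sfunc_ends[OF q] by auto
  note DC = pd_func[OF pdD tC] and EC = pd_func[OF pdE tC] and EK = pd_func[OF pdE tK] and Eq = pd_func[OF pdE q]
  note eh = universal_hom[OF DC e] and Z = universal_ob[OF DC e]
  have X: "X \<in> Ob (DO D C)" using hom_ob[OF func_cat(2)[OF DC] eh] by simp
  let ?X = "FO (MF F C) X" and ?Z = "FO (MF F one_cat) Z" and ?e = "lift E F (to_one C) Z e"
  have FX: "?X \<in> Ob (DO E C)" using func_ob[OF mfunc[OF sfunc_small(2)[OF q]] X] .
  have FZ: "?Z \<in> Ob (DO E one_cat)" using func_ob[OF mfunc[OF small_one[OF U]] Z] .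
  note le = lift_in[OF tC Z eh]
  have qle: "FA (DF E q) ?e \<in> hom (DO E K) (FO (DF E q) ?X) (FO (DF E (to_one K)) ?Z)"
    using func_hom[OF Eq le] pd_comp_ob[OF pdE q tC FZ] t by simp
  have "universal (DF D (to_one K)) (FO (DF D q) X) Z (FA (DF D q) e)"
    using fD e unfolding colimit_final_def s by blast
  from preserves_universalD[OF p tK this]
  have "universal (DF E (to_one K)) (FO (MF F K) (FO (DF D q) X)) ?Z
      (Cmp (DO E K) (FA (DF E q) ?e) (exch F q X))"
    using lift_restrict[OF pdD pdE F q tC Z eh] t by simp
  then have uK: "universal (DF E (to_one K)) (FO (DF E q) ?X) ?Z (FA (DF E q) ?e)"
    by (rule universal_precomp_iso_iff[OF EK exch_iso[OF q X] qle])
  obtain Z0 e0 where e0: "universal (DF E (to_one C)) ?X Z0 e0" using universal_exists[OF U derE tC FX] .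
  note e0h = universal_hom[OF EC e0]
  obtain g where g: "g \<in> hom (DO E one_cat) Z0 ?Z" "Cmp (DO E C) (FA (DF E (to_one C)) g) e0 = ?e"
    using universal_factor[OF EC e0 FZ le] .
  have "universal (DF E (to_one K)) (FO (DF E q) ?X) Z0 (FA (DF E q) e0)"
    using fE e0 unfolding colimit_final_def s by blast
  moreover have "Cmp (DO E K) (FA (DF E (to_one K)) g) (FA (DF E q) e0) = FA (DF E q) ?e"
    using func_comp[OF Eq func_hom[OF EC g(1)] e0h] pd_comp_hom[OF pdE q tC g(1)] g(2) t by simp
  ultimately have "g \<in> isos (DO E one_cat) Z0 ?Z" using universal_iso[OF EK _ uK g(1)] by simp
  from universal_comp_iso[OF EC e0 this]
  show "universal (DF E (to_one C)) (FO (MF F (Src (to_one C))) X) (FO (MF F (Trg (to_one C))) Z) ?e"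
    using g(2) sfunc_ends[OF tC] by simp
qed

text \<open>Universal arrows over \<open>w v\<close> are composites of universal arrows over \<open>v\<close> and \<open>w\<close>.\<close>

lemma preserves_universal_comp:
  assumes v: "sfunc A B v" and w: "sfunc B C w"
    and pv: "preserves_universal D E F v" and pw: "preserves_universal D E F w"
  shows "preserves_universal D E F (w \<bullet> v)"
proof (rule preserves_universalI[OF sfunc_comp[OF v w]])
  fix X assume X: "X \<in> Ob (DO D A)"
  obtain Z e where e: "universal (DF D v) X Z e" using universal_exists[OF U derD v X] .
  note eh = universal_hom[OF pd_func[OF pdD v] e] and Z = universal_ob[OF pd_func[OF pdD v] e]
  obtain W e' where e': "universal (DF D w) Z W e'" using universal_exists[OF U derD w Z] .
  note e'h = universal_hom[OF pd_func[OF pdD w] e'] and W = universal_ob[OF pd_func[OF pdD w] e']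
  have "universal (DF D (w \<bullet> v)) X W (Cmp (DO D A) (FA (DF D v) e') e)"
    using universal_comp[OF pd_func[OF pdD v] pd_func[OF pdD w] e e'] pd_comp[OF pdD v w] by simp
  moreover have "universal (DF E (w \<bullet> v)) (FO (MF F A) X) (FO (MF F C) W)
      (lift E F (w \<bullet> v) W (Cmp (DO D A) (FA (DF D v) e') e))"
    using universal_comp[OF pd_func[OF pdE v] pd_func[OF pdE w] preserves_universalD[OF pv v e]
        preserves_universalD[OF pw w e']] pd_comp[OF pdE v w] lift_comp[OF pdD pdE F v w W eh e'h] by simp
  ultimately show "\<exists>Z e. universal (DF D (w \<bullet> v)) X Z e \<and>
      universal (DF E (w \<bullet> v)) (FO (MF F A) X) (FO (MF F C) Z) (lift E F (w \<bullet> v) Z e)" by blast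
qed

lemma universal_id:
  assumes A: "is_cat A" and i: "i \<in> isos A X Z" shows "universal (id_ftr A) X Z i"
proof -
  have Z: "Z \<in> Ob A" and X: "X \<in> Ob A" using hom_ob[OF A isos_hom[OF i]] by auto
  note R = func_id_ftr[OF A]
  obtain j where j: "i \<in> hom A X Z" "j \<in> hom A Z X" "Cmp A j i = Idn A X"
    using i by (rule isosE)
  show ?thesis
  proof (rule universalI[OF R Z])
    show "i \<in> hom A X (FO (id_ftr A) Z)" using j Z by simp
    show "\<exists>g\<in>hom A Z W. Cmp A (FA (id_ftr A) g) i = f"
      if W: "W \<in> Ob A" and "f \<in> hom A X (FO (id_ftr A) W)" for W f
    proof (intro bexI[of _ "Cmp A f j"])
      have f: "f \<in> hom A X W" using that by simp
      show fj: "Cmp A f j \<in> hom A Z W" using cat_comp[OF A f j(2)] .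
      then show "Cmp A (FA (id_ftr A) (Cmp A f j)) i = f"
        using cat_assoc[OF A j(1,2) f] j(3) cat_id_right[OF A f] by (simp add: hom_iff)
    qed
    show "g = h" if "g \<in> hom A Z W" "h \<in> hom A Z W"
      "Cmp A (FA (id_ftr A) g) i = Cmp A (FA (id_ftr A) h) i" for W g h
      using iso_right_cancel[OF A i that(1,2)] that by (simp add: hom_iff)
  qed
qed

lemma preserves_one: "preserves_universal D E F (to_one one_cat)"
  unfolding to_one_one
proof (rule preserves_universalI[OF sfunc_id[OF small_one[OF U]]])
  fix X assume X: "X \<in> Ob (DO D one_cat)"
  note o1 = small_one[OF U] and i1 = sfunc_id[OF small_one[OF U]]
  note cD = pd_cat[OF pdD o1] and cE = pd_cat[OF pdE o1]
  note f = mfunc[OF o1]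
  let ?i = "Idn (DO D one_cat) X"
  have FX: "FO (MF F one_cat) X \<in> Ob (DO E one_cat)" using func_ob[OF f X] .
  note x = exch_iso[OF i1 X, unfolded pd_id_ob[OF pdD o1 X] pd_id_ob[OF pdE o1 FX]]
  have "lift E F (id_ftr one_cat) X ?i = exch F (id_ftr one_cat) X"
    unfolding lift_eq[OF pdD pdE F i1] func_id[OF f X] using cat_id_right[OF cE isos_hom[OF x]] .
  then have "universal (DF E (id_ftr one_cat)) (FO (MF F one_cat) X) (FO (MF F one_cat) X)
      (lift E F (id_ftr one_cat) X ?i)"
    using universal_id[OF cE x] pd_id[OF pdE o1] by simp
  moreover have "universal (DF D (id_ftr one_cat)) X X ?i"
    using universal_id[OF cD isos_id[OF cD X]] pd_id[OF pdD o1] by simp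
  ultimately show "\<exists>Z e. universal (DF D (id_ftr one_cat)) X Z e \<and>
      universal (DF E (id_ftr one_cat)) (FO (MF F one_cat) X) (FO (MF F one_cat) Z)
        (lift E F (id_ftr one_cat) Z e)" by blast
qed

end

section \<open>Finality from reflections, isomorphisms and equivalences\<close>

text \<open>
  Inclusions of reflective subcategories are right adjoints, hence final.  Here the counit is an
  identity, and the triangle identity says that the unit is an identity on the image of \<open>G\<close>.
\<close>

lemma colimit_final_reflection:
  fixes D :: "('u, 'o, 'm) prederiv"
  assumes U: "universe TYPE('u)" and pd: "prederivator D"
    and G: "sfunc K C G" and l: "sfunc C K l" and lG: "l \<bullet> G = id_ftr K"
    and \<eta>: "sntr C C (id_ftr C) (G \<bullet> l) \<eta>" and \<eta>G: "\<And>x. x \<in> Ob K \<Longrightarrow> Cpt \<eta> (FO G x) = Idn C (FO G x)"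
  shows "colimit_final D G"
proof (rule colimit_final_adjoint[OF U pd G l \<eta>])
  note sK = sfunc_small(1)[OF G] and sC = sfunc_small(2)[OF G]
  note idK = sfunc_id[OF sK]
  show "sntr K K (l \<bullet> G) (id_ftr K) (id_ntr (id_ftr K))" using sntr_id[OF pd idK] lG by simp
  fix X assume X: "X \<in> Ob (DO D C)"
  note fG = pd_func[OF pd G]
  have GX: "FO (DF D G) X \<in> Ob (DO D K)" using func_ob[OF fG X] .
  have GlG: "(G \<bullet> l) \<bullet> G = G"
    using comp_assoc[OF sfunc_func[OF G] sfunc_func[OF l] sfunc_func[OF G]] lG
      comp_id_right[OF sfunc_func[OF G]] by simp
  have w: "ntr G G (\<eta> \<rhd> G)"
    using ntr_whisker_right[OF sntr_func(3)[OF \<eta>] func_id_ftr sfunc_func[OF G]] sC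
      comp_id_left[OF sfunc_func[OF G]] GlG by (simp add: small_cat_def)
  have "\<eta> \<rhd> G = id_ntr G"
  proof (rule ntr_eqI[OF w ntr_id_ntr[OF sfunc_func[OF G]]])
    fix x assume "x \<in> Ob (Src G)"
    then show "Cpt (\<eta> \<rhd> G) x = Cpt (id_ntr G) x" using \<eta>G sfunc_ends[OF G] by simp
  qed
  then have "FA (DF D G) (Cpt (DN D \<eta>) X) = Idn (DO D K) (FO (DF D G) X)"
    using pd_whisker_right[OF pd \<eta> G X] pd_id_ntr[OF pd G X] by simp
  moreover have "Cpt (DN D (id_ntr (id_ftr K))) (FO (DF D G) X) = Idn (DO D K) (FO (DF D G) X)"
    using pd_id_ntr[OF pd idK GX] pd_id_ob[OF pd sK GX] by simp
  ultimately show "Cmp (DO D K) (Cpt (DN D (id_ntr (id_ftr K))) (FO (DF D G) X))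
      (FA (DF D G) (Cpt (DN D \<eta>) X)) \<in> isos (DO D K) (FO (DF D G) X) (FO (DF D G) X)"
    using isos_id[OF pd_cat[OF pd sK] GX] cat_id_left[OF pd_cat[OF pd sK]]
      cat_id[OF pd_cat[OF pd sK] GX] by simp
qed

lemma colimit_final_iso:
  fixes D :: "('u, 'o, 'm) prederiv"
  assumes U: "universe TYPE('u)" and pd: "prederivator D"
    and G: "sfunc K C G" and l: "sfunc C K l" and lG: "l \<bullet> G = id_ftr K" and Gl: "G \<bullet> l = id_ftr C"
  shows "colimit_final D G"
proof (rule colimit_final_reflection[OF U pd G l lG])
  show "sntr C C (id_ftr C) (G \<bullet> l) (id_ntr (id_ftr C))"
    using sntr_id[OF pd sfunc_id[OF sfunc_small(2)[OF G]]] Gl by simp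
  show "Cpt (id_ntr (id_ftr C)) (FO G x) = Idn C (FO G x)" if "x \<in> Ob K" for x
    using func_ob[OF sfunc_func[OF G] that] by simp
qed

lemma pd_nat_iso:
  fixes D :: "('u, 'o, 'm) prederiv"
  assumes pd: "prederivator D" and a: "sntr A B u v \<alpha>" and i: "nat_iso \<alpha>" and Z: "Z \<in> Ob (DO D B)"
  shows "Cpt (DN D \<alpha>) Z \<in> isos (DO D A) (FO (DF D u) Z) (FO (DF D v) Z)"
proof -
  note u = sntr_func(1)[OF a] and v = sntr_func(2)[OF a] and n = sntr_func(3)[OF a]
  have b: "sntr A B v u (nat_inv \<alpha>)"
    using ntr_nat_inv[OF i n sfunc_func[OF u]] v by (simp add: sntr_def)
  note inv = nat_inv_inverse[OF i n sfunc_func[OF u]]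
  have s: "Src u = A" "Trg u = B" "Src v = A" "Trg v = B" "NDom \<alpha> = u" "NDom (nat_inv \<alpha>) = v"
    using sfunc_ends[OF u] sfunc_ends[OF v] n b by (auto simp: ntr_def sntr_def)
  have "nat_inv \<alpha> \<odot> \<alpha> = id_ntr u"
    by (rule ntr_eqI[OF ntr_vcomp[OF n sntr_func(3)[OF b]] ntr_id_ntr[OF sfunc_func[OF u]]])
      (simp add: s inv)
  moreover have "\<alpha> \<odot> nat_inv \<alpha> = id_ntr v"
    by (rule ntr_eqI[OF ntr_vcomp[OF sntr_func(3)[OF b] n] ntr_id_ntr[OF sfunc_func[OF v]]])
      (simp add: s inv)
  ultimately show ?thesis
    using isosI[OF pd_cpt_hom[OF pd a Z] pd_cpt_hom[OF pd b Z]]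
      pd_vcomp[OF pd a b Z] pd_vcomp[OF pd b a Z] pd_id_ntr[OF pd u Z] pd_id_ntr[OF pd v Z] by simp
qed

lemma colimit_final_equivalence:
  fixes D :: "('u, 'o, 'm) prederiv"
  assumes U: "universe TYPE('u)" and pd: "prederivator D"
    and G: "sfunc K C G" and l: "sfunc C K l"
    and a: "sntr C C (id_ftr C) (G \<bullet> l) \<alpha>" "nat_iso \<alpha>"
    and b: "sntr K K (l \<bullet> G) (id_ftr K) \<beta>" "nat_iso \<beta>"
  shows "colimit_final D G"
proof (rule colimit_final_adjoint[OF U pd G l a(1) b(1)])
  fix X assume X: "X \<in> Ob (DO D C)"
  note fG = pd_func[OF pd G] and sC = sfunc_small(2)[OF G] and sK = sfunc_small(1)[OF G]
  have GX: "FO (DF D G) X \<in> Ob (DO D K)" using func_ob[OF fG X] .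
  have "FA (DF D G) (Cpt (DN D \<alpha>) X) \<in> isos (DO D K) (FO (DF D G) X)
      (FO (DF D G) (FO (DF D l) (FO (DF D G) X)))"
    using func_isos[OF fG pd_nat_iso[OF pd a X]] pd_comp_ob[OF pd l G X] pd_id_ob[OF pd sC X] by simp
  moreover have "Cpt (DN D \<beta>) (FO (DF D G) X) \<in> isos (DO D K)
      (FO (DF D G) (FO (DF D l) (FO (DF D G) X))) (FO (DF D G) X)"
    using pd_nat_iso[OF pd b GX] pd_comp_ob[OF pd G l GX] pd_id_ob[OF pd sK GX] by simp
  ultimately show "Cmp (DO D K) (Cpt (DN D \<beta>) (FO (DF D G) X)) (FA (DF D G) (Cpt (DN D \<alpha>) X))
      \<in> isos (DO D K) (FO (DF D G) X) (FO (DF D G) X)"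
    using isos_comp[OF pd_cat[OF pd sK]] by blast
qed

section \<open>Finite slices and subcategories\<close>

definition finite_cat :: "('o, 'm) cat \<Rightarrow> bool" where
  "finite_cat C \<longleftrightarrow> is_cat C \<and> finite (Ob C) \<and> finite (Ar C)"

lemma small_finite_cat: "universe TYPE('u) \<Longrightarrow> finite_cat (C :: 'u scat) \<Longrightarrow> small_cat C"
  by (simp add: finite_cat_def small_cat_def small_finite)

lemma finite_slice:
  assumes u: "func A B u" and A: "finite_cat A" and B: "finite_cat B"
  shows "finite (Ob (slice_over u b))" "finite (Ar (slice_over u b))"
    "finite (Ob (slice_under u b))" "finite (Ar (slice_under u b))"
proof -
  have s: "Src u = A" "Trg u = B" using u by (simp_all add: func_def)
  have "Ob (slice_over u b) \<subseteq> Ob A \<times> Ar B" "Ob (slice_under u b) \<subseteq> Ob A \<times> Ar B"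
    using s by (auto simp: slice_over_def slice_under_def Let_def)
  moreover have f: "finite (Ob A \<times> Ar B)" using A B by (simp add: finite_cat_def)
  ultimately show o: "finite (Ob (slice_over u b))" "finite (Ob (slice_under u b))"
    using finite_subset by blast+
  have "Ar (slice_over u b) \<subseteq> Ob (slice_over u b) \<times> Ar A \<times> Ob (slice_over u b)"
    "Ar (slice_under u b) \<subseteq> Ob (slice_under u b) \<times> Ar A \<times> Ob (slice_under u b)"
    using s by (auto simp: slice_over_def slice_under_def Let_def)
  moreover have "finite (Ob (slice_over u b) \<times> Ar A \<times> Ob (slice_over u b))"
    "finite (Ob (slice_under u b) \<times> Ar A \<times> Ob (slice_under u b))"
    using o A by (simp_all add: finite_cat_def)
  ultimately show "finite (Ar (slice_over u b))" "finite (Ar (slice_under u b))"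
    using finite_subset by blast+
qed

lemma small_slices:
  assumes U: "universe TYPE('u)" and u: "func A B (u :: 'u sftr)" and b: "b \<in> Ob B"
    and A: "finite_cat A" and B: "finite_cat B"
  shows "small_cat (over u b)" "small_cat (under u b)"
proof -
  note f = finite_slice[OF u A B]
  have "finite (Ob (over u b))" "finite (Ar (over u b))" "finite (Ob (under u b))" "finite (Ar (under u b))"
    using f by (simp_all add: over_def under_def small_copy_def)
  then show "small_cat (over u b)" "small_cat (under u b)"
    using small_finite_cat[OF U] is_cat_over[OF U u b] is_cat_under[OF U u b]
    by (simp_all add: finite_cat_def)
qed

lemma full_subcat_simps:
  "Ob (full_subcat C S) = Ob C \<inter> S"
  "f \<in> Ar (full_subcat C S) \<longleftrightarrow> f \<in> Ar C \<and> Dom C f \<in> S \<and> Cod C f \<in> S"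
  "f \<in> hom (full_subcat C S) x y \<longleftrightarrow> f \<in> hom C x y \<and> x \<in> S \<and> y \<in> S"
  "x \<in> Ob C \<Longrightarrow> x \<in> S \<Longrightarrow> Idn (full_subcat C S) x = Idn C x"
  by (auto simp: full_subcat_def hom_iff)

lemma full_subcat_comp:
  "f \<in> hom (full_subcat C S) x y \<Longrightarrow> g \<in> hom (full_subcat C S) y z \<Longrightarrow>
     Cmp (full_subcat C S) g f = Cmp C g f"
  by (auto simp: full_subcat_def hom_iff)

lemma is_cat_full_subcat:
  assumes C: "is_cat C" shows "is_cat (full_subcat C S)"
  unfolding full_subcat_def
proof (rule is_cat_mk_cat, goal_cases)
  case (1 f) then show ?case using C by (auto intro: Dom_ob Cod_ob)
next
  case (2 x) then show ?case using cat_id[OF C, of x] by (auto simp: hom_iff)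
next
  case (3 f g) then show ?case using cat_comp[OF C, of g "Cod C f" "Cod C g" f "Dom C f"] by (auto simp: hom_iff)
next
  case (4 f)
  then have "f \<in> hom C (Dom C f) (Cod C f)" by (simp add: hom_iff)
  then show ?case using cat_id_left[OF C] cat_id_right[OF C] by blast
next
  case (5 f g h)
  then show ?case using cat_assoc[OF C, of f "Dom C f" "Dom C g" g "Dom C h" h "Cod C h"] by (auto simp: hom_iff)
qed

lemma finite_full_subcat: "finite_cat C \<Longrightarrow> finite_cat (full_subcat C S)"
  unfolding finite_cat_def using is_cat_full_subcat by (auto simp: full_subcat_def)

section \<open>The span category\<close>

lemma is_cat_ord: "is_cat (ord_cat n)"
  unfolding ord_cat_def by (rule is_cat_mk_cat) auto

lemma ord_cat_hom: "f \<in> hom (ord_cat n) i j \<longleftrightarrow> f = (i, j) \<and> i \<le> j \<and> j \<le> n"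
  by (auto simp: ord_cat_def hom_iff)

lemma is_cat_product:
  assumes C: "is_cat C" and D: "is_cat D" shows "is_cat (product_cat C D)"
  unfolding product_cat_def
proof (rule is_cat_mk_cat, goal_cases)
  case (1 f) then show ?case using C D by (auto intro: Dom_ob Cod_ob)
next
  case (2 x) then show ?case using cat_id[OF C, of "fst x"] cat_id[OF D, of "snd x"] by (auto simp: hom_iff)
next
  case (3 f g)
  then show ?case
    using cat_comp[OF C, of "fst g" "Cod C (fst f)" "Cod C (fst g)" "fst f" "Dom C (fst f)"]
      cat_comp[OF D, of "snd g" "Cod D (snd f)" "Cod D (snd g)" "snd f" "Dom D (snd f)"]
    by (auto simp: hom_iff)
next
  case (4 f)
  then have "fst f \<in> hom C (Dom C (fst f)) (Cod C (fst f))" "snd f \<in> hom D (Dom D (snd f)) (Cod D (snd f))"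
    by (auto simp: hom_iff)
  then show ?case using cat_id_left[OF C] cat_id_right[OF C] cat_id_left[OF D] cat_id_right[OF D]
    by (cases f) auto
next
  case (5 f g h)
  obtain f1 f2 g1 g2 h1 h2 where e: "f = (f1, f2)" "g = (g1, g2)" "h = (h1, h2)"
    by (metis prod.exhaust)
  have h: "f1 \<in> hom C (Dom C f1) (Dom C g1)" "g1 \<in> hom C (Dom C g1) (Dom C h1)" "h1 \<in> hom C (Dom C h1) (Cod C h1)"
    "f2 \<in> hom D (Dom D f2) (Dom D g2)" "g2 \<in> hom D (Dom D g2) (Dom D h2)" "h2 \<in> hom D (Dom D h2) (Cod D h2)"
    using 5 unfolding e hom_iff by auto
  show ?case unfolding e using cat_assoc[OF C h(1-3)] cat_assoc[OF D h(4-6)] by simp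
qed

text \<open>The span shape before it is coded into the universe.\<close>

definition span0 :: "(nat \<times> nat, (nat \<times> nat) \<times> (nat \<times> nat)) cat" where
  "span0 = full_subcat (product_cat (ord_cat 1) (ord_cat 1))
     (Ob (product_cat (ord_cat 1) (ord_cat 1)) - {(1, 1)})"

lemma span_cat_copy: "span_cat = small_copy span0"
  by (simp add: span_cat_def span0_def)

lemma is_cat_span0: "is_cat span0"
  unfolding span0_def by (intro is_cat_full_subcat is_cat_product is_cat_ord)

lemma span0_ob: "Ob span0 = {(0, 0), (0, 1), (1, 0)}"
  by (auto simp: span0_def full_subcat_simps product_cat_def ord_cat_def)

lemma product_cat_hom:
  "m \<in> hom (product_cat C D) x y \<longleftrightarrow> fst m \<in> hom C (fst x) (fst y) \<and> snd m \<in> hom D (snd x) (snd y)"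
proof (cases "fst m \<in> Ar C \<and> snd m \<in> Ar D")
  case True
  then have "m \<in> Ar C \<times> Ar D" by (simp add: mem_Times_iff)
  then show ?thesis by (auto simp: hom_iff product_cat_def split_beta prod_eq_iff)
next
  case False
  then have "m \<notin> Ar C \<times> Ar D" by (simp add: mem_Times_iff)
  then show ?thesis using False by (auto simp: hom_iff product_cat_def)
qed

lemma span0_hom:
  "m \<in> hom span0 a b \<longleftrightarrow> a \<in> Ob span0 \<and> b \<in> Ob span0 \<and> fst a \<le> fst b \<and> snd a \<le> snd b \<and>
     m = ((fst a, fst b), (snd a, snd b))"
proof -
  have "m \<in> hom span0 a b \<longleftrightarrow> fst m = (fst a, fst b) \<and> snd m = (snd a, snd b) \<and> fst a \<le> fst b \<and>
      snd a \<le> snd b \<and> fst b \<le> 1 \<and> snd b \<le> 1 \<and> a \<noteq> (1, 1) \<and> b \<noteq> (1, 1)"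
    unfolding span0_def full_subcat_simps(3) product_cat_hom ord_cat_hom
    by (auto simp: product_cat_def ord_cat_def mem_Times_iff)
  moreover have "(p, q) \<in> Ob span0 \<longleftrightarrow> p \<le> 1 \<and> q \<le> 1 \<and> (p, q) \<noteq> (1, 1)" for p q
    unfolding span0_ob by (auto simp: le_Suc_eq)
  from this[of "fst a" "snd a"] this[of "fst b" "snd b"]
  have "a \<in> Ob span0 \<longleftrightarrow> fst a \<le> 1 \<and> snd a \<le> 1 \<and> a \<noteq> (1, 1)"
    "b \<in> Ob span0 \<longleftrightarrow> fst b \<le> 1 \<and> snd b \<le> 1 \<and> b \<noteq> (1, 1)" by simp_all
  ultimately show ?thesis by (cases m) (auto dest: le_trans)
qed

lemma finite_span0: "finite (Ar span0)"
proof -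
  have "Ar span0 \<subseteq> ({..1} \<times> {..1}) \<times> ({..1} \<times> {..1})"
    unfolding span0_def by (auto simp: full_subcat_simps product_cat_def ord_cat_def)
  then show ?thesis using finite_subset by blast
qed

context
  fixes U :: "'u itself"
  assumes U: "universe TYPE('u)"
begin

lemma finite_cat_span: "finite_cat (span_cat :: 'u scat)"
proof -
  have "is_cat (span_cat :: 'u scat)"
    unfolding span_cat_copy
    by (rule is_cat_small_copy[OF is_cat_span0]) (use code_inj_instances[OF U] in auto)
  moreover have "finite (Ob (span_cat :: 'u scat))" "finite (Ar (span_cat :: 'u scat))"
    using finite_span0 span0_ob by (simp_all add: span_cat_copy small_copy_def)
  ultimately show ?thesis by (simp add: finite_cat_def)
qed

lemma span_ob: "Ob (span_cat :: 'u scat) = code ` Ob span0"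
  by (simp add: span_cat_copy small_copy_def)

lemma span_hom: "m \<in> hom (span_cat :: 'u scat) x y \<longleftrightarrow>
    (\<exists>a b. x = code a \<and> y = code b \<and> a \<in> Ob span0 \<and> b \<in> Ob span0 \<and> fst a \<le> fst b \<and> snd a \<le> snd b \<and>
      m = code ((fst a, fst b), (snd a, snd b)))"
  unfolding span_cat_copy
  using small_copy_hom[OF is_cat_span0 code_inj_instances(4,5)[OF U], of m x y]
  by (auto simp: span0_hom)

text \<open>Since the span shape is a poset, a functor into it is an order-preserving labelling.\<close>

lemma span_functor:
  fixes K :: "'u scat"
  assumes K: "is_cat K" and ob: "\<And>x. x \<in> Ob K \<Longrightarrow> \<sigma> x \<in> Ob span0"
    and mono: "\<And>f x y. f \<in> hom K x y \<Longrightarrow> fst (\<sigma> x) \<le> fst (\<sigma> y) \<and> snd (\<sigma> x) \<le> snd (\<sigma> y)"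
  obtains v where "func K (span_cat :: 'u scat) v" "\<And>x. x \<in> Ob K \<Longrightarrow> FO v x = code (\<sigma> x)"
proof -
  let ?m = "\<lambda>f. ((fst (\<sigma> (Dom K f)), fst (\<sigma> (Cod K f))), (snd (\<sigma> (Dom K f)), snd (\<sigma> (Cod K f))))"
  let ?v = "mk_ftr K span0 \<sigma> ?m"
  have v: "func K span0 ?v"
  proof (rule func_mk_ftr[OF K is_cat_span0 ob])
    have h: "?m f \<in> hom span0 (\<sigma> x) (\<sigma> y)" if f: "f \<in> hom K x y" for f x y
    proof -
      have d: "Dom K f = x" "Cod K f = y" using f by (simp_all add: hom_iff)
      show ?thesis unfolding d using mono[OF f] hom_ob[OF K f] ob by (simp add: span0_hom)
    qed
    show "?m f \<in> hom span0 (\<sigma> x) (\<sigma> y)" if "f \<in> hom K x y" for f x y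
      using h[OF that] .
    show "?m (Idn K a) = Idn span0 (\<sigma> a)" if a: "a \<in> Ob K" for a
      using h[OF cat_id[OF K a]] cat_id[OF is_cat_span0 ob[OF a]] unfolding span0_hom by metis
    show "?m (Cmp K g f) = Cmp span0 (?m g) (?m f)"
      if f: "f \<in> hom K x y" and g: "g \<in> hom K y z" for f g x y z
      using h[OF cat_comp[OF K g f]] cat_comp[OF is_cat_span0 h[OF g] h[OF f]] unfolding span0_hom by metis
  qed
  note e = func_enc[OF is_cat_span0 code_inj_instances(4,5)[OF U]]
  have "func K (span_cat :: 'u scat) (enc span0 \<bullet> ?v)"
    unfolding span_cat_copy using func_comp_ftr[OF v e] .
  moreover have "FO ((enc span0 \<bullet> ?v) :: 'u sftr) x = code (\<sigma> x)" if "x \<in> Ob K" for x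
    using comp_ob[OF v that] that ob[OF that]
      enc_dec_simps(1)[OF is_cat_span0 code_inj_instances(4,5)[OF U]] by simp
  ultimately show thesis using that by blast
qed

text \<open>
  Over a preorder, the slice over \<open>b\<close> is isomorphic to the full subcategory of the objects lying below
  \<open>b\<close>, and isomorphisms are final.
\<close>

lemma slice_over_poset:
  fixes K B :: "'u scat"
  assumes v: "func K B v" and b: "b \<in> Ob B"
    and fK: "finite_cat K" and fB: "finite_cat B"
    and thin: "\<And>x y f g. f \<in> hom B x y \<Longrightarrow> g \<in> hom B x y \<Longrightarrow> f = g"
    and S: "\<And>k. k \<in> Ob K \<Longrightarrow> k \<in> S \<longleftrightarrow> hom B (FO v k) b \<noteq> {}"
  obtains G where "sfunc (full_subcat K S) (over v b) G" "\<And>D :: ('u, 'o, 'm) prederiv. prederivator D \<Longrightarrow> colimit_final D G"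
proof -
  let ?K = "full_subcat K S" and ?J = "slice_over v b"
  have K: "is_cat K" and B: "is_cat B" using fK fB by (auto simp: finite_cat_def)
  note cK = is_cat_full_subcat[OF K, of S]
  note cJ = is_cat_slice_over[OF v b]
  define t where "t k = (SOME f. f \<in> hom B (FO v k) b)" for k
  have t: "t k \<in> hom B (FO v k) b" if "k \<in> Ob ?K" for k
  proof -
    have "k \<in> Ob K" "k \<in> S" using that by (simp_all add: full_subcat_simps(1))
    then have "\<exists>f. f \<in> hom B (FO v k) b" using S by blast
    then show ?thesis unfolding t_def by (rule someI_ex)
  qed
  have tu: "f = t k" if "f \<in> hom B (FO v k) b" "k \<in> Ob K" for f k
  proof -
    have "hom B (FO v k) b \<noteq> {}" using that(1) by blast
    then have "k \<in> Ob ?K" using S[OF that(2)] that(2) by (simp add: full_subcat_simps(1))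
    then show ?thesis using thin[OF that(1) t] by simp
  qed
  have J_ob: "s \<in> Ob ?J \<longleftrightarrow> (\<exists>k\<in>Ob ?K. s = (k, t k))" for s
  proof
    assume "s \<in> Ob ?J"
    then have s: "fst s \<in> Ob K" "snd s \<in> hom B (FO v (fst s)) b" by (simp_all add: slice_over_ob[OF v])
    then have "hom B (FO v (fst s)) b \<noteq> {}" by blast
    then have "fst s \<in> Ob ?K" using S[OF s(1)] s(1) by (simp add: full_subcat_simps(1))
    then show "\<exists>k\<in>Ob ?K. s = (k, t k)" using tu[OF s(2,1)] by (metis prod.collapse)
  next
    assume "\<exists>k\<in>Ob ?K. s = (k, t k)"
    then obtain k where k: "k \<in> Ob ?K" "s = (k, t k)" by blast
    then show "s \<in> Ob ?J" using t[OF k(1)] by (simp add: slice_over_ob[OF v] full_subcat_simps)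
  qed
  let ?G = "mk_ftr ?K ?J (\<lambda>k. (k, t k)) (\<lambda>f. ((Dom K f, t (Dom K f)), f, (Cod K f, t (Cod K f))))"
  let ?l = "mk_ftr ?J ?K fst (\<lambda>m. fst (snd m))"
  have Gh: "((x, t x), f, (y, t y)) \<in> hom ?J (x, t x) (y, t y)" if f: "f \<in> hom ?K x y" for f x y
  proof -
    have f': "f \<in> hom K x y" and x: "x \<in> Ob ?K" and y: "y \<in> Ob ?K"
      using f hom_ob[OF cK f] by (auto simp: full_subcat_simps)
    have "Cmp B (t y) (FA v f) = t x"
      using cat_comp[OF B t[OF y] func_hom[OF v f']] t[OF x] thin by blast
    then show ?thesis using x y f' by (auto simp: slice_over_hom[OF v] J_ob)
  qed
  have G: "func ?K ?J ?G"
  proof (rule func_mk_ftr[OF cK cJ], goal_cases)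
    case (1 a) then show ?case using J_ob by blast
  next
    case (2 f x y)
    have "f \<in> hom K x y" using 2 by (simp add: full_subcat_simps(3))
    then have "Dom K f = x" "Cod K f = y" by (simp_all add: hom_iff)
    then show ?case using Gh[OF 2] by simp
  next
    case (3 a)
    then have "(a, t a) \<in> Ob ?J" using J_ob by blast
    then show ?case using 3 slice_over_id[OF v] cat_id[OF K, of a] by (simp add: full_subcat_simps hom_iff)
  next
    case (4 f g x y z)
    then have fg: "f \<in> hom K x y" "g \<in> hom K y z" by (auto simp: full_subcat_simps)
    have c: "Cmp ?K g f = Cmp K g f" "Cmp K g f \<in> hom K x z"
      using full_subcat_comp[OF 4(1,2)] cat_comp[OF K fg(2,1)] by auto
    show ?case using slice_over_comp[OF v Gh[OF 4(1)] Gh[OF 4(2)]] fg c by (simp add: hom_iff)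
  qed
  have l: "func ?J ?K ?l"
  proof (rule func_mk_ftr[OF cJ cK], goal_cases)
    case (1 a) then show ?case using J_ob by auto
  next
    case (2 f x y) then show ?case by (auto simp: slice_over_hom[OF v] J_ob full_subcat_simps)
  next
    case (3 a) then show ?case using J_ob[of a] by (auto simp: slice_over_id[OF v] full_subcat_simps)
  next
    case (4 f g x y z)
    obtain f' g' where fg: "f = (x, f', y)" "g = (y, g', z)" using 4 by (auto simp: slice_over_hom[OF v])
    have fg': "f' \<in> hom ?K (fst x) (fst y)" "g' \<in> hom ?K (fst y) (fst z)"
      using 4 fg by (auto simp: slice_over_hom[OF v] J_ob full_subcat_simps)
    then show ?case using 4 fg slice_over_comp[OF v, of x f' y b g' z] full_subcat_comp[OF fg'] by simp
  qed
  note i = code_inj_instances(1,3)[OF U]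
  note en = func_enc[OF cJ i] and de = func_dec[OF cJ i]
  have lG0: "?l \<bullet> ?G = id_ftr ?K"
    by (rule ftr_eqI[OF func_comp_ftr[OF G l] func_id_ftr[OF cK]])
      (use func_ob[OF G] func_ar[OF G] in \<open>auto\<close>)
  have Gl0: "?G \<bullet> ?l = id_ftr ?J"
  proof (rule ftr_eqI[OF func_comp_ftr[OF l G] func_id_ftr[OF cJ]])
    show "FO (?G \<bullet> ?l) x = FO (id_ftr ?J) x" if "x \<in> Ob ?J" for x
      using that J_ob[of x] by auto
    show "FA (?G \<bullet> ?l) f = FA (id_ftr ?J) f" if "f \<in> Ar ?J" for f
    proof -
      have f: "f \<in> hom ?J (Dom ?J f) (Cod ?J f)" using that by (simp add: hom_iff)
      then obtain x g y where "f = ((x, t x), g, (y, t y))" "g \<in> hom K x y" "x \<in> Ob ?K" "y \<in> Ob ?K"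
        by (auto simp: slice_over_hom[OF v] J_ob)
      then show ?thesis using that comp_hom[OF l f] f by (simp add: full_subcat_simps hom_iff)
    qed
  qed
  let ?e = "enc ?J :: ('u \<times> 'u, ('u \<times> 'u) \<times> 'u \<times> ('u \<times> 'u), 'u, 'u) ftr"
    and ?d = "dec ?J :: ('u, 'u, 'u \<times> 'u, ('u \<times> 'u) \<times> 'u \<times> ('u \<times> 'u)) ftr"
  let ?G' = "?e \<bullet> ?G" and ?l' = "?l \<bullet> ?d"
  have G': "func ?K (over v b) ?G'" and l': "func (over v b) ?K ?l'"
    unfolding over_def using func_comp_ftr[OF G en] func_comp_ftr[OF de l] by auto
  have "?l' \<bullet> ?G' = ?l \<bullet> ((?d \<bullet> ?e) \<bullet> ?G)"
    by (rule trans[OF comp_assoc[OF func_comp_ftr[OF G en] de l, symmetric]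
          arg_cong[where f = "\<lambda>z. ?l \<bullet> z", OF comp_assoc[OF G en de]]])
  also have "\<dots> = id_ftr ?K"
    unfolding dec_enc[OF cJ i] using comp_id_left[OF G] lG0 by simp
  finally have lG: "?l' \<bullet> ?G' = id_ftr ?K" .
  have "?G' \<bullet> ?l' = ?e \<bullet> ((?G \<bullet> ?l) \<bullet> ?d)"
    by (rule trans[OF comp_assoc[OF func_comp_ftr[OF de l] G en, symmetric]
          arg_cong[where f = "\<lambda>z. ?e \<bullet> z", OF comp_assoc[OF de l G]]])
  also have "\<dots> = id_ftr (over v b)"
    unfolding Gl0 over_def using comp_id_left[OF de] enc_dec[OF cJ i] by simp
  finally have Gl: "?G' \<bullet> ?l' = id_ftr (over v b)" .
  note sK = small_finite_cat[OF U finite_full_subcat[OF fK], of S]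
  note sO = small_slices(1)[OF U v b fK fB]
  have "sfunc ?K (over v b) ?G'" "sfunc (over v b) ?K ?l'"
    using G' l' sK sO by (auto simp: sfunc_def)
  then show thesis using that colimit_final_iso[OF U _ _ _ lG Gl] by blast
qed

end

section \<open>The double mapping cylinder at a maximal_hom object\<close>

text \<open>
  Let \<open>C'\<close> be \<open>C\<close> without \<open>m\<close>, and \<open>C'/m\<close> the category of nonidentity arrows into \<open>m\<close>.  The objects of the
  double mapping cylinder of \<open>C' \<leftarrow> C'/m \<rightarrow> 1\<close> are those of \<open>C'\<close>, of \<open>C'/m\<close> and the point.  They are encoded
  by arrows of \<open>C\<close>: an object of \<open>C'\<close> by its identity, an object of \<open>C'/m\<close> by itself, and the point by the
  identity of \<open>m\<close>.  So the domain of the arrow is the image of the object in \<open>C\<close>, and no tags are needed.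
  An arrow of the cylinder is an arrow \<open>g\<close> between these domains; it has to be an arrow over \<open>m\<close> if the
  target lies in \<open>C'/m\<close> or is the point.
\<close>

definition cyl_ob :: "'u scat \<Rightarrow> 'u \<Rightarrow> 'u set" where
  "cyl_ob C m = {f \<in> Ar C. Cod C f = m \<or> f = Idn C (Dom C f)}"

definition cylinder :: "'u scat \<Rightarrow> 'u \<Rightarrow> 'u scat" where
  "cylinder C m = mk_cat (cyl_ob C m)
     (code ` {(f, g, f'). f \<in> cyl_ob C m \<and> f' \<in> cyl_ob C m \<and> g \<in> hom C (Dom C f) (Dom C f') \<and>
       (Cod C f' = m \<longrightarrow> Cmp C f' g = f)})
     (\<lambda>k. fst (decode k :: 'u \<times> 'u \<times> 'u)) (\<lambda>k. snd (snd (decode k :: 'u \<times> 'u \<times> 'u)))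
     (\<lambda>f. code (f, Idn C (Dom C f), f))
     (\<lambda>k' k. code (fst (decode k :: 'u \<times> 'u \<times> 'u),
        Cmp C (fst (snd (decode k' :: 'u \<times> 'u \<times> 'u))) (fst (snd (decode k :: 'u \<times> 'u \<times> 'u))),
        snd (snd (decode k' :: 'u \<times> 'u \<times> 'u))))"

definition cyl_proj :: "'u scat \<Rightarrow> 'u \<Rightarrow> 'u sftr" where
  "cyl_proj C m = mk_ftr (cylinder C m) C (Dom C) (\<lambda>k. fst (snd (decode k :: 'u \<times> 'u \<times> 'u)))"

definition maximal_ob :: "('o, 'm) cat \<Rightarrow> 'o \<Rightarrow> bool" where
  "maximal_ob C m \<longleftrightarrow> m \<in> Ob C \<and> (\<forall>f\<in>Ar C. Dom C f = m \<longrightarrow> f = Idn C m)"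

context
  fixes C :: "'u scat" and m :: 'u
  assumes U: "universe TYPE('u)" and fC: "finite_cat C" and mx: "maximal_ob C m"
begin

lemma max_ob: "m \<in> Ob C"
  and max_arrow: "f \<in> Ar C \<Longrightarrow> Dom C f = m \<Longrightarrow> f = Idn C m"
  using mx by (simp_all add: maximal_ob_def)

lemma cyl_cat: "is_cat C"
  using fC by (simp add: finite_cat_def)

lemma decode_triple: "decode (code t :: 'u) = (t :: 'u \<times> 'u \<times> 'u)"
  using code_inj_instances(2)[OF U] by simp

lemma cyl_idn: "x \<in> Ob C \<Longrightarrow> Idn C x \<in> Ar C \<and> Dom C (Idn C x) = x \<and> Cod C (Idn C x) = x"
  using cat_id[OF cyl_cat, of x] by (simp add: hom_iff)

lemma maximal_hom: "g \<in> hom C m y \<Longrightarrow> g = Idn C m \<and> y = m"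
  using max_arrow[of g] cyl_idn[OF max_ob] by (auto simp: hom_iff)

lemma cyl_ob_in: "f \<in> cyl_ob C m \<Longrightarrow> f \<in> hom C (Dom C f) (Cod C f) \<and> Dom C f \<in> Ob C \<and> Cod C f \<in> Ob C"
  using cyl_cat by (auto simp: cyl_ob_def hom_iff)

lemma cyl_ob_from_max: "f \<in> cyl_ob C m \<Longrightarrow> Dom C f = m \<Longrightarrow> f = Idn C m"
  using max_arrow by (auto simp: cyl_ob_def)

lemma is_cat_cylinder: "is_cat (cylinder C m)"
  unfolding cylinder_def
proof (rule is_cat_mk_cat, goal_cases)
  case (1 k) then show ?case by (auto simp: decode_triple)
next
  case (2 f)
  then have f: "f \<in> hom C (Dom C f) (Cod C f)" "Dom C f \<in> Ob C" using cyl_ob_in by auto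
  show ?case using 2 cat_id[OF cyl_cat f(2)] cat_id_right[OF cyl_cat f(1)] by (simp add: decode_triple)
next
  case (3 k k')
  then obtain f g f' g' f'' where k: "k = code (f, g, f')" "k' = code (f', g', f'')"
    "f \<in> cyl_ob C m" "f' \<in> cyl_ob C m" "f'' \<in> cyl_ob C m"
    "g \<in> hom C (Dom C f) (Dom C f')" "g' \<in> hom C (Dom C f') (Dom C f'')"
    "Cod C f' = m \<longrightarrow> Cmp C f' g = f" "Cod C f'' = m \<longrightarrow> Cmp C f'' g' = f'"
    by (auto simp: decode_triple)
  have f'': "f'' \<in> hom C (Dom C f'') (Cod C f'')" using cyl_ob_in[OF k(5)] by simp
  have "Cmp C f'' (Cmp C g' g) = f" if "Cod C f'' = m"
  proof -
    have f': "Cmp C f'' g' = f'" using k(9) that by simp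
    then have "Cod C f' = m" using cat_comp[OF cyl_cat f'' k(7)] that by (simp add: hom_iff)
    then show ?thesis using cat_assoc[OF cyl_cat k(6,7) f''] f' k(8) by simp
  qed
  then show ?case using k cat_comp[OF cyl_cat k(7,6)] by (simp add: decode_triple)
next
  case (4 k)
  then obtain f g f' where k: "k = code (f, g, f')" "g \<in> hom C (Dom C f) (Dom C f')" by auto
  then show ?case using cat_id_left[OF cyl_cat k(2)] cat_id_right[OF cyl_cat k(2)] by (simp add: decode_triple)
next
  case (5 k k' k'')
  then obtain f g f' g' f'' g'' f3 where k: "k = code (f, g, f')" "k' = code (f', g', f'')"
    "k'' = code (f'', g'', f3)" "g \<in> hom C (Dom C f) (Dom C f')" "g' \<in> hom C (Dom C f') (Dom C f'')"
    "g'' \<in> hom C (Dom C f'') (Dom C f3)"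
    by (auto simp: decode_triple)
  then show ?case using cat_assoc[OF cyl_cat k(4-6)] by (simp add: decode_triple)
qed

lemma cyl_Ob: "Ob (cylinder C m) = cyl_ob C m"
  by (simp add: cylinder_def)

lemma cyl_hom: "k \<in> hom (cylinder C m) f f' \<longleftrightarrow> (\<exists>g. k = code (f, g, f') \<and> f \<in> cyl_ob C m \<and>
    f' \<in> cyl_ob C m \<and> g \<in> hom C (Dom C f) (Dom C f') \<and> (Cod C f' = m \<longrightarrow> Cmp C f' g = f))"
  (is "?l \<longleftrightarrow> ?r")
proof
  assume l: ?l
  then have kA: "k \<in> Ar (cylinder C m)" and ends: "Dom (cylinder C m) k = f" "Cod (cylinder C m) k = f'"
    by (simp_all add: hom_iff)
  then show ?r unfolding cylinder_def by (auto simp: decode_triple)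
next
  assume ?r
  then obtain g where g: "k = code (f, g, f')" "f \<in> cyl_ob C m" "f' \<in> cyl_ob C m"
    "g \<in> hom C (Dom C f) (Dom C f')" "Cod C f' = m \<longrightarrow> Cmp C f' g = f" by blast
  then have "k \<in> Ar (cylinder C m)" by (auto simp: cylinder_def)
  then show ?l using g(1) unfolding hom_iff by (simp add: cylinder_def decode_triple)
qed

lemma cyl_id: "f \<in> cyl_ob C m \<Longrightarrow> Idn (cylinder C m) f = code (f, Idn C (Dom C f), f)"
  by (simp add: cylinder_def)

lemma cyl_comp: "code (f, g, f') \<in> hom (cylinder C m) f f' \<Longrightarrow> code (f', g', f'') \<in> hom (cylinder C m) f' f'' \<Longrightarrow>
    Cmp (cylinder C m) (code (f', g', f'')) (code (f, g, f')) = code (f, Cmp C g' g, f'')"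
proof -
  assume a: "code (f, g, f') \<in> hom (cylinder C m) f f'" and b: "code (f', g', f'') \<in> hom (cylinder C m) f' f''"
  then have "code (f, g, f') \<in> Ar (cylinder C m)" "code (f', g', f'') \<in> Ar (cylinder C m)"
    by (simp_all add: hom_iff)
  then show ?thesis unfolding cylinder_def by (simp add: decode_triple)
qed

lemma code_triple_eq: "(code t :: 'u) = code t' \<longleftrightarrow> t = (t' :: 'u \<times> 'u \<times> 'u)"
  using code_inj_instances(2)[OF U] by (simp add: inj_eq)

lemma cyl_homD: "code (f0, g, f0') \<in> hom (cylinder C m) f f' \<Longrightarrow> f0 = f \<and> f0' = f' \<and> f \<in> cyl_ob C m \<and>
    f' \<in> cyl_ob C m \<and> g \<in> hom C (Dom C f) (Dom C f') \<and> (Cod C f' = m \<longrightarrow> Cmp C f' g = f)"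
  by (auto simp: cyl_hom code_triple_eq)

lemma finite_cylinder: "finite_cat (cylinder C m)"
proof -
  have o: "finite (cyl_ob C m)" using fC by (simp add: finite_cat_def cyl_ob_def)
  have "{(f, g, f'). f \<in> cyl_ob C m \<and> f' \<in> cyl_ob C m \<and> g \<in> hom C (Dom C f) (Dom C f') \<and>
       (Cod C f' = m \<longrightarrow> Cmp C f' g = f)} \<subseteq> cyl_ob C m \<times> Ar C \<times> cyl_ob C m"
    by (auto simp: hom_iff)
  moreover have "finite (cyl_ob C m \<times> Ar C \<times> cyl_ob C m)" using o fC by (simp add: finite_cat_def)
  ultimately have "finite {(f, g, f'). f \<in> cyl_ob C m \<and> f' \<in> cyl_ob C m \<and> g \<in> hom C (Dom C f) (Dom C f') \<and>
       (Cod C f' = m \<longrightarrow> Cmp C f' g = f)}" using finite_subset by blast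
  then show ?thesis using o is_cat_cylinder by (simp add: finite_cat_def cylinder_def)
qed

lemma func_cyl_proj: "func (cylinder C m) C (cyl_proj C m)"
  unfolding cyl_proj_def
proof (rule func_mk_ftr[OF is_cat_cylinder cyl_cat], goal_cases)
  case (1 a) then show ?case using cyl_ob_in by (simp add: cyl_Ob)
next
  case (2 k f f') then show ?case by (auto simp: cyl_hom decode_triple)
next
  case (3 a) then show ?case by (simp add: cyl_Ob cyl_id decode_triple)
next
  case (4 k k' f f' f'')
  obtain g :: 'u where g: "k = code (f, g, f')" using 4(1) unfolding cyl_hom by blast
  obtain g' :: 'u where g': "k' = code (f', g', f'')" using 4(2) unfolding cyl_hom by blast
  note k = g g'
  then show ?case using cyl_comp 4 by (simp add: decode_triple)
qed

lemma cyl_proj_simps: "f \<in> cyl_ob C m \<Longrightarrow> FO (cyl_proj C m) f = Dom C f"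
  "code (f, g, f') \<in> hom (cylinder C m) f f' \<Longrightarrow> FA (cyl_proj C m) (code (f, g, f')) = g"
  unfolding cyl_proj_def by (auto simp: cyl_Ob decode_triple)

subsection \<open>The projection is final\<close>

abbreviation (input) "fibre c \<equiv> slice_under (cyl_proj C m) c"

text \<open>
  An object of \<open>c/q\<close> is a pair \<open>s = (f, k : c \<rightarrow> dom f)\<close>.  Pulling \<open>f\<close> back along \<open>k\<close> gives an object of
  the cylinder over \<open>c\<close> itself.
\<close>

definition pull :: "'u \<Rightarrow> 'u \<times> 'u \<Rightarrow> 'u" where
  "pull c s = (if Cod C (fst s) = m then Cmp C (fst s) (snd s) else Idn C c)"

context
  fixes c :: 'u
  assumes c: "c \<in> Ob C"
begin

lemma fibre_ob: "s \<in> Ob (fibre c) \<longleftrightarrow> fst s \<in> cyl_ob C m \<and> snd s \<in> hom C c (Dom C (fst s))"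
  by (auto simp: slice_under_ob[OF func_cyl_proj] cyl_Ob cyl_proj_simps)

lemma fibre_hom: "x \<in> hom (fibre c) s t \<longleftrightarrow> s \<in> Ob (fibre c) \<and> t \<in> Ob (fibre c) \<and>
    (\<exists>g. x = (s, code (fst s, g, fst t), t) \<and> code (fst s, g, fst t) \<in> hom (cylinder C m) (fst s) (fst t) \<and>
       Cmp C g (snd s) = snd t)"
  (is "?l \<longleftrightarrow> ?r")
proof
  assume ?l
  then obtain k where k: "s \<in> Ob (fibre c)" "t \<in> Ob (fibre c)" "x = (s, k, t)"
    "k \<in> hom (cylinder C m) (fst s) (fst t)" "Cmp C (FA (cyl_proj C m) k) (snd s) = snd t"
    by (auto simp: slice_under_hom[OF func_cyl_proj])
  moreover obtain g :: 'u where "k = code (fst s, g, fst t)" using k(4) unfolding cyl_hom by blast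
  ultimately show ?r using cyl_proj_simps(2) by auto
next
  assume ?r then show ?l using cyl_proj_simps(2) by (auto simp: slice_under_hom[OF func_cyl_proj])
qed

lemma pull_ob: "s \<in> Ob (fibre c) \<Longrightarrow> pull c s \<in> cyl_ob C m \<and> Dom C (pull c s) = c"
proof -
  assume s: "s \<in> Ob (fibre c)"
  then have h: "fst s \<in> hom C (Dom C (fst s)) (Cod C (fst s))" "snd s \<in> hom C c (Dom C (fst s))"
    using cyl_ob_in by (auto simp: fibre_ob)
  show ?thesis using cat_comp[OF cyl_cat h] cyl_idn[OF c] by (auto simp: pull_def cyl_ob_def hom_iff)
qed

lemma pull_max:
  assumes s: "s \<in> Ob (fibre c)" and "c = m" shows "pull c s = Idn C m"
  using cyl_ob_from_max pull_ob[OF s] assms(2) by auto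

text \<open>
  If the object \<open>fst t\<close> of the cylinder is an arrow into \<open>m\<close>, so is \<open>fst s\<close>, and both give the same
  composite \<open>c \<rightarrow> m\<close>.  Otherwise \<open>pull c t\<close> is the identity of \<open>c\<close>, which ends at \<open>m\<close> only for
  \<open>c = m\<close>; then maximality leaves no choice.
\<close>

lemma pull_natural:
  assumes x: "x \<in> hom (fibre c) s t" and e: "Cod C (pull c t) = m" shows "pull c t = pull c s"
proof (cases "c = m")
  case True
  have "s \<in> Ob (fibre c)" "t \<in> Ob (fibre c)" using x by (auto simp: fibre_hom)
  then show ?thesis using pull_max True by simp
next
  case False
  obtain g where g: "s \<in> Ob (fibre c)" "t \<in> Ob (fibre c)"
    "code (fst s, g, fst t) \<in> hom (cylinder C m) (fst s) (fst t)" "Cmp C g (snd s) = snd t"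
    using x by (auto simp: fibre_hom)
  have t: "Cod C (fst t) = m" using e cyl_idn[OF c] False by (auto simp: pull_def split: if_splits)
  have h: "Cmp C (fst t) g = fst s" "g \<in> hom C (Dom C (fst s)) (Dom C (fst t))" "fst t \<in> hom C (Dom C (fst t)) m"
    "snd s \<in> hom C c (Dom C (fst s))"
    using cyl_homD[OF g(3)] cyl_ob_in[of "fst t"] g(1) t by (auto simp: fibre_ob)
  have "Cod C (fst s) = m" using cat_comp[OF cyl_cat h(3,2)] h(1) by (simp add: hom_iff)
  then show ?thesis using t g(4) h(1) cat_assoc[OF cyl_cat h(4,2,3)] by (simp add: pull_def)
qed

lemma fibre_arrowI:
  assumes "s \<in> Ob (fibre c)" "t \<in> Ob (fibre c)" "g \<in> hom C (Dom C (fst s)) (Dom C (fst t))"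
    "Cod C (fst t) = m \<Longrightarrow> Cmp C (fst t) g = fst s" "Cmp C g (snd s) = snd t"
  shows "(s, code (fst s, g, fst t), t) \<in> hom (fibre c) s t"
  using assms by (auto simp: fibre_hom fibre_ob cyl_hom)

lemma fibre_comp:
  assumes "(s, code (fst s, g, fst t), t) \<in> hom (fibre c) s t" "(t, code (fst t, g', fst r), r) \<in> hom (fibre c) t r"
  shows "Cmp (fibre c) (t, code (fst t, g', fst r), r) (s, code (fst s, g, fst t), t) =
    (s, code (fst s, Cmp C g' g, fst r), r)"
proof -
  have "code (fst s, g, fst t) \<in> hom (cylinder C m) (fst s) (fst t)"
    "code (fst t, g', fst r) \<in> hom (cylinder C m) (fst t) (fst r)"
    using assms by (auto simp: fibre_hom code_triple_eq)
  then show ?thesis using slice_under_comp[OF func_cyl_proj assms] cyl_comp by simp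
qed

lemma fibre_id: "s \<in> Ob (fibre c) \<Longrightarrow> Idn (fibre c) s = (s, code (fst s, Idn C (Dom C (fst s)), fst s), s)"
  using slice_under_id[OF func_cyl_proj] cyl_id by (simp add: fibre_ob)

lemma is_cat_fibre: "is_cat (fibre c)"
  using is_cat_slice_under[OF func_cyl_proj c] .

text \<open>The contraction of \<open>c/q\<close>: it moves \<open>(f, k : c \<rightarrow> dom f)\<close> along \<open>k\<close> to an object over \<open>c\<close> itself.\<close>

definition contract :: "('u \<times> 'u, ('u \<times> 'u) \<times> 'u \<times> ('u \<times> 'u), 'u \<times> 'u, ('u \<times> 'u) \<times> 'u \<times> ('u \<times> 'u)) ftr" where
  "contract = mk_ftr (fibre c) (fibre c) (\<lambda>s. (pull c s, Idn C c))
    (\<lambda>x. ((pull c (fst x), Idn C c), code (pull c (fst x), Idn C c, pull c (snd (snd x))),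
      (pull c (snd (snd x)), Idn C c)))"

text \<open>
  The pulled back objects are those over \<open>c\<close>, and each of them has the arrow \<open>id\<^sub>c\<close> to the object encoded
  by \<open>id\<^sub>c\<close>.  This is the centre of the contraction.
\<close>

definition base_pt :: "'u \<times> 'u" where "base_pt = (Idn C c, Idn C c)"

lemma contract_ob: "s \<in> Ob (fibre c) \<Longrightarrow> (pull c s, Idn C c) \<in> Ob (fibre c)"
  using pull_ob cat_id[OF cyl_cat c] by (simp add: fibre_ob)

lemma contract_arrow:
  assumes "x \<in> hom (fibre c) s t"
  shows "((pull c s, Idn C c), code (pull c s, Idn C c, pull c t), (pull c t, Idn C c)) \<in>
    hom (fibre c) (pull c s, Idn C c) (pull c t, Idn C c)"
proof -
  have st: "s \<in> Ob (fibre c)" "t \<in> Ob (fibre c)" using assms by (auto simp: fibre_hom)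
  note i = cat_id[OF cyl_cat c]
  have "pull c t \<in> hom C c (Cod C (pull c t))"
    using pull_ob[OF st(2)] cyl_ob_in by metis
  then show ?thesis
    using fibre_arrowI[OF contract_ob[OF st(1)] contract_ob[OF st(2)], of "Idn C c"] pull_ob[OF st(1)] pull_ob[OF st(2)] i
      cat_id_left[OF cyl_cat i] cat_id_right[OF cyl_cat] pull_natural[OF assms] by simp
qed

lemma func_contract: "func (fibre c) (fibre c) contract"
  unfolding contract_def
proof (rule func_mk_ftr[OF is_cat_fibre is_cat_fibre], goal_cases)
  case (1 s) then show ?case by (rule contract_ob)
next
  case (2 x s t)
  then have "fst x = s" "snd (snd x) = t" by (auto simp: fibre_hom)
  then show ?case using contract_arrow[OF 2] by simp
next
  case (3 s) then show ?case using fibre_id[OF contract_ob[OF 3]] pull_ob[OF 3] by (simp add: fibre_id)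
next
  case (4 x y s t r)
  then have e: "fst x = s" "snd (snd x) = t" "fst y = t" "snd (snd y) = r" by (auto simp: fibre_hom)
  have "Cmp (fibre c) y x \<in> hom (fibre c) s r" using cat_comp[OF is_cat_fibre 4(2,1)] .
  then have "fst (Cmp (fibre c) y x) = s" "snd (snd (Cmp (fibre c) y x)) = r" by (auto simp: fibre_hom)
  then show ?case
    using fibre_comp[of "(pull c s, Idn C c)" "Idn C c" "(pull c t, Idn C c)" "Idn C c" "(pull c r, Idn C c)"]
      contract_arrow[OF 4(1)] contract_arrow[OF 4(2)] e cat_id_left[OF cyl_cat cat_id[OF cyl_cat c]] by simp
qed

lemma contract_simps: "s \<in> Ob (fibre c) \<Longrightarrow> FO contract s = (pull c s, Idn C c)"
  "x \<in> hom (fibre c) s t \<Longrightarrow> FA contract x =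
     ((pull c s, Idn C c), code (pull c s, Idn C c, pull c t), (pull c t, Idn C c))"
proof -
  show "FO contract s = (pull c s, Idn C c)" if "s \<in> Ob (fibre c)" using that by (simp add: contract_def)
  show "FA contract x = ((pull c s, Idn C c), code (pull c s, Idn C c, pull c t), (pull c t, Idn C c))"
    if x: "x \<in> hom (fibre c) s t"
  proof -
    have "fst x = s" "snd (snd x) = t" using x by (auto simp: fibre_hom)
    then show ?thesis using x by (simp add: contract_def, simp)
  qed
qed

lemma counit_arrow:
  assumes s: "s \<in> Ob (fibre c)"
  shows "((pull c s, Idn C c), code (pull c s, snd s, fst s), s) \<in> hom (fibre c) (pull c s, Idn C c) s"
proof -
  have "snd s \<in> hom C c (Dom C (fst s))" using s by (simp add: fibre_ob)
  then show ?thesis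
    using fibre_arrowI[OF contract_ob[OF s] s, of "snd s"] pull_ob[OF s] cat_id_right[OF cyl_cat] by (simp add: pull_def)
qed

lemma base_ob: "base_pt \<in> Ob (fibre c)"
  using cyl_idn[OF c] cat_id[OF cyl_cat c] by (simp add: base_pt_def fibre_ob cyl_ob_def)

lemma base_arrow:
  assumes s: "s \<in> Ob (fibre c)"
  shows "((pull c s, Idn C c), code (pull c s, Idn C c, Idn C c), base_pt) \<in> hom (fibre c) (pull c s, Idn C c) base_pt"
proof -
  note i = cat_id[OF cyl_cat c]
  show ?thesis
    using fibre_arrowI[OF contract_ob[OF s] base_ob, of "Idn C c"] pull_ob[OF s] cyl_idn[OF c] i cat_id_left[OF cyl_cat i]
      pull_max[OF s] unfolding base_pt_def by auto
qed

lemma contraction_counit: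
  "ntr contract (id_ftr (fibre c)) (mk_ntr contract (id_ftr (fibre c)) (\<lambda>s. ((pull c s, Idn C c), code (pull c s, snd s, fst s), s)))"
proof (rule ntr_mk_ntr[OF func_contract func_id_ftr[OF is_cat_fibre]], goal_cases)
  case (1 s) then show ?case using counit_arrow contract_simps(1) by simp
next
  case (2 x s t)
  then obtain g where g: "s \<in> Ob (fibre c)" "t \<in> Ob (fibre c)" "x = (s, code (fst s, g, fst t), t)"
    "Cmp C g (snd s) = snd t" by (auto simp: fibre_hom)
  have t: "snd t \<in> hom C c (Dom C (fst t))" using g(2) by (simp add: fibre_ob)
  have "FA (id_ftr (fibre c)) x = x" using 2 by (simp add: hom_iff)
  then show ?case
    using contract_simps(2)[OF 2] g(3,4) cat_id_right[OF cyl_cat t]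
      fibre_comp[of "(pull c s, Idn C c)" "Idn C c" "(pull c t, Idn C c)" "snd t" t] contract_arrow[OF 2]
      fibre_comp[of "(pull c s, Idn C c)" "snd s" s g t] 2
      counit_arrow[OF g(1)] counit_arrow[OF g(2)] by simp
qed

lemma contraction_base:
  "ntr contract (mk_ftr (fibre c) (fibre c) (\<lambda>_. base_pt) (\<lambda>_. Idn (fibre c) base_pt))
    (mk_ntr contract (mk_ftr (fibre c) (fibre c) (\<lambda>_. base_pt) (\<lambda>_. Idn (fibre c) base_pt))
      (\<lambda>s. ((pull c s, Idn C c), code (pull c s, Idn C c, Idn C c), base_pt)))"
proof -
  note b = base_ob
  note ib = cat_id[OF is_cat_fibre b] and i = cat_id[OF cyl_cat c]
  have K: "func (fibre c) (fibre c) (mk_ftr (fibre c) (fibre c) (\<lambda>_. base_pt) (\<lambda>_. Idn (fibre c) base_pt))"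
    by (rule func_mk_ftr[OF is_cat_fibre is_cat_fibre]) (use b ib cat_id_left[OF is_cat_fibre ib] in auto)
  show ?thesis
  proof (rule ntr_mk_ntr[OF func_contract K], goal_cases)
    case (1 s) then show ?case using base_arrow contract_simps(1) by simp
  next
    case (2 x s t)
    then have st: "s \<in> Ob (fibre c)" "t \<in> Ob (fibre c)" by (auto simp: fibre_hom)
    show ?case
      using contract_simps(2)[OF 2] 2 contract_arrow[OF 2] base_arrow[OF st(1)] base_arrow[OF st(2)]
        cat_id_left[OF is_cat_fibre base_arrow[OF st(1)]] cat_id_left[OF cyl_cat i]
        fibre_comp[of "(pull c s, Idn C c)" "Idn C c" "(pull c t, Idn C c)" "Idn C c" base_pt]
      by (simp add: base_pt_def)
  qed
qed

end

subsection \<open>The three pieces of the cylinder\<close>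

definition piece :: "'u set \<Rightarrow> 'u scat" where
  "piece S = full_subcat (cylinder C m) S"

lemma finite_piece: "finite_cat (piece S)"
  unfolding piece_def using finite_full_subcat[OF finite_cylinder] .

lemma is_cat_piece: "is_cat (piece S)"
  using finite_piece by (simp add: finite_cat_def)

lemma small_piece: "small_cat (piece S)"
  using small_finite_cat[OF U finite_piece] .

lemma piece_hom: "k \<in> hom (piece S) f f' \<longleftrightarrow> k \<in> hom (cylinder C m) f f' \<and> f \<in> S \<and> f' \<in> S"
  and piece_ob: "Ob (piece S) = cyl_ob C m \<inter> S"
  and piece_id: "f \<in> cyl_ob C m \<Longrightarrow> f \<in> S \<Longrightarrow> Idn (piece S) f = code (f, Idn C (Dom C f), f)"
  unfolding piece_def by (simp_all add: full_subcat_simps cyl_Ob cyl_id)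

lemma piece_comp: "code (f, g, f') \<in> hom (piece S) f f' \<Longrightarrow> code (f', g', f'') \<in> hom (piece S) f' f'' \<Longrightarrow>
    Cmp (piece S) (code (f', g', f'')) (code (f, g, f')) = code (f, Cmp C g' g, f'')"
  unfolding piece_def using full_subcat_comp cyl_comp
  by (metis (no_types, lifting) full_subcat_simps(3))

text \<open>The objects over \<open>m\<close> have the terminal object \<open>id\<^sub>m\<close>.\<close>

lemma top_piece_final:
  fixes D :: "('u, 'o, 'm) prederiv"
  assumes pd: "prederivator D"
  defines "S \<equiv> {f. Cod C f = m}"
  shows "sfunc one_cat (piece S) (point (piece S) (Idn C m))"
    "colimit_final D (point (piece S) (Idn C m))"
proof -
  let ?P = "piece S" and ?i = "Idn C m"
  have i: "?i \<in> cyl_ob C m" "?i \<in> S" "Dom C ?i = m" "Cod C ?i = m"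
    using cyl_idn[OF max_ob] by (auto simp: cyl_ob_def S_def)
  have iP: "?i \<in> Ob ?P" using i by (simp add: piece_ob)
  note im = cat_id[OF cyl_cat max_ob]
  show G: "sfunc one_cat ?P (point ?P ?i)" using sfunc_point[OF U small_piece iP] .
  note l = sfunc_to_one[OF U small_piece, of S]
  have lG: "to_one ?P \<bullet> point ?P ?i = id_ftr one_cat"
    using to_one_comp[OF sfunc_func[OF G]] to_one_one by simp
  have t: "code (f, f, ?i) \<in> hom ?P f ?i" if "f \<in> Ob ?P" for f
  proof -
    have "f \<in> cyl_ob C m" "f \<in> S" using that by (auto simp: piece_ob)
    then have "f \<in> hom C (Dom C f) m" using cyl_ob_in by (auto simp: S_def)
    then show ?thesis
      using i cat_id_left[OF cyl_cat] \<open>f \<in> cyl_ob C m\<close> \<open>f \<in> S\<close> by (auto simp: piece_hom cyl_hom)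
  qed
  note lf = sfunc_func[OF l] and Gl = func_comp_ftr[OF sfunc_func[OF l] sfunc_func[OF G]]
  have Glo: "FO (point ?P ?i \<bullet> to_one ?P) f = ?i" if "f \<in> Ob ?P" for f
    using that by (simp add: comp_ob[OF lf that], simp add: to_one_def)
  have n: "ntr (id_ftr ?P) (point ?P ?i \<bullet> to_one ?P)
      (mk_ntr (id_ftr ?P) (point ?P ?i \<bullet> to_one ?P) (\<lambda>f. code (f, f, ?i)))"
  proof (rule ntr_mk_ntr[OF func_id_ftr[OF is_cat_piece] Gl], goal_cases)
    case (1 f) then show ?case using t Glo by simp
  next
    case (2 k f f')
    then obtain g where g: "k = code (f, g, f')" "Cmp C f' g = f" "f \<in> Ob ?P" "f' \<in> Ob ?P"
      by (auto simp: piece_hom cyl_hom piece_ob S_def)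
    have "FA (point ?P ?i \<bullet> to_one ?P) k = code (?i, ?i, ?i)"
      using 2 piece_id[OF i(1,2)] i(3) by (simp add: comp_hom[OF lf 2], simp add: to_one_def)
    moreover have "f \<in> hom C (Dom C f) m"
      using g(3) cyl_ob_in[of f] by (auto simp: piece_ob S_def)
    then have "Cmp C ?i f = f" by (rule cat_id_left[OF cyl_cat])
    moreover have "code (?i, ?i, ?i) \<in> hom ?P ?i ?i"
      using cat_id[OF is_cat_piece iP] piece_id[OF i(1,2)] i(3) by simp
    moreover have "FA (id_ftr ?P) k = k" using 2 by (simp add: hom_iff)
    ultimately show ?case
      using g piece_comp[of f g f' S f' ?i] piece_comp[of f f ?i S ?i ?i] 2 t by simp
  qed
  show "colimit_final D (point ?P ?i)"
  proof (rule colimit_final_reflection[OF U pd G l lG])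
    show "sntr ?P ?P (id_ftr ?P) (point ?P ?i \<bullet> to_one ?P)
      (mk_ntr (id_ftr ?P) (point ?P ?i \<bullet> to_one ?P) (\<lambda>f. code (f, f, ?i)))"
      using n sfunc_id[OF small_piece] by (simp add: sntr_def)
    show "Cpt (mk_ntr (id_ftr ?P) (point ?P ?i \<bullet> to_one ?P) (\<lambda>f. code (f, f, ?i))) (FO (point ?P ?i) x) =
        Idn ?P (FO (point ?P ?i) x)" if "x \<in> Ob one_cat" for x
      using that iP piece_id[OF i(1,2)] i(3) by simp
  qed
qed

text \<open>
  The objects other than \<open>id\<^sub>m\<close> are reflected onto the identities, which form a copy of \<open>C\<close> without
  \<open>m\<close>: the reflection of \<open>f\<close> is \<open>id\<^bsub>dom f\<^esub>\<close>.
\<close>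

lemma bottom_piece_final:
  defines "S \<equiv> - {Idn C m}" and "B \<equiv> full_subcat C (Ob C - {m})"
  obtains G where "sfunc B (piece S) G" "\<And>D :: ('u, 'o, 'm) prederiv. prederivator D \<Longrightarrow> colimit_final D G"
proof -
  let ?P = "piece S"
  have fB: "finite_cat B" unfolding B_def using finite_full_subcat[OF fC] .
  then have cB: "is_cat B" by (simp add: finite_cat_def)
  note sB = small_finite_cat[OF U fB]
  have B_ob: "x \<in> Ob B \<longleftrightarrow> x \<in> Ob C \<and> x \<noteq> m" for x by (auto simp: B_def full_subcat_simps)
  have B_hom: "g \<in> hom B x y \<longleftrightarrow> g \<in> hom C x y \<and> x \<noteq> m \<and> y \<noteq> m" for g x y
    using hom_ob[OF cyl_cat] by (auto simp: B_def full_subcat_simps)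
  have B_id: "Idn B x = Idn C x" if "x \<in> Ob B" for x using that by (simp add: B_def full_subcat_simps)
  have B_comp: "Cmp B g f = Cmp C g f" if "f \<in> hom B x y" "g \<in> hom B y z" for f g x y z
    using that unfolding B_def by (rule full_subcat_comp)
  have S_iff: "f \<in> S \<longleftrightarrow> f \<noteq> Idn C m" for f by (simp add: S_def)
  have P_ob: "f \<in> Ob ?P \<longleftrightarrow> f \<in> cyl_ob C m \<and> f \<noteq> Idn C m" for f by (auto simp: piece_ob S_def)
  have dom: "Dom C f \<in> Ob B" if "f \<in> Ob ?P" for f
    using that cyl_ob_from_max[of f] cyl_ob_in[of f] by (auto simp: P_ob B_ob)
  have io: "Idn C x \<in> Ob ?P" if "x \<in> Ob B" for x
    using that cyl_idn[of x] cyl_idn[OF max_ob] by (auto simp: P_ob B_ob cyl_ob_def)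
  let ?G = "mk_ftr B ?P (Idn C) (\<lambda>g. code (Idn C (Dom C g), g, Idn C (Cod C g)))"
  let ?l = "mk_ftr ?P B (Dom C) (\<lambda>k. fst (snd (decode k :: 'u \<times> 'u \<times> 'u)))"
  have Gh: "code (Idn C x, g, Idn C y) \<in> hom ?P (Idn C x) (Idn C y)" if "g \<in> hom B x y" for g x y
  proof -
    have "x \<in> Ob B" "y \<in> Ob B" using hom_ob[OF cB that] by auto
    then show ?thesis using io[of x] io[of y] cyl_idn[of x] cyl_idn[of y] that
      by (auto simp: piece_hom piece_ob cyl_hom B_hom B_ob)
  qed
  have Ph: "\<exists>g. k = code (f, g, f') \<and> g \<in> hom B (Dom C f) (Dom C f')" if k: "k \<in> hom ?P f f'" for k f f'
  proof -
    have "f \<in> Ob ?P" "f' \<in> Ob ?P" using hom_ob[OF is_cat_piece k] by auto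
    then have "Dom C f \<noteq> m" "Dom C f' \<noteq> m" using dom B_ob by auto
    then show ?thesis using k by (auto simp: piece_hom cyl_hom B_hom)
  qed
  have G: "func B ?P ?G"
  proof (rule func_mk_ftr[OF cB is_cat_piece], goal_cases)
    case (1 a) then show ?case by (rule io)
  next
    case (2 g x y)
    then have "Dom C g = x" "Cod C g = y" by (auto simp: B_hom hom_iff[of g C])
    then show ?case using Gh[OF 2] by simp
  next
    case (3 a)
    then have "a \<in> Ob C" by (simp add: B_ob)
    then show ?case using cyl_idn[of a] io[OF 3] 3 by (simp add: B_id piece_id P_ob S_iff)
  next
    case (4 f g x y z)
    then have d: "Dom C f = x" "Cod C f = y" "Dom C g = y" "Cod C g = z" "f \<in> hom C x y" "g \<in> hom C y z"
      by (auto simp: B_hom hom_iff[of f C] hom_iff[of g C])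
    have "Cmp C g f \<in> hom C x z" using cat_comp[OF cyl_cat d(6,5)] .
    then show ?case
      using piece_comp[OF Gh[OF 4(1)] Gh[OF 4(2)]] B_comp[OF 4] d by (simp add: hom_iff[of "Cmp C g f"])
  qed
  have l: "func ?P B ?l"
  proof (rule func_mk_ftr[OF is_cat_piece cB], goal_cases)
    case (1 f) then show ?case by (rule dom)
  next
    case (2 k f f') then show ?case using Ph[OF 2] by (auto simp: decode_triple)
  next
    case (3 f) then show ?case using dom[OF 3] by (simp add: B_id piece_id P_ob S_iff decode_triple)
  next
    case (4 k k' f f' f'')
    obtain g g' where g: "k = code (f, g, f')" "k' = code (f', g', f'')"
      "g \<in> hom B (Dom C f) (Dom C f')" "g' \<in> hom B (Dom C f') (Dom C f'')"
      using Ph[OF 4(1)] Ph[OF 4(2)] by blast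
    then show ?case using 4 piece_comp[of f g f' S g' f''] B_comp[OF g(3,4)] by (simp add: decode_triple)
  qed
  have lG: "?l \<bullet> ?G = id_ftr B"
  proof (rule ftr_eqI[OF func_comp_ftr[OF G l] func_id_ftr[OF cB]])
    show "FO (?l \<bullet> ?G) x = FO (id_ftr B) x" if "x \<in> Ob B" for x
      using that io[OF that] cyl_idn[of x] by (simp add: B_ob)
    show "FA (?l \<bullet> ?G) g = FA (id_ftr B) g" if "g \<in> Ar B" for g
      using that func_ar[OF G that] by (simp, simp add: decode_triple)
  qed
  note Gl = func_comp_ftr[OF l G]
  let ?n = "\<lambda>f. (code (f, Idn C (Dom C f), Idn C (Dom C f)) :: 'u)"
  have n: "?n f \<in> hom ?P f (Idn C (Dom C f))" if f: "f \<in> Ob ?P" for f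
    using f io[OF dom[OF f]] dom[OF f] cyl_idn[of "Dom C f"] cat_id[OF cyl_cat, of "Dom C f"]
    by (auto simp: piece_hom piece_ob cyl_hom B_ob)
  have Glo: "FO (?G \<bullet> ?l) f = Idn C (Dom C f)" if "f \<in> Ob ?P" for f
    using comp_ob[OF l that] that dom[OF that] by simp
  have N: "ntr (id_ftr ?P) (?G \<bullet> ?l) (mk_ntr (id_ftr ?P) (?G \<bullet> ?l) ?n)"
  proof (rule ntr_mk_ntr[OF func_id_ftr[OF is_cat_piece] Gl], goal_cases)
    case (1 f) then show ?case using n Glo by simp
  next
    case (2 k f f')
    obtain g where g: "k = code (f, g, f')" "g \<in> hom B (Dom C f) (Dom C f')" using Ph[OF 2] by blast
    have ob: "f \<in> Ob ?P" "f' \<in> Ob ?P" using hom_ob[OF is_cat_piece 2] by auto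
    have gC: "g \<in> hom C (Dom C f) (Dom C f')" using g(2) by (simp add: B_hom)
    then have d: "Dom C g = Dom C f" "Cod C g = Dom C f'" by (simp_all add: hom_iff)
    have lk: "FA ?l k = g" using 2 g(1) by (simp, simp add: decode_triple)
    have "FA (?G \<bullet> ?l) k = FA ?G (FA ?l k)" using comp_hom[OF l 2] .
    also have "\<dots> = code (Idn C (Dom C f), g, Idn C (Dom C f'))"
      unfolding lk using g(2) d by (simp, simp)
    finally have "FA (?G \<bullet> ?l) k = code (Idn C (Dom C f), g, Idn C (Dom C f'))" .
    moreover have "FA (id_ftr ?P) k = k" using 2 by (simp add: hom_iff)
    ultimately show ?case
      using piece_comp[of f g f' S "Idn C (Dom C f')" "Idn C (Dom C f')"] n[OF ob(1)] n[OF ob(2)] 2 g(1)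
        piece_comp[of f "Idn C (Dom C f)" "Idn C (Dom C f)" S g "Idn C (Dom C f')"] Gh[OF g(2)]
        cat_id_left[OF cyl_cat gC] cat_id_right[OF cyl_cat gC] by simp
  qed
  have sG: "sfunc B ?P ?G" and sl: "sfunc ?P B ?l"
    using G l sB small_piece by (auto simp: sfunc_def)
  have "colimit_final D ?G" if "prederivator D" for D :: "('u, 'o, 'm) prederiv"
  proof (rule colimit_final_reflection[OF U that sG sl lG])
    show "sntr ?P ?P (id_ftr ?P) (?G \<bullet> ?l) (mk_ntr (id_ftr ?P) (?G \<bullet> ?l) ?n)"
      using N sfunc_id[OF small_piece] by (simp add: sntr_def)
    show "Cpt (mk_ntr (id_ftr ?P) (?G \<bullet> ?l) ?n) (FO ?G x) = Idn ?P (FO ?G x)" if "x \<in> Ob B" for x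
      using that io[OF that] cyl_idn[of x] by (simp add: B_ob piece_id P_ob S_iff)
  qed
  then show thesis using that sG by blast
qed

text \<open>
  No arrow leads from the point to another object, nor from \<open>C'\<close> to \<open>C'/m\<close> or to the point; so the
  partition of the cylinder into its three pieces is a functor to the span shape.
\<close>

lemma cylinder_arrow_label:
  assumes k: "k \<in> hom (cylinder C m) f f'"
  shows "f = Idn C m \<Longrightarrow> f' = Idn C m" "Cod C f' = m \<Longrightarrow> Cod C f = m"
proof -
  obtain g where g: "f \<in> cyl_ob C m" "f' \<in> cyl_ob C m" "g \<in> hom C (Dom C f) (Dom C f')"
    "Cod C f' = m \<longrightarrow> Cmp C f' g = f" using k by (auto simp: cyl_hom)
  show "f' = Idn C m" if "f = Idn C m"
  proof -
    have "Dom C f' = m" using maximal_hom[of g "Dom C f'"] g(3) cyl_idn[OF max_ob] that by simp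
    then show ?thesis using cyl_ob_from_max[OF g(2)] by simp
  qed
  show "Cod C f = m" if "Cod C f' = m"
    using cat_comp[OF cyl_cat conjunct1[OF cyl_ob_in[OF g(2)]] g(3)] g(4) that by (simp add: hom_iff)
qed

end

lemma small_copy_contraction:
  fixes B :: "('o, 'm) cat" and S :: "'u scat"
  assumes B: "is_cat B" and io: "inj (code :: 'o \<Rightarrow> 'u)" and im: "inj (code :: 'm \<Rightarrow> 'u)"
    and T: "func B B T" and a: "ntr T (id_ftr B) \<alpha>"
    and b: "ntr T (mk_ftr B B (\<lambda>_. j) (\<lambda>_. Idn B j)) \<beta>" and j: "j \<in> Ob B"
  defines "S \<equiv> small_copy B"
  obtains T' \<alpha>' \<beta>' where "func S S T'" "ntr T' (id_ftr S) \<alpha>'" "ntr T' (point S (code j) \<bullet> to_one S) \<beta>'"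
proof -
  let ?e = "enc B :: ('o, 'm, 'u, 'u) ftr" and ?d = "dec B :: ('u, 'u, 'o, 'm) ftr"
  let ?c = "mk_ftr B B (\<lambda>_. j) (\<lambda>_. Idn B j)"
  note e = func_enc[OF B io im, folded S_def] and d = func_dec[OF B io im, folded S_def]
  have S: "is_cat S" using func_cat(1)[OF d] .
  have c: "func B B ?c"
  proof -
    have "Src T = B" "Trg T = B" using T by (simp_all add: func_def)
    then show ?thesis using ntr_func(2)[OF b] by simp
  qed
  have jS: "code j \<in> Ob S" using func_ob[OF e j] j by (simp add: enc_def)
  have 1: "ntr ((?e \<bullet> T) \<bullet> ?d) (id_ftr S) ((?e \<lhd> \<alpha>) \<rhd> ?d)"
    using ntr_whisker_right[OF ntr_whisker_left[OF a T e] func_comp_ftr[OF T e] d]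
      comp_id_right[OF e] enc_dec[OF B io im] by (simp add: S_def)
  have 2: "ntr ((?e \<bullet> T) \<bullet> ?d) ((?e \<bullet> ?c) \<bullet> ?d) ((?e \<lhd> \<beta>) \<rhd> ?d)"
    using ntr_whisker_right[OF ntr_whisker_left[OF b T e] func_comp_ftr[OF T e] d] .
  note t = func_to_one[OF S] and p = func_point[OF S jS]
  have iS: "Idn S (code j) = code (Idn B j)"
    unfolding S_def using small_copy_simps(5)[OF B io im j] .
  have jj: "Idn B j \<in> Ar B" using cat_id[OF B j] by (simp add: hom_iff)
  have "(?e \<bullet> ?c) \<bullet> ?d = point S (code j) \<bullet> to_one S"
  proof (rule ftr_eqI[OF func_comp_ftr[OF d func_comp_ftr[OF c e]] func_comp_ftr[OF t p]])
    fix x assume x: "x \<in> Ob S"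
    have "FO (point S (code j) \<bullet> to_one S) x = code j"
      using x by (simp add: comp_ob[OF t x], simp add: to_one_def)
    moreover have "FO ((?e \<bullet> ?c) \<bullet> ?d) x = code j"
      using func_ob[OF d x] j by (simp add: comp_ob[OF d x] comp_ob[OF c func_ob[OF d x]], simp add: enc_def)
    ultimately show "FO ((?e \<bullet> ?c) \<bullet> ?d) x = FO (point S (code j) \<bullet> to_one S) x" by simp
  next
    fix f assume f: "f \<in> Ar S"
    have f': "f \<in> hom S (Dom S f) (Cod S f)" using f by (simp add: hom_iff)
    have "FA (point S (code j) \<bullet> to_one S) f = code (Idn B j)"
      using f iS by (simp add: comp_hom[OF t f'], simp add: to_one_def)
    moreover have "FA ((?e \<bullet> ?c) \<bullet> ?d) f = code (Idn B j)"
      using func_ar[OF d f] jj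
      by (simp add: comp_hom[OF d f'] comp_hom[OF c func_hom[OF d f']], simp add: enc_def)
    ultimately show "FA ((?e \<bullet> ?c) \<bullet> ?d) f = FA (point S (code j) \<bullet> to_one S) f" by simp
  qed
  then show thesis using that[OF func_comp_ftr[OF d func_comp_ftr[OF T e]] 1] 2 by simp
qed

lemma cyl_proj_final:
  fixes C :: "'u scat" and D :: "('u, 'o, 'm) prederiv"
  assumes U: "universe TYPE('u)" and fC: "finite_cat C" and mx: "maximal_ob C m"
    and der: "derivator D"
  shows "sfunc (cylinder C m) C (cyl_proj C m)" "colimit_final D (cyl_proj C m)"
proof -
  note pd = derivator_prederivator[OF der]
  note q = func_cyl_proj[OF U fC mx] and fK = finite_cylinder[OF U fC mx]
  show sq: "sfunc (cylinder C m) C (cyl_proj C m)"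
    using q small_finite_cat[OF U fK] small_finite_cat[OF U fC] by (simp add: sfunc_def)
  show "colimit_final D (cyl_proj C m)"
  proof (rule colimit_final_under[OF U der sq])
    fix c assume c: "c \<in> Ob C"
    show sJ: "small_cat (under (cyl_proj C m) c)" using small_slices(2)[OF U q c fK fC] .
    note b = base_ob[OF U fC mx c] and T = func_contract[OF U fC mx c]
    obtain T \<alpha> \<beta> where t: "func (under (cyl_proj C m) c) (under (cyl_proj C m) c) T"
      "ntr T (id_ftr (under (cyl_proj C m) c)) \<alpha>"
      "ntr T (point (under (cyl_proj C m) c) (code (base_pt C c)) \<bullet> to_one (under (cyl_proj C m) c)) \<beta>"
      using small_copy_contraction[OF is_cat_slice_under[OF q c] code_inj_instances(1,3)[OF U] T
          contraction_counit[OF U fC mx c] contraction_base[OF U fC mx c] b]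
      unfolding under_def by blast
    have "code (base_pt C c) \<in> Ob (under (cyl_proj C m) c)"
      using under_ob[OF U q c] b by blast
    then show "fully_faithful (DF D (to_one (under (cyl_proj C m) c)))"
      using contraction_fully_faithful[OF U pd] t sJ unfolding sntr_def sfunc_def by blast
  qed
qed

section \<open>Colimits over finite graded categories\<close>

definition graded :: "('o, 'm) cat \<Rightarrow> nat \<Rightarrow> ('o \<Rightarrow> nat) \<Rightarrow> bool" where
  "graded C n h \<longleftrightarrow> finite_cat C \<and> (\<forall>x\<in>Ob C. h x < n) \<and>
     (\<forall>f\<in>Ar C. f = Idn C (Dom C f) \<or> h (Dom C f) < h (Cod C f))"

lemma is_cat_empty: "is_cat empty_cat"
  unfolding empty_cat_def by (rule is_cat_mk_cat) auto

lemma empty_cat_unique: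
  assumes C: "is_cat C" and e: "Ob C = {}" shows "C = empty_cat"
proof (rule cat_eqI[OF C is_cat_empty])
  have "Ar C = {}" using Dom_ob[OF C] e by blast
  then show "Ar C = Ar empty_cat" by (simp add: empty_cat_def)
qed (use e in \<open>auto simp: empty_cat_def hom_iff\<close>)

context
  fixes D E :: "('u, 'o, 'm) prederiv" and F :: "('u, 'o, 'm) dmor"
  assumes U: "universe TYPE('u)" and derD: "derivator D" and derE: "derivator E"
    and F: "derivator_morphism D E F" and span: "preserves_universal D E F (to_one span_cat)"
begin

text \<open>
  The slices of the functor \<open>v\<close> to the span shape are \<open>C'/m\<close>, a category that reflects onto \<open>C'\<close>, and a
  category with a terminal object.  So \<open>F\<close> preserves Kan extensions along \<open>v\<close>, and with the colimits of
  spans it preserves the colimits over the cylinder.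
\<close>

lemma cylinder_preserves:
  assumes g: "graded C n h" and mx: "maximal_ob C m"
    and below: "preserves_universal D E F (to_one (piece C m {f. Cod C f = m \<and> f \<noteq> Idn C m}))"
    and rest: "preserves_universal D E F (to_one (full_subcat C (Ob C - {m})))"
  shows "preserves_universal D E F (to_one C)"
proof -
  have fC: "finite_cat C" and C: "is_cat C" using g by (auto simp: graded_def finite_cat_def)
  note prem = U fC mx and m = max_ob[OF U fC mx]
  note D = derivator_prederivator[OF derD] and E = derivator_prederivator[OF derE]
  note pres_final = preserves_colimits_final[OF U derD derE F]
  let ?K = "cylinder C m" and ?S = "span_cat :: 'u scat"
  note fK = finite_cylinder[OF prem] and cK = is_cat_cylinder[OF prem] and K_ob = cyl_Ob[OF prem]
  note fS = finite_cat_span[OF U]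
  have cS: "is_cat ?S" using fS by (simp add: finite_cat_def)
  \<comment> \<open>The apex \<open>(0, 0)\<close> of the span labels \<open>C'/m\<close>, and its two feet label the point and \<open>C'\<close>.\<close>
  define \<sigma> :: "'u \<Rightarrow> nat \<times> nat" where "\<sigma> f = (if Cod C f = m then (if f = Idn C m then (1, 0) else (0, 0)) else (0, 1))" for f
  have \<sigma>_ob: "\<sigma> f \<in> Ob span0" for f by (simp add: \<sigma>_def span0_ob)
  have im: "Cod C (Idn C m) = m" using cat_id[OF C m] by (simp add: hom_iff)
  have mono: "fst (\<sigma> f) \<le> fst (\<sigma> f') \<and> snd (\<sigma> f) \<le> snd (\<sigma> f')" if "k \<in> hom ?K f f'" for k f f'
    using cylinder_arrow_label[OF prem that] im by (auto simp: \<sigma>_def)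
  obtain v where v: "func ?K ?S v" "\<And>f. f \<in> Ob ?K \<Longrightarrow> FO v f = code (\<sigma> f)"
    by (rule span_functor[OF U cK, of \<sigma>]) (use \<sigma>_ob mono in blast)+
  have sv: "sfunc ?K ?S v" using v(1) small_finite_cat[OF U fK] small_finite_cat[OF U fS]
    by (simp add: sfunc_def)
  have inj: "inj (code :: nat \<times> nat \<Rightarrow> 'u)" using code_inj_instances(4)[OF U] .
  have thin: "f = f'" if "f \<in> hom ?S x y" "f' \<in> hom ?S x y" for f f' x y
    using that inj unfolding span_hom[OF U] by (auto simp: inj_eq)
  have pv: "preserves_universal D E F v"
  proof (rule preserves_universal_pointwise[OF U derD derE F sv])
    fix b assume b: "b \<in> Ob ?S"
    show "small_cat (over v b)" using small_slices(1)[OF U v(1) b fK fS] .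
    obtain s where s: "b = code s" "s \<in> Ob span0" using b span_ob[OF U] by auto
    let ?B = "{f. fst (\<sigma> f) \<le> fst s \<and> snd (\<sigma> f) \<le> snd s}"
    have B: "f \<in> ?B \<longleftrightarrow> hom ?S (FO v f) b \<noteq> {}" if f: "f \<in> Ob ?K" for f
    proof
      assume "f \<in> ?B"
      then have "code ((fst (\<sigma> f), fst s), (snd (\<sigma> f), snd s)) \<in> hom ?S (FO v f) b"
        unfolding span_hom[OF U] v(2)[OF f] s(1) using \<sigma>_ob s(2) by blast
      then show "hom ?S (FO v f) b \<noteq> {}" by blast
    next
      assume "hom ?S (FO v f) b \<noteq> {}"
      then show "f \<in> ?B" unfolding span_hom[OF U] v(2)[OF f] s(1) using inj
        by (auto simp: span_hom[OF U] inj_eq)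
    qed
    obtain G where "sfunc (full_subcat ?K ?B) (over v b) G"
      "\<And>D :: ('u, 'o, 'm) prederiv. prederivator D \<Longrightarrow> colimit_final D G"
      by (rule slice_over_poset[OF U v(1) b fK fS, of ?B]) (use thin B in blast)+
    then have G: "sfunc (piece C m ?B) (over v b) G"
      "\<And>D :: ('u, 'o, 'm) prederiv. prederivator D \<Longrightarrow> colimit_final D G"
      by (simp_all add: piece_def[OF prem])
    have "preserves_universal D E F (to_one (piece C m ?B))"
    proof -
      consider "s = (0, 0)" | "s = (0, 1)" | "s = (1, 0)" using s(2) by (auto simp: span0_ob)
      then show ?thesis
      proof cases
        case 1
        then have "?B = {f. Cod C f = m \<and> f \<noteq> Idn C m}" using im by (auto simp: \<sigma>_def)
        then show ?thesis using below by simp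
      next
        case 2
        then have "?B = - {Idn C m}" using im by (auto simp: \<sigma>_def)
        moreover obtain G' where "sfunc (full_subcat C (Ob C - {m})) (piece C m (- {Idn C m})) G'"
          "\<And>D :: ('u, 'o, 'm) prederiv. prederivator D \<Longrightarrow> colimit_final D G'"
          using bottom_piece_final[OF prem] by blast
        ultimately show ?thesis using pres_final[OF _ _ _ rest] D E by metis
      next
        case 3
        then have "?B = {f. Cod C f = m}" by (auto simp: \<sigma>_def)
        then show ?thesis
          using pres_final[OF top_piece_final(1)[OF prem D] top_piece_final(2)[OF prem D]
              top_piece_final(2)[OF prem E] preserves_one[OF U derD derE F]] by simp
      qed
    qed
    then show "preserves_universal D E F (to_one (over v b))"
      using pres_final[OF G(1) G(2)[OF D] G(2)[OF E]] by blast
  qed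
  note tS = sfunc_to_one[OF U small_finite_cat[OF U fS]]
  have "to_one ?S \<bullet> v = to_one ?K" using to_one_comp[OF v(1)] .
  then have "preserves_universal D E F (to_one ?K)"
    using preserves_universal_comp[OF U derD derE F sv tS pv span] by simp
  then show ?thesis
    using pres_final[OF cyl_proj_final(1)[OF prem derD] cyl_proj_final(2)[OF prem derD]
        cyl_proj_final(2)[OF prem derE]] by blast
qed

text \<open>
  Removing an object \<open>m\<close> of maximal height leaves fewer objects.  The category \<open>C'/m\<close> may have more
  objects than \<open>C\<close>, but their domains lie strictly below \<open>m\<close>, so the bound for the height drops.
\<close>

lemma graded_preserves:
  assumes empty: "preserves_universal D E F (to_one empty_cat)"
  shows "graded C n h \<Longrightarrow> preserves_universal D E F (to_one C)"
proof (induction n arbitrary: C h)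
  case 0
  then have "C = empty_cat" by (intro empty_cat_unique) (auto simp: graded_def finite_cat_def)
  then show ?case using empty by simp
next
  case (Suc n)
  note step = Suc.IH
  from Suc.prems show ?case
  proof (induction "card (Ob C)" arbitrary: C rule: less_induct)
    case (less C)
    have fC: "finite_cat C" and C: "is_cat C" and fin: "finite (Ob C)"
      using less.prems by (auto simp: graded_def finite_cat_def)
    have deg: "f = Idn C (Dom C f) \<or> h (Dom C f) < h (Cod C f)" if "f \<in> Ar C" for f
      using less.prems that by (simp add: graded_def)
    show ?case
    proof (cases "Ob C = {}")
      case True
      then show ?thesis using empty_cat_unique[OF C] empty by simp
    next
      case False
      then have "Max (h ` Ob C) \<in> h ` Ob C" using fin by simp
      then obtain m where m: "m \<in> Ob C" "h m = Max (h ` Ob C)" by (metis imageE)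
      have hm: "h x \<le> h m" if "x \<in> Ob C" for x using that m(2) fin by simp
      have max: "f = Idn C m" if "f \<in> Ar C" "Dom C f = m" for f
        using deg[OF that(1)] hm[OF Cod_ob[OF C that(1)]] that(2) by auto
      have mx: "maximal_ob C m" using m(1) max by (simp add: maximal_ob_def)
      note prem = U fC mx
      let ?P = "piece C m {f. Cod C f = m \<and> f \<noteq> Idn C m}"
      let ?R = "full_subcat C (Ob C - {m})"
      have "graded ?P n (\<lambda>f. h (Dom C f))"
        unfolding graded_def
      proof (intro conjI ballI)
        show "finite_cat ?P" using finite_piece[OF prem] .
        fix f assume "f \<in> Ob ?P"
        then have f: "f \<in> Ar C" "Cod C f = m" "f \<noteq> Idn C m"
          by (auto simp: piece_ob[OF prem] cyl_ob_def)
        have "f \<noteq> Idn C (Dom C f)"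
          using f cat_id[OF C Dom_ob[OF C f(1)]] by (metis (no_types, lifting) hom_iff)
        then have "h (Dom C f) < h m" using deg[OF f(1)] f(2) by auto
        moreover have "h m < Suc n" using less.prems m(1) by (simp add: graded_def)
        ultimately show "h (Dom C f) < n" by simp
      next
        fix k assume kP: "k \<in> Ar ?P"
        obtain f f' where k: "k \<in> hom ?P f f'" and ends: "Dom ?P k = f" "Cod ?P k = f'"
          using kP by (simp add: hom_iff)
        from k have "k \<in> hom (cylinder C m) f f'" "Cod C f = m" "Cod C f' = m" "f \<noteq> Idn C m"
          unfolding piece_hom[OF prem] by auto
        then obtain g where g: "k = code (f, g, f')" "f \<in> cyl_ob C m" "f' \<in> cyl_ob C m"
          "g \<in> hom C (Dom C f) (Dom C f')" "Cmp C f' g = f" "Cod C f = m" "Cod C f' = m" "f \<noteq> Idn C m"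
          unfolding cyl_hom[OF prem] by blast
        have "k = Idn ?P f \<or> h (Dom C f) < h (Dom C f')"
        proof (cases "g = Idn C (Dom C f)")
          case True
          have d: "Dom C f = Dom C f'"
            using g(4) cat_id[OF C, of "Dom C f"] cyl_ob_in[OF prem g(2)] True by (simp add: hom_iff)
          have "f' \<in> hom C (Dom C f') m" using cyl_ob_in[OF prem g(3)] g(7) by simp
          then have "Cmp C f' (Idn C (Dom C f')) = f'" by (rule cat_id_right[OF C])
          then have "f' = f" using g(5) unfolding True d[symmetric] by (rule trans[OF sym])
          then show ?thesis using g(1,6,8) True piece_id[OF prem g(2)] by simp
        next
          case False
          then show ?thesis using deg[of g] g(4) by (auto simp: hom_iff)
        qed
        then show "k = Idn ?P (Dom ?P k) \<or> h (Dom C (Dom ?P k)) < h (Dom C (Cod ?P k))"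
          unfolding ends .
      qed
      then have below: "preserves_universal D E F (to_one ?P)" by (rule step)
      have oR: "Ob ?R = Ob C - {m}" by (auto simp: full_subcat_simps)
      have "graded ?R (Suc n) h"
        unfolding graded_def
      proof (intro conjI ballI)
        show "finite_cat ?R" using finite_full_subcat[OF fC] .
        show "h x < Suc n" if "x \<in> Ob ?R" for x using that less.prems oR by (simp add: graded_def)
        fix f assume "f \<in> Ar ?R"
        then have "f \<in> hom ?R (Dom ?R f) (Cod ?R f)" by (simp add: hom_iff)
        then have f: "f \<in> hom C (Dom ?R f) (Cod ?R f)" "Dom ?R f \<in> Ob C - {m}"
          unfolding full_subcat_simps(3) by auto
        then have "f \<in> Ar C" "Dom C f = Dom ?R f" "Cod C f = Cod ?R f" by (simp_all add: hom_iff)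
        then show "f = Idn ?R (Dom ?R f) \<or> h (Dom ?R f) < h (Cod ?R f)"
          using deg[of f] f(2) full_subcat_simps(4)[of "Dom ?R f" C "Ob C - {m}"] by auto
      qed
      moreover have "card (Ob ?R) < card (Ob C)" unfolding oR using m(1) fin by (rule card_Diff1_less[rotated])
      ultimately have rest: "preserves_universal D E F (to_one ?R)" using less.hyps by blast
      show ?thesis using cylinder_preserves[OF less.prems mx below rest] by blast
    qed
  qed
qed

end

section \<open>Strictly homotopy finite categories are graded\<close>

text \<open>
  An infinite sequence \<open>s\<close> of composable arrows has an \<open>n\<close>-simplex of the nerve for every \<open>n\<close>: the
  chain of its first \<open>n\<close> arrows.
\<close>

fun path :: "('o, 'm) cat \<Rightarrow> (nat \<Rightarrow> 'm) \<Rightarrow> nat \<Rightarrow> nat \<Rightarrow> 'm" where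
  "path C s i 0 = Idn C (Dom C (s i))"
| "path C s i (Suc k) = Cmp C (s (i + k)) (path C s i k)"

definition simplex :: "('o, 'm) cat \<Rightarrow> (nat \<Rightarrow> 'm) \<Rightarrow> nat \<Rightarrow> (nat, nat \<times> nat, 'o, 'm) ftr" where
  "simplex C s n = mk_ftr (ord_cat n) C (\<lambda>i. Dom C (s i)) (\<lambda>(i, j). path C s i (j - i))"

definition composable :: "('o, 'm) cat \<Rightarrow> (nat \<Rightarrow> 'm) \<Rightarrow> bool" where
  "composable C s \<longleftrightarrow> (\<forall>i. s i \<in> hom C (Dom C (s i)) (Dom C (s (Suc i))))"

context
  fixes C :: "('o, 'm) cat" and s :: "nat \<Rightarrow> 'm"
  assumes C: "is_cat C" and s: "composable C s"
begin

lemma composable_step: "s i \<in> hom C (Dom C (s i)) (Dom C (s (Suc i)))"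
  using s by (simp add: composable_def)

lemma path_hom: "path C s i k \<in> hom C (Dom C (s i)) (Dom C (s (i + k)))"
proof (induction k)
  case 0
  have "Dom C (s i) \<in> Ob C" using hom_ob[OF C composable_step] by simp
  then show ?case using cat_id[OF C] by simp
next
  case (Suc k) then show ?case using cat_comp[OF C composable_step[of "i + k"]] by simp
qed

lemma path_add: "path C s i (k + l) = Cmp C (path C s (i + k) l) (path C s i k)"
proof (induction l)
  case 0 then show ?case using cat_id_left[OF C path_hom] by simp
next
  case (Suc l)
  have "path C s (i + k) l \<in> hom C (Dom C (s (i + k))) (Dom C (s (i + k + l)))" by (rule path_hom)
  then show ?case using Suc cat_assoc[OF C path_hom _ composable_step[of "i + k + l"]] by (simp add: add.assoc)
qed

lemma simplex_in: "simplex C s n \<in> Simp (nerve C) n"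
proof -
  have "func (ord_cat n) C (simplex C s n)"
    unfolding simplex_def
  proof (rule func_mk_ftr[OF is_cat_ord C], goal_cases)
    case (1 i) then show ?case using hom_ob[OF C composable_step] by simp
  next
    case (2 f i j) then show ?case using path_hom[of i "j - i"] by (auto simp: ord_cat_hom)
  next
    case (3 i) then show ?case by (simp add: ord_cat_def)
  next
    case (4 f g i j k)
    then have f: "f = (i, j)" "g = (j, k)" "i \<le> j" "j \<le> k" by (auto simp: ord_cat_hom)
    have "Cmp (ord_cat n) g f \<in> hom (ord_cat n) i k" using cat_comp[OF is_cat_ord 4(2,1)] .
    then have "Cmp (ord_cat n) g f = (i, k)" by (simp add: ord_cat_hom)
    then show ?case using path_add[of i "j - i" "k - j"] f by simp
  qed
  then show ?thesis by (simp add: nerve_def func_def)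
qed

text \<open>
  A simplex that factors through a shorter one factors through a map that identifies two neighbours \<open>i\<close>
  and \<open>i + 1\<close>, so its edge from \<open>i\<close> to \<open>i + 1\<close> is an identity.
\<close>

lemma simplex_nondegenerate:
  assumes nid: "\<And>i. i < n \<Longrightarrow> s i \<noteq> Idn C (Dom C (s i))"
  shows "\<not> degenerate (nerve C) n (simplex C s n)"
proof
  assume "degenerate (nerve C) n (simplex C s n)"
  then obtain l \<sigma> y where l: "l < n" and \<sigma>: "mono_on {..n} \<sigma>" "\<sigma> ` {..n} = {..l}"
    and y: "y \<in> Simp (nerve C) l" and eq: "simplex C s n = Act (nerve C) n l \<sigma> y"
    unfolding degenerate_def by blast
  have fy: "func (ord_cat l) C y" using y by (simp add: nerve_def func_def)
  have "\<not> inj_on \<sigma> {..n}"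
  proof
    assume "inj_on \<sigma> {..n}"
    then have "card (\<sigma> ` {..n}) = card {..n}" by (rule card_image)
    then show False using \<sigma>(2) l by simp
  qed
  then obtain i' j' where "i' \<le> n" "j' \<le> n" "i' \<noteq> j'" "\<sigma> i' = \<sigma> j'" unfolding inj_on_def by auto
  then obtain i j where ij: "i < j" "j \<le> n" "\<sigma> i = \<sigma> j" by (metis linorder_neqE_nat)
  have "\<sigma> i \<le> \<sigma> (Suc i)" "\<sigma> (Suc i) \<le> \<sigma> j"
    using ij(1,2) by (auto intro!: mono_onD[OF \<sigma>(1)])
  then have e: "\<sigma> (Suc i) = \<sigma> i" using ij(3) by simp
  have \<sigma>i: "\<sigma> i \<in> Ob (ord_cat l)" using ij \<sigma>(2) by (auto simp: ord_cat_def)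
  have a: "(i, Suc i) \<in> Ar (ord_cat n)" using ij by (simp add: ord_cat_def)
  have "FA (Act (nerve C) n l \<sigma> y) (i, Suc i) = FA y (\<sigma> i, \<sigma> i)"
    using a e by (simp add: nerve_def ord_ftr_def)
  also have "(\<sigma> i, \<sigma> i) = Idn (ord_cat l) (\<sigma> i)" using \<sigma>i by (simp add: ord_cat_def)
  finally have 1: "FA (simplex C s n) (i, Suc i) = Idn C (FO y (\<sigma> i))"
    using func_id[OF fy \<sigma>i] eq by simp
  have 2: "FA (simplex C s n) (i, Suc i) = s i"
    using a cat_id_right[OF C composable_step[of i]] by (simp add: simplex_def)
  have "FO y (\<sigma> i) \<in> Ob C" using func_ob[OF fy \<sigma>i] .
  from cat_id[OF C this] have "Dom C (s i) = FO y (\<sigma> i)" using 1 2 by (simp add: hom_iff)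
  then show False using nid[of i] 1 2 ij by simp
qed

end

text \<open>
  Objects are 0-simplices and nonidentity arrows are nondegenerate 1-simplices, so \<open>C\<close> is finite.  A cycle
  of nonidentity arrows could be traversed indefinitely and would give nondegenerate simplices of every
  dimension.  Without cycles, the number of objects with a nonempty path of nonidentity arrows to \<open>x\<close> is a
  height of \<open>x\<close>.
\<close>

lemma nerve_finite_graded:
  assumes C: "is_cat C" and fin: "finite_sset (nerve C)"
  obtains n h where "graded C n h"
proof -
  let ?N = "{(n, x). x \<in> Simp (nerve C) n \<and> \<not> degenerate (nerve C) n x}"
  have fN: "finite ?N" using fin by (simp add: finite_sset_def)
  have inN: "(n, simplex C s n) \<in> ?N"
    if "composable C s" "\<And>i. i < n \<Longrightarrow> s i \<noteq> Idn C (Dom C (s i))" for s n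
    using simplex_in[OF C that(1)] simplex_nondegenerate[OF C that] by simp
  have idn: "Idn C x \<in> Ar C" "Dom C (Idn C x) = x" "Cod C (Idn C x) = x" if "x \<in> Ob C" for x
    using cat_id[OF C that] by (simp_all add: hom_iff)
  have fO: "finite (Ob C)"
  proof -
    let ?f = "\<lambda>x. (0 :: nat, simplex C (\<lambda>_. Idn C x) 0)"
    have "?f ` Ob C \<subseteq> ?N"
      using inN by (intro image_subsetI) (simp add: composable_def hom_iff idn)
    moreover have "inj_on ?f (Ob C)"
    proof (rule inj_onI)
      fix x y assume xy: "x \<in> Ob C" "y \<in> Ob C" and "?f x = ?f y"
      then have "FO (simplex C (\<lambda>_. Idn C x) 0) 0 = FO (simplex C (\<lambda>_. Idn C y) 0) 0" by simp
      then show "x = y" using xy idn by (simp add: simplex_def ord_cat_def)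
    qed
    ultimately show ?thesis using fN finite_subset finite_imageD by blast
  qed
  have fA: "finite (Ar C)"
  proof -
    let ?A = "{f \<in> Ar C. f \<noteq> Idn C (Dom C f)}"
    \<comment> \<open>Only the first arrow matters for the 1-simplex; identities continue the sequence.\<close>
    let ?s = "\<lambda>f i. if i = 0 then f else Idn C (Cod C f)"
    let ?f = "\<lambda>f. (1 :: nat, simplex C (?s f) 1)"
    have comp: "composable C (?s f)" if "f \<in> Ar C" for f
      unfolding composable_def using that idn[OF Cod_ob[OF C that]] by (simp add: hom_iff)
    have "?f ` ?A \<subseteq> ?N" using inN[OF comp] by (intro image_subsetI) simp
    moreover have "inj_on ?f ?A"
    proof (rule inj_onI)
      have a: "FA (simplex C (?s f) 1) (0, 1) = f" if "f \<in> Ar C" for f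
        using cat_id_right[OF C, of f "Dom C f" "Cod C f"] that
        by (simp add: simplex_def ord_cat_def hom_iff)
      fix f g assume "f \<in> ?A" "g \<in> ?A" "?f f = ?f g"
      then show "f = g" using a[of f] a[of g] by simp
    qed
    ultimately have "finite ?A" using fN finite_subset finite_imageD by blast
    moreover have "Ar C \<subseteq> ?A \<union> Idn C ` Ob C" using Dom_ob[OF C] by blast
    ultimately show ?thesis using fO finite_subset by blast
  qed
  define R where "R = {(Dom C f, Cod C f) | f. f \<in> Ar C \<and> f \<noteq> Idn C (Dom C f)}"
  have acyclic: "(x, x) \<notin> R\<^sup>+" for x
  proof
    assume x: "(x, x) \<in> R\<^sup>+"
    have next_step: "\<exists>f. f \<in> Ar C \<and> f \<noteq> Idn C (Dom C f) \<and> Dom C f = y \<and> (Cod C f, x) \<in> R\<^sup>+"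
      if y: "(y, x) \<in> R\<^sup>+" for y
    proof -
      obtain z where z: "(y, z) \<in> R" "(z, x) \<in> R\<^sup>*" using tranclD[OF y] by blast
      then have "(z, x) \<in> R\<^sup>+" using x by (metis rtranclD)
      then show ?thesis using z(1) unfolding R_def by blast
    qed
    define P where "P f \<longleftrightarrow> f \<in> Ar C \<and> f \<noteq> Idn C (Dom C f) \<and> (Cod C f, x) \<in> R\<^sup>+" for f
    have "\<exists>s. \<forall>n. P (s n) \<and> Dom C (s (Suc n)) = Cod C (s n)"
    proof (rule dependent_nat_choice)
      show "\<exists>f. P f" using next_step[OF x] by (auto simp: P_def)
      show "\<exists>g. P g \<and> Dom C g = Cod C f" if "P f" for f n
        using next_step[of "Cod C f"] that by (auto simp: P_def)
    qed
    then obtain s where s: "\<And>n. P (s n)" "\<And>n. Dom C (s (Suc n)) = Cod C (s n)" by blast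
    have "composable C s" using s by (simp add: composable_def hom_iff P_def)
    then have "range (\<lambda>n. (n, simplex C s n)) \<subseteq> ?N"
      using inN s(1) by (auto simp: P_def)
    then have "finite (range (\<lambda>n. (n, simplex C s n)))" using fN finite_subset by blast
    then have "finite (UNIV :: nat set)" by (rule finite_imageD) (simp add: inj_on_def)
    then show False by simp
  qed
  define h where "h y = card {x \<in> Ob C. (x, y) \<in> R\<^sup>+}" for y
  have "graded C (Suc (card (Ob C))) h"
    unfolding graded_def
  proof (intro conjI ballI)
    show "finite_cat C" using C fO fA by (simp add: finite_cat_def)
    show "h x < Suc (card (Ob C))" if "x \<in> Ob C" for x
      unfolding h_def using card_mono[OF fO, of "{y \<in> Ob C. (y, x) \<in> R\<^sup>+}"] by auto
    fix f assume f: "f \<in> Ar C"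
    show "f = Idn C (Dom C f) \<or> h (Dom C f) < h (Cod C f)"
    proof (cases "f = Idn C (Dom C f)")
      case False
      then have r: "(Dom C f, Cod C f) \<in> R" using f by (auto simp: R_def)
      have "{x \<in> Ob C. (x, Dom C f) \<in> R\<^sup>+} \<subset> {x \<in> Ob C. (x, Cod C f) \<in> R\<^sup>+}"
      proof (rule psubsetI)
        show "{x \<in> Ob C. (x, Dom C f) \<in> R\<^sup>+} \<subseteq> {x \<in> Ob C. (x, Cod C f) \<in> R\<^sup>+}"
          using trancl_into_trancl[OF _ r] by blast
        have "Dom C f \<in> {x \<in> Ob C. (x, Cod C f) \<in> R\<^sup>+}" using r Dom_ob[OF C f] by blast
        moreover have "Dom C f \<notin> {x \<in> Ob C. (x, Dom C f) \<in> R\<^sup>+}" using acyclic by simp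
        ultimately show "{x \<in> Ob C. (x, Dom C f) \<in> R\<^sup>+} \<noteq> {x \<in> Ob C. (x, Cod C f) \<in> R\<^sup>+}" by metis
      qed
      then show ?thesis unfolding h_def by (intro disjI2 psubset_card_mono) (simp_all add: fO)
    qed simp
  qed
  then show thesis using that by blast
qed

section \<open>Homotopy finite shapes and the theorem\<close>

lemma homotopy_finite_final:
  fixes C :: "'u scat"
  assumes U: "universe TYPE('u)" and C: "homotopy_finite C"
  obtains K n h G where "graded K n h" "sfunc K C G"
    "\<And>D :: ('u, 'o, 'm) prederiv. prederivator D \<Longrightarrow> colimit_final D G"
proof -
  obtain K :: "'u scat" where sC: "small_cat C" and K: "strictly_homotopy_finite K"
    and eq: "equivalent_cats C K"
    using C unfolding homotopy_finite_def by blast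
  have sK: "small_cat K" and fin: "finite_sset (nerve K)"
    using K by (auto simp: strictly_homotopy_finite_def)
  obtain n h where g: "graded K n h"
    using nerve_finite_graded[OF _ fin] sK by (auto simp: small_cat_def)
  obtain l where "equivalence_ftr l" "Src l = C" "Trg l = K" using eq unfolding equivalent_cats_def by blast
  then obtain G \<alpha> \<beta> where l: "is_ftr l" "Src l = C" "Trg l = K" and G: "is_ftr G" "Src G = K" "Trg G = C"
    and a: "nat_iso \<alpha>" "NDom \<alpha> = id_ftr C" "NCod \<alpha> = G \<bullet> l"
    and b: "nat_iso \<beta>" "NDom \<beta> = l \<bullet> G" "NCod \<beta> = id_ftr K"
    unfolding equivalence_ftr_def by auto
  have sG: "sfunc K C G" and sl: "sfunc C K l" using l G sC sK by (auto simp: sfunc_def func_def)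
  have "sntr C C (id_ftr C) (G \<bullet> l) \<alpha>" "sntr K K (l \<bullet> G) (id_ftr K) \<beta>"
    using a b sfunc_id[OF sC] sfunc_comp[OF sG sl] by (auto simp: sntr_def ntr_def nat_iso_def)
  then show thesis using that[OF g sG] colimit_final_equivalence[OF U _ sG sl _ a(1) _ b(1)] by blast
qed

theorem theorem9p14:
  fixes D E :: "('u, 'o, 'm) prederiv"
    and F :: "('u, 'o, 'm) dmor"
    and u :: "'u sftr"
  assumes "universe TYPE('u)"
    and "derivator D" and "derivator E"
    and "derivator_morphism D E F"
    and "right_exact D E F"
    and "left_homotopy_finite TYPE('o \<times> 'm) u"
  shows "preserves_left_kan D E F u"
proof -
  note U = assms(1) and der = assms(2,3) and F = assms(4)
  note D = derivator_prederivator[OF der(1)] and E = derivator_prederivator[OF der(2)]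
  note iff = preserves_left_kan_iff[OF U der F]
  have fin_empty: "finite_cat (empty_cat :: 'u scat)"
    using is_cat_empty by (simp add: finite_cat_def empty_cat_def)
  have "preserves_left_kan D E F (to_one empty_cat)" "preserves_left_kan D E F (to_one span_cat)"
    using assms(5) by (auto simp: right_exact_def preserves_colimits_def)
  then have empty: "preserves_universal D E F (to_one empty_cat)"
    and span: "preserves_universal D E F (to_one span_cat)"
    using iff[OF sfunc_to_one[OF U small_finite_cat[OF U fin_empty]]]
      iff[OF sfunc_to_one[OF U small_finite_cat[OF U finite_cat_span[OF U]]]] by auto
  have u: "sfunc (Src u) (Trg u) u" using assms(6) sfunc_iff by (auto simp: left_homotopy_finite_def)
  have slices: "small_cat (over u b) \<and> preserves_universal D E F (to_one (over u b))"
    if b: "b \<in> Ob (Trg u)" for b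
  proof -
    obtain v where v: "homotopy_finite (Src v)" "Trg v = over u b" "homotopy_final TYPE('o \<times> 'm) v"
      using assms(6) b unfolding left_homotopy_finite_def by blast
    then have "small_ftr v" unfolding homotopy_final_def by blast
    then have sv: "sfunc (Src v) (over u b) v" using v(2) sfunc_iff[of v] by simp
    obtain K n h G where K: "graded K n h" "sfunc K (Src v) G"
      "\<And>D :: ('u, 'o, 'm) prederiv. prederivator D \<Longrightarrow> colimit_final D G"
      using homotopy_finite_final[OF U v(1)] by blast
    have "preserves_universal D E F (to_one K)" using graded_preserves[OF U der F span empty K(1)] .
    then have "preserves_universal D E F (to_one (Src v))"
      using preserves_colimits_final[OF U der F K(2) K(3)[OF D] K(3)[OF E]] by blast
    then have "preserves_universal D E F (to_one (over u b))"
      using preserves_colimits_final[OF U der F sv homotopy_final_colimit_final[OF U der(1) v(3)]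
          homotopy_final_colimit_final[OF U der(2) v(3)]] by blast
    then show ?thesis using sfunc_small(2)[OF sv] by blast
  qed
  then have "preserves_universal D E F u"
    using preserves_universal_pointwise[OF U der F u] by blast
  then show ?thesis using iff[OF u] by blast
qed

end
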